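(* Let $n\ge3$, $\mathbf{char}(q)=\ell\ge3$, $m\ge1$ an integer and $0\le s\le n$. If $q$ is a primitive $\ell$-th root of unity or $m$ is even, then the cohomology group $H^s(\Omega_q(n,\mathbf m))$ is isomorphic, as a $\mathfrak u_q(\mathfrak{sl}_n)$-module, to the direct sum of $\binom ns$ trivial $\mathfrak u_q(\mathfrak{sl}_n)$-modules. If $q$ is a primitive $2\ell$-th root of unity and $m$ is odd, then $H^s(\Omega_q(n,\mathbf m))$ is isomorphic to the direct sum of $\binom ns$ sign-trivial $\mathfrak u_q(\mathfrak{sl}_n)$-modules.
   Context: $k$ is an algebraically closed field of characteristic $0$ and $q\in k^*$, $q\ne\pm1$. $[a]=\frac{q^a-q^{-a}}{q-q^{-1}}$; $\mathbf{char}(q)$ is the smallest positive integer $\ell$ with $[\ell]=0$ (so $q$ is either a primitive $2\ell$-th root of unity, or $\ell$ is odd and $q$ is a primitive $\ell$-th root of unity). $U_q(\mathfrak{sl}_n)$ is the usual quantum group with generators $e_i,f_i,K_i^{\pm1}$ ($1\le i\le n-1$) and coproduct $\Delta(K_i^{\pm1})=K_i^{\pm1}\otimes K_i^{\pm1}$, $\Delta(e_i)=e_i\otimes K_i+1\otimes e_i$, $\Delta(f_i)=f_i\otimes1+K_i^{-1}\otimes f_i$; counit $\epsilon(K_i^{\pm1})=1$, $\epsilon(e_i)=\epsilon(f_i)=0$. $\mathfrak u_q(\mathfrak{sl}_n)=U_q(\mathfrak{sl}_n)/(e_i^\ell,f_i^\ell,K_i^{2\ell}-1)$. $\mathcal A_q(n)$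 is the $k$-vector space with basis $\{x^{(\alpha)}\mid\alpha\in\mathbb Z_+^n\}$ ($\mathbb Z_+$ = nonnegative integers); $x^{(\beta)}:=0$ if $\beta\notin\mathbb Z_+^n$; $\varepsilon_i$ is the $i$-th unit vector; $\mathfrak u_q(\mathfrak{sl}_n)$ acts by $e_i.x^{(\beta)}=[\beta_i+1]x^{(\beta+\varepsilon_i-\varepsilon_{i+1})}$, $f_i.x^{(\beta)}=[\beta_{i+1}+1]x^{(\beta-\varepsilon_i+\varepsilon_{i+1})}$, $K_i^{\pm1}.x^{(\beta)}=q^{\pm(\beta_i-\beta_{i+1})}x^{(\beta)}$. For $\beta\in\mathbb Z^n$, $\varepsilon_i*\beta=\sum_{j<i}\beta_j$. $\wedge_q(n)=k\{dx_1,\dots,dx_n\}/((dx_i)^2,\ dx_jdx_i+q^{-1}dx_idx_j\ (i<j))$, product written $\wedge$, with degree $s$ part $\wedge_q(n)_{(s)}$; it is a $\mathfrak u_q(\mathfrak{sl}_n)$-module algebra via $e_i.dx_j=\delta_{i+1,j}dx_i$, $f_i.dx_j=\delta_{ij}dx_{i+1}$, $K_i.dx_j=q^{\delta_{ij}-\delta_{i+1,j}}dx_j$. $\Omega_q(n)^{(s)}=\mathcal A_q(n)\otimes_k\wedge_q(n)_{(s)}$ is the tensor product module, and $$d^s(x^{(\alpha)}\otimes dx_{i_1}\wedge\cdots\wedge dx_{i_s})=\sum_{j=1}^nq^{-\varepsilon_j*\alpha}x^{(\alpha-\varepsilon_j)}\otimes dx_j\wedge dx_{i_1}\wedge\cdots\wedge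 dx_{i_s}$$ defines $\mathfrak u_q(\mathfrak{sl}_n)$-module homomorphisms $d^s:\Omega_q(n)^{(s)}\to\Omega_q(n)^{(s+1)}$ with $d^{s+1}d^s=0$ ($d^n=0$, $d^{-1}=0$). With $\mathcal A_q(n,\mathbf m)=\mathrm{span}_k\{x^{(\alpha)}\mid\alpha\in\mathbb Z_+^n,\ \alpha_i\le m\ell-1\ \forall i\}$ (a submodule), $\Omega_q(n,\mathbf m)^{(s)}=\mathcal A_q(n,\mathbf m)\otimes\wedge_q(n)_{(s)}$ is a subcomplex of modules, and $H^s(\Omega_q(n,\mathbf m))=\ker d^s/\mathrm{Im}\,d^{s-1}$ is its $s$-th cohomology module. A one-dimensional $\mathfrak u_q(\mathfrak{sl}_n)$-module spanned by $v\ne0$ is sign-trivial if $e_i.v=f_i.v=0$ and $K_i.v=\epsilon_iv$ with $\epsilon_i\in\{1,-1\}$ for $i=1,\dots,n-1$; it is trivial if all $\epsilon_i=1$. *)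

theory Defs
  imports
    "HOL-Computational_Algebra.Polynomial"
    "HOL-Library.Poly_Mapping"
    "HOL-Algebra.QuotRing"
    "HOL-Algebra.Module"
begin

section \<open>Quantum integers and roots of unity\<close>

definition qint :: "'k::field \<Rightarrow> int \<Rightarrow> 'k" where
  "qint q a = (q powi a - q powi (- a)) / (q - inverse q)"

definition has_qchar :: "'k::field \<Rightarrow> nat \<Rightarrow> bool" where
  "has_qchar q l \<longleftrightarrow> 0 < l \<and> qint q (int l) = 0 \<and> (\<forall>j. 0 < j \<and> j < l \<longrightarrow> qint q (int j) \<noteq> 0)"

definition primitive_root_of_unity :: "'k::field \<Rightarrow> nat \<Rightarrow> bool" where
  "primitive_root_of_unity q r \<longleftrightarrow> 0 < r \<and> q ^ r = 1 \<and> (\<forall>j. 0 < j \<and> j < r \<longrightarrow> q ^ j \<noteq> 1)"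


section \<open>Algebras given by generators and relations\<close>

text \<open>Lists form the free monoid, so that \<open>'g list \<Rightarrow>\<^sub>0 'k\<close>, with the convolution product of
  \<^theory>\<open>HOL-Library.Poly_Mapping\<close>, is the free associative algebra on \<open>'g\<close>.\<close>

instantiation list :: (type) monoid_add
begin
definition zero_list :: "'a list" where "zero_list = []"
definition plus_list :: "'a list \<Rightarrow> 'a list \<Rightarrow> 'a list" where "plus_list xs ys = xs @ ys"
instance by standard (simp_all add: zero_list_def plus_list_def)
end

abbreviation mon :: "'g list \<Rightarrow> ('g list \<Rightarrow>\<^sub>0 'k::field)" where
  "mon w \<equiv> Poly_Mapping.single w 1"

abbreviation cst :: "'k::field \<Rightarrow> ('g list \<Rightarrow>\<^sub>0 'k)" where
  "cst c \<equiv> Poly_Mapping.single [] c"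

definition free_algebra :: "'g set \<Rightarrow> ('g list \<Rightarrow>\<^sub>0 'k::field) ring" where
  "free_algebra X = \<lparr>carrier = {p. Poly_Mapping.keys p \<subseteq> lists X},
     mult = (*), one = 1, zero = 0, add = (+)\<rparr>"

definition presented_algebra ::
    "'g set \<Rightarrow> ('g list \<Rightarrow>\<^sub>0 'k::field) set \<Rightarrow> ('g list \<Rightarrow>\<^sub>0 'k) set ring" where
  "presented_algebra X R = free_algebra X Quot (Idl\<^bsub>free_algebra X\<^esub> R)"

definition presented_class ::
    "'g set \<Rightarrow> ('g list \<Rightarrow>\<^sub>0 'k::field) set \<Rightarrow> ('g list \<Rightarrow>\<^sub>0 'k) \<Rightarrow> ('g list \<Rightarrow>\<^sub>0 'k) set" where
  "presented_class X R p = Idl\<^bsub>free_algebra X\<^esub> R +>\<^bsub>free_algebra X\<^esub> p"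


section \<open>The small quantum group\<close>

text \<open>\<open>Ki i\<close> stands for the generator \<open>K\<^sub>i\<close> inverse.\<close>

datatype ugen = E nat | F nat | K nat | Ki nat

definition uq_gens :: "nat \<Rightarrow> ugen set" where
  "uq_gens n = (\<Union>i\<in>{1..n-1}. {E i, F i, K i, Ki i})"

definition cartan :: "nat \<Rightarrow> nat \<Rightarrow> int" where
  "cartan i j = (if i = j then 2 else if j = Suc i \<or> i = Suc j then - 1 else 0)"

inductive_set Uq_rels :: "'k::field \<Rightarrow> nat \<Rightarrow> (ugen list \<Rightarrow>\<^sub>0 'k) set"
  for q :: 'k and n :: nat where
  KKi: "i \<in> {1..n-1} \<Longrightarrow> mon [K i, Ki i] - 1 \<in> Uq_rels q n"
| KiK: "i \<in> {1..n-1} \<Longrightarrow> mon [Ki i, K i] - 1 \<in> Uq_rels q n"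
| KK: "i \<in> {1..n-1} \<Longrightarrow> j \<in> {1..n-1} \<Longrightarrow> mon [K i, K j] - mon [K j, K i] \<in> Uq_rels q n"
| KE: "i \<in> {1..n-1} \<Longrightarrow> j \<in> {1..n-1} \<Longrightarrow>
    mon [K i, E j, Ki i] - cst (q powi cartan i j) * mon [E j] \<in> Uq_rels q n"
| KF: "i \<in> {1..n-1} \<Longrightarrow> j \<in> {1..n-1} \<Longrightarrow>
    mon [K i, F j, Ki i] - cst (q powi (- cartan i j)) * mon [F j] \<in> Uq_rels q n"
| EF: "i \<in> {1..n-1} \<Longrightarrow> j \<in> {1..n-1} \<Longrightarrow>
    mon [E i, F j] - mon [F j, E i]
      - (if i = j then cst (inverse (q - inverse q)) * (mon [K i] - mon [Ki i]) else 0)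
      \<in> Uq_rels q n"
| EE: "i \<in> {1..n-1} \<Longrightarrow> j \<in> {1..n-1} \<Longrightarrow> cartan i j = 0 \<Longrightarrow>
    mon [E i, E j] - mon [E j, E i] \<in> Uq_rels q n"
| FF: "i \<in> {1..n-1} \<Longrightarrow> j \<in> {1..n-1} \<Longrightarrow> cartan i j = 0 \<Longrightarrow>
    mon [F i, F j] - mon [F j, F i] \<in> Uq_rels q n"
| serreE: "i \<in> {1..n-1} \<Longrightarrow> j \<in> {1..n-1} \<Longrightarrow> cartan i j = - 1 \<Longrightarrow>
    mon [E i, E i, E j] - cst (q + inverse q) * mon [E i, E j, E i] + mon [E j, E i, E i]
      \<in> Uq_rels q n"
| serreF: "i \<in> {1..n-1} \<Longrightarrow> j \<in> {1..n-1} \<Longrightarrow> cartan i j = - 1 \<Longrightarrow>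
    mon [F i, F i, F j] - cst (q + inverse q) * mon [F i, F j, F i] + mon [F j, F i, F i]
      \<in> Uq_rels q n"

definition small_rels :: "'k::field \<Rightarrow> nat \<Rightarrow> nat \<Rightarrow> (ugen list \<Rightarrow>\<^sub>0 'k) set" where
  "small_rels q n l = Uq_rels q n \<union>
     (\<Union>i\<in>{1..n-1}. {mon (replicate l (E i)), mon (replicate l (F i)),
                       mon (replicate (2 * l) (K i)) - 1})"

definition small_uq :: "'k::field \<Rightarrow> nat \<Rightarrow> nat \<Rightarrow> (ugen list \<Rightarrow>\<^sub>0 'k) set ring" where
  "small_uq q n l = presented_algebra (uq_gens n) (small_rels q n l)"

definition uq_class :: "'k::field \<Rightarrow> nat \<Rightarrow> nat \<Rightarrow> (ugen list \<Rightarrow>\<^sub>0 'k) \<Rightarrow> (ugen list \<Rightarrow>\<^sub>0 'k) set" where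
  "uq_class q n l = presented_class (uq_gens n) (small_rels q n l)"


section \<open>Modules over a not necessarily commutative ring\<close>

text \<open>The record type \<^typ>\<open>('a, 'b) module\<close> of HOL-Algebra is used, but its locale requires a
  commutative ring of scalars.  The fields \<open>mult\<close> and \<open>one\<close> of the record carry no meaning.\<close>

locale left_module = R?: ring R + M?: abelian_group M
  for R :: "'r ring" (structure) and M :: "('r, 'v) module" (structure) +
  assumes left_smult_closed:
      "a \<in> carrier R \<Longrightarrow> x \<in> carrier M \<Longrightarrow> a \<odot>\<^bsub>M\<^esub> x \<in> carrier M"
    and left_smult_l_distr: "a \<in> carrier R \<Longrightarrow> b \<in> carrier R \<Longrightarrow> x \<in> carrier M \<Longrightarrow>
      (a \<oplus>\<^bsub>R\<^esub> b) \<odot>\<^bsub>M\<^esub> x = a \<odot>\<^bsub>M\<^esub> x \<oplus>\<^bsub>M\<^esub> b \<odot>\<^bsub>M\<^esub> x"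
    and left_smult_r_distr: "a \<in> carrier R \<Longrightarrow> x \<in> carrier M \<Longrightarrow> y \<in> carrier M \<Longrightarrow>
      a \<odot>\<^bsub>M\<^esub> (x \<oplus>\<^bsub>M\<^esub> y) = a \<odot>\<^bsub>M\<^esub> x \<oplus>\<^bsub>M\<^esub> a \<odot>\<^bsub>M\<^esub> y"
    and left_smult_assoc: "a \<in> carrier R \<Longrightarrow> b \<in> carrier R \<Longrightarrow> x \<in> carrier M \<Longrightarrow>
      (a \<otimes>\<^bsub>R\<^esub> b) \<odot>\<^bsub>M\<^esub> x = a \<odot>\<^bsub>M\<^esub> (b \<odot>\<^bsub>M\<^esub> x)"
    and left_smult_one: "x \<in> carrier M \<Longrightarrow> \<one>\<^bsub>R\<^esub> \<odot>\<^bsub>M\<^esub> x = x"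

definition module_isomorphic :: "'r ring \<Rightarrow> ('r, 'v) module \<Rightarrow> ('r, 'w) module \<Rightarrow> bool" where
  "module_isomorphic R M N \<longleftrightarrow> left_module R M \<and> left_module R N \<and>
     (\<exists>h. bij_betw h (carrier M) (carrier N) \<and>
        (\<forall>x\<in>carrier M. \<forall>y\<in>carrier M. h (x \<oplus>\<^bsub>M\<^esub> y) = h x \<oplus>\<^bsub>N\<^esub> h y) \<and>
        (\<forall>a\<in>carrier R. \<forall>x\<in>carrier M. h (a \<odot>\<^bsub>M\<^esub> x) = a \<odot>\<^bsub>N\<^esub> h x))"

definition direct_sum :: "nat \<Rightarrow> (nat \<Rightarrow> ('r, 'v) module) \<Rightarrow> ('r, nat \<Rightarrow> 'v) module" where
  "direct_sum N M = \<lparr>carrier = (\<Pi>\<^sub>E j\<in>{..<N}. carrier (M j)),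
     mult = undefined, one = undefined,
     zero = (\<lambda>j\<in>{..<N}. \<zero>\<^bsub>M j\<^esub>),
     add = (\<lambda>f g. \<lambda>j\<in>{..<N}. f j \<oplus>\<^bsub>M j\<^esub> g j),
     smult = (\<lambda>a f. \<lambda>j\<in>{..<N}. a \<odot>\<^bsub>M j\<^esub> f j)\<rparr>"

definition quotient_module :: "('r, 'v) module \<Rightarrow> 'v set \<Rightarrow> ('r, 'v set) module" where
  "quotient_module M N = \<lparr>carrier = a_rcosets\<^bsub>M\<^esub> N,
     mult = undefined, one = undefined,
     zero = N, add = set_add M,
     smult = (\<lambda>a C. N +>\<^bsub>M\<^esub> (a \<odot>\<^bsub>M\<^esub> (SOME x. x \<in> C)))\<rparr>"

text \<open>In the next two definitions the field acts through its image in the algebra.\<close>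

definition sign_trivial_module ::
    "'k::field \<Rightarrow> nat \<Rightarrow> nat \<Rightarrow> ((ugen list \<Rightarrow>\<^sub>0 'k) set, 'v) module \<Rightarrow> bool" where
  "sign_trivial_module q n l M \<longleftrightarrow> left_module (small_uq q n l) M \<and>
     (\<exists>v\<in>carrier M. v \<noteq> \<zero>\<^bsub>M\<^esub> \<and>
        carrier M = (\<lambda>c. uq_class q n l (cst c) \<odot>\<^bsub>M\<^esub> v) ` UNIV \<and>
        (\<forall>i\<in>{1..n-1}.
           uq_class q n l (mon [E i]) \<odot>\<^bsub>M\<^esub> v = \<zero>\<^bsub>M\<^esub> \<and>
           uq_class q n l (mon [F i]) \<odot>\<^bsub>M\<^esub> v = \<zero>\<^bsub>M\<^esub> \<and>
           (\<exists>\<epsilon>\<in>{1, - 1}. uq_class q n l (mon [K i]) \<odot>\<^bsub>M\<^esub> v = uq_class q n l (cst \<epsilon>) \<odot>\<^bsub>M\<^esub> v)))"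

definition trivial_module ::
    "'k::field \<Rightarrow> nat \<Rightarrow> nat \<Rightarrow> ((ugen list \<Rightarrow>\<^sub>0 'k) set, 'v) module \<Rightarrow> bool" where
  "trivial_module q n l M \<longleftrightarrow> left_module (small_uq q n l) M \<and>
     (\<exists>v\<in>carrier M. v \<noteq> \<zero>\<^bsub>M\<^esub> \<and>
        carrier M = (\<lambda>c. uq_class q n l (cst c) \<odot>\<^bsub>M\<^esub> v) ` UNIV \<and>
        (\<forall>i\<in>{1..n-1}.
           uq_class q n l (mon [E i]) \<odot>\<^bsub>M\<^esub> v = \<zero>\<^bsub>M\<^esub> \<and>
           uq_class q n l (mon [F i]) \<odot>\<^bsub>M\<^esub> v = \<zero>\<^bsub>M\<^esub> \<and>
           uq_class q n l (mon [K i]) \<odot>\<^bsub>M\<^esub> v = v))"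


section \<open>The quantum divided power algebra\<close>

text \<open>Exponents live in \<open>\<int>\<^sup>n\<close>, as integer functions vanishing outside \<open>{1..n}\<close>, so that
  \<open>x\<^sup>(\<^sup>\<beta>\<^sup>)\<close> can literally be set to zero when some \<open>\<beta>\<^sub>i\<close> is negative.\<close>

definition exps :: "nat \<Rightarrow> (nat \<Rightarrow> int) set" where
  "exps n = {\<beta>. (\<forall>i\<in>{1..n}. 0 \<le> \<beta> i) \<and> (\<forall>i. i \<notin> {1..n} \<longrightarrow> \<beta> i = 0)}"

definition trunc_exps :: "nat \<Rightarrow> nat \<Rightarrow> nat \<Rightarrow> (nat \<Rightarrow> int) set" where
  "trunc_exps n l m = {\<beta> \<in> exps n. \<forall>i\<in>{1..n}. \<beta> i \<le> int m * int l - 1}"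

definition xterm :: "nat \<Rightarrow> 'k::field \<Rightarrow> (nat \<Rightarrow> int) \<Rightarrow> ((nat \<Rightarrow> int) \<Rightarrow>\<^sub>0 'k)" where
  "xterm n c \<beta> = (if \<beta> \<in> exps n then Poly_Mapping.single \<beta> c else 0)"

text \<open>The action of a generator on the basis vector \<open>x\<^sup>(\<^sup>\<beta>\<^sup>)\<close>.\<close>

fun A_act :: "'k::field \<Rightarrow> nat \<Rightarrow> ugen \<Rightarrow> (nat \<Rightarrow> int) \<Rightarrow> ((nat \<Rightarrow> int) \<Rightarrow>\<^sub>0 'k)" where
  "A_act q n (E i) \<beta> =
     xterm n (qint q (\<beta> i + 1)) (\<beta>(i := \<beta> i + 1, Suc i := \<beta> (Suc i) - 1))"
| "A_act q n (F i) \<beta> =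
     xterm n (qint q (\<beta> (Suc i) + 1)) (\<beta>(i := \<beta> i - 1, Suc i := \<beta> (Suc i) + 1))"
| "A_act q n (K i) \<beta> = xterm n (q powi (\<beta> i - \<beta> (Suc i))) \<beta>"
| "A_act q n (Ki i) \<beta> = xterm n (q powi (- (\<beta> i - \<beta> (Suc i)))) \<beta>"


section \<open>The quantum exterior algebra\<close>

definition wedge_rels :: "'k::field \<Rightarrow> nat \<Rightarrow> (nat list \<Rightarrow>\<^sub>0 'k) set" where
  "wedge_rels q n = {mon [i, i] | i. i \<in> {1..n}} \<union>
     {mon [j, i] + cst (inverse q) * mon [i, j] | i j. i \<in> {1..n} \<and> j \<in> {1..n} \<and> i < j}"

definition wedge :: "'k::field \<Rightarrow> nat \<Rightarrow> (nat list \<Rightarrow>\<^sub>0 'k) set ring" where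
  "wedge q n = presented_algebra {1..n} (wedge_rels q n)"

definition wedge_class :: "'k::field \<Rightarrow> nat \<Rightarrow> (nat list \<Rightarrow>\<^sub>0 'k) \<Rightarrow> (nat list \<Rightarrow>\<^sub>0 'k) set" where
  "wedge_class q n = presented_class {1..n} (wedge_rels q n)"

definition wedge_deg :: "'k::field \<Rightarrow> nat \<Rightarrow> nat \<Rightarrow> (nat list \<Rightarrow>\<^sub>0 'k) set set" where
  "wedge_deg q n s = wedge_class q n `
     {p. \<forall>w\<in>Poly_Mapping.keys p. w \<in> lists {1..n} \<and> length w = s}"

definition wedge_scale ::
    "'k::field \<Rightarrow> nat \<Rightarrow> 'k \<Rightarrow> (nat list \<Rightarrow>\<^sub>0 'k) set \<Rightarrow> (nat list \<Rightarrow>\<^sub>0 'k) set" where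
  "wedge_scale q n c w = wedge_class q n (cst c) \<otimes>\<^bsub>wedge q n\<^esub> w"

fun dx_act :: "'k::field \<Rightarrow> ugen \<Rightarrow> nat \<Rightarrow> (nat list \<Rightarrow>\<^sub>0 'k)" where
  "dx_act q (E i) j = (if j = Suc i then mon [i] else 0)"
| "dx_act q (F i) j = (if j = i then mon [Suc i] else 0)"
| "dx_act q (K i) j = Poly_Mapping.single [j] (q powi (of_bool (j = i) - of_bool (j = Suc i)))"
| "dx_act q (Ki i) j = Poly_Mapping.single [j] (q powi (- (of_bool (j = i) - of_bool (j = Suc i))))"

text \<open>The module algebra structure is determined on products by the coproduct
  \<open>\<Delta>(e\<^sub>i) = e\<^sub>i \<otimes> K\<^sub>i + 1 \<otimes> e\<^sub>i\<close>, \<open>\<Delta>(f\<^sub>i) = f\<^sub>i \<otimes> 1 + K\<^sub>i\<^sup>-\<^sup>1 \<otimes> f\<^sub>i\<close>, \<open>\<Delta>(K\<^sub>i) = K\<^sub>i \<otimes> K\<^sub>i\<close>, and on \<open>1\<close> by the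
  counit.  It is defined on words first, then linearly on the free algebra, and then passes to the
  quotient (for \<open>1 \<le> i < n\<close> the relations are preserved).\<close>

fun word_act :: "'k::field \<Rightarrow> ugen \<Rightarrow> nat list \<Rightarrow> (nat list \<Rightarrow>\<^sub>0 'k)" where
  "word_act q (E i) [] = 0"
| "word_act q (F i) [] = 0"
| "word_act q (K i) [] = 1"
| "word_act q (Ki i) [] = 1"
| "word_act q (E i) (j # w) = dx_act q (E i) j * word_act q (K i) w + mon [j] * word_act q (E i) w"
| "word_act q (F i) (j # w) = dx_act q (F i) j * mon w + dx_act q (Ki i) j * word_act q (F i) w"
| "word_act q (K i) (j # w) = dx_act q (K i) j * word_act q (K i) w"
| "word_act q (Ki i) (j # w) = dx_act q (Ki i) j * word_act q (Ki i) w"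

definition free_act :: "'k::field \<Rightarrow> ugen \<Rightarrow> (nat list \<Rightarrow>\<^sub>0 'k) \<Rightarrow> (nat list \<Rightarrow>\<^sub>0 'k)" where
  "free_act q g p = (\<Sum>w\<in>Poly_Mapping.keys p. cst (Poly_Mapping.lookup p w) * word_act q g w)"

definition wedge_act ::
    "'k::field \<Rightarrow> nat \<Rightarrow> ugen \<Rightarrow> (nat list \<Rightarrow>\<^sub>0 'k) set \<Rightarrow> (nat list \<Rightarrow>\<^sub>0 'k) set" where
  "wedge_act q n g C = wedge_class q n (free_act q g (SOME p. p \<in> C))"


section \<open>The quantum de Rham complex\<close>

text \<open>As \<open>\<A>\<^sub>q(n)\<close> has the basis \<open>x\<^sup>(\<^sup>\<alpha>\<^sup>)\<close>, the tensor product \<open>\<A>\<^sub>q(n) \<otimes> \<and>\<^sub>q(n)\<close> is the space of finitely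
  supported families \<open>f\<close> of elements of \<open>\<and>\<^sub>q(n)\<close> indexed by the exponents \<open>\<alpha>\<close>; the family \<open>f\<close>
  represents the sum of all \<open>x\<^sup>(\<^sup>\<alpha>\<^sup>) \<otimes> f \<alpha>\<close>.\<close>

type_synonym 'k form = "(nat \<Rightarrow> int) \<Rightarrow> (nat list \<Rightarrow>\<^sub>0 'k) set"

definition supp :: "'k::field \<Rightarrow> nat \<Rightarrow> 'k form \<Rightarrow> (nat \<Rightarrow> int) set" where
  "supp q n f = {\<alpha>. f \<alpha> \<noteq> \<zero>\<^bsub>wedge q n\<^esub>}"

definition Omega :: "'k::field \<Rightarrow> nat \<Rightarrow> ('k, 'k form) module" where
  "Omega q n = \<lparr>carrier = {f. (\<forall>\<alpha>. f \<alpha> \<in> carrier (wedge q n)) \<and> finite (supp q n f) \<and> supp q n f \<subseteq> exps n},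
     mult = undefined, one = undefined,
     zero = (\<lambda>\<alpha>. \<zero>\<^bsub>wedge q n\<^esub>),
     add = (\<lambda>f g \<alpha>. f \<alpha> \<oplus>\<^bsub>wedge q n\<^esub> g \<alpha>),
     smult = (\<lambda>c f \<alpha>. wedge_scale q n c (f \<alpha>))\<rparr>"

definition tens ::
    "'k::field \<Rightarrow> nat \<Rightarrow> ((nat \<Rightarrow> int) \<Rightarrow>\<^sub>0 'k) \<Rightarrow> (nat list \<Rightarrow>\<^sub>0 'k) set \<Rightarrow> 'k form" where
  "tens q n a w = (\<lambda>\<alpha>. wedge_scale q n (Poly_Mapping.lookup a \<alpha>) w)"

text \<open>The action of a generator on \<open>x\<^sup>(\<^sup>\<alpha>\<^sup>) \<otimes> w\<close>, through the coproduct.\<close>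

fun tens_act ::
    "'k::field \<Rightarrow> nat \<Rightarrow> ugen \<Rightarrow> (nat \<Rightarrow> int) \<Rightarrow> (nat list \<Rightarrow>\<^sub>0 'k) set \<Rightarrow> 'k form" where
  "tens_act q n (E i) \<alpha> w = tens q n (A_act q n (E i) \<alpha>) (wedge_act q n (K i) w)
     \<oplus>\<^bsub>Omega q n\<^esub> tens q n (xterm n 1 \<alpha>) (wedge_act q n (E i) w)"
| "tens_act q n (F i) \<alpha> w = tens q n (A_act q n (F i) \<alpha>) w
     \<oplus>\<^bsub>Omega q n\<^esub> tens q n (A_act q n (Ki i) \<alpha>) (wedge_act q n (F i) w)"
| "tens_act q n (K i) \<alpha> w = tens q n (A_act q n (K i) \<alpha>) (wedge_act q n (K i) w)"
| "tens_act q n (Ki i) \<alpha> w = tens q n (A_act q n (Ki i) \<alpha>) (wedge_act q n (Ki i) w)"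

definition Omega_gen :: "'k::field \<Rightarrow> nat \<Rightarrow> ugen \<Rightarrow> 'k form \<Rightarrow> 'k form" where
  "Omega_gen q n g f = (\<Oplus>\<^bsub>Omega q n\<^esub>\<alpha>\<in>supp q n f. tens_act q n g \<alpha> (f \<alpha>))"

definition Omega_act :: "'k::field \<Rightarrow> nat \<Rightarrow> (ugen list \<Rightarrow>\<^sub>0 'k) \<Rightarrow> 'k form \<Rightarrow> 'k form" where
  "Omega_act q n a f = (\<Oplus>\<^bsub>Omega q n\<^esub>w\<in>Poly_Mapping.keys a.
     Poly_Mapping.lookup a w \<odot>\<^bsub>Omega q n\<^esub> foldr (Omega_gen q n) w f)"

text \<open>The module \<open>\<Omega>\<^sub>q(n, m)\<^sup>(\<^sup>s\<^sup>)\<close> over the small quantum group; a coset acts through any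
  representative.\<close>

definition Omega_mod ::
    "'k::field \<Rightarrow> nat \<Rightarrow> nat \<Rightarrow> nat \<Rightarrow> nat \<Rightarrow> ((ugen list \<Rightarrow>\<^sub>0 'k) set, 'k form) module" where
  "Omega_mod q n l m s =
     \<lparr>carrier = {f \<in> carrier (Omega q n). (\<forall>\<alpha>. f \<alpha> \<in> wedge_deg q n s) \<and> supp q n f \<subseteq> trunc_exps n l m},
      mult = undefined, one = undefined,
      zero = \<zero>\<^bsub>Omega q n\<^esub>, add = add (Omega q n),
      smult = (\<lambda>r f. Omega_act q n (SOME a. a \<in> r) f)\<rparr>"

definition dOmega :: "'k::field \<Rightarrow> nat \<Rightarrow> 'k form \<Rightarrow> 'k form" where
  "dOmega q n f = (\<Oplus>\<^bsub>Omega q n\<^esub>\<alpha>\<in>supp q n f. \<Oplus>\<^bsub>Omega q n\<^esub>j\<in>{1..n}.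
     tens q n (xterm n (q powi (- (\<Sum>i\<in>{1..<j}. \<alpha> i))) (\<alpha>(j := \<alpha> j - 1)))
              (wedge_class q n (mon [j]) \<otimes>\<^bsub>wedge q n\<^esub> f \<alpha>))"

definition cocycles :: "'k::field \<Rightarrow> nat \<Rightarrow> nat \<Rightarrow> nat \<Rightarrow> nat \<Rightarrow> 'k form set" where
  "cocycles q n l m s = {f \<in> carrier (Omega_mod q n l m s). dOmega q n f = \<zero>\<^bsub>Omega q n\<^esub>}"

definition coboundaries :: "'k::field \<Rightarrow> nat \<Rightarrow> nat \<Rightarrow> nat \<Rightarrow> nat \<Rightarrow> 'k form set" where
  "coboundaries q n l m s =
     (if s = 0 then {\<zero>\<^bsub>Omega q n\<^esub>} else dOmega q n ` carrier (Omega_mod q n l m (s - 1)))"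

definition cohomology ::
    "'k::field \<Rightarrow> nat \<Rightarrow> nat \<Rightarrow> nat \<Rightarrow> nat \<Rightarrow> ((ugen list \<Rightarrow>\<^sub>0 'k) set, 'k form set) module" where
  "cohomology q n l m s = quotient_module
     ((Omega_mod q n l m s)\<lparr>carrier := cocycles q n l m s\<rparr>) (coboundaries q n l m s)"

end

theory Submission
  imports Defs
begin

text \<open>
  On the basis \<open>x\<^sup>(\<^sup>\<alpha>\<^sup>) \<otimes> dx\<^sub>J\<close> the differential preserves the weight \<open>\<gamma> = \<alpha> + 1\<^sub>J\<close>, and in weight \<open>\<gamma>\<close>
  it is, up to signs and invertible scalars depending only on \<open>\<gamma>\<close>, a Koszul differential on those
  indices \<open>j\<close> with \<open>0 < \<gamma>\<^sub>j < ml\<close>.  Hence the complex is contractible in every weight that has such an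
  index, and each \<open>I \<subseteq> {1..n}\<close> with \<open>|I| = s\<close> contributes exactly one class to \<open>H\<^sup>s\<close>, that of
  \<open>\<alpha> = (ml - 1) 1\<^sub>I\<close>, \<open>J = I\<close>.  The generators \<open>e\<^sub>i\<close>, \<open>f\<^sub>i\<close> commute with the differential and move these
  weights to contractible ones, so they act by zero, while \<open>K\<^sub>i\<close> acts by a power of \<open>q\<^sup>m\<^sup>l\<close>, whose square
  is 1.  As the generators act on cohomology through characters, the relations of the small quantum
  group need only be checked on these characters and not on the complex.
\<close>

section \<open>Free algebras and their quotients\<close>

text \<open>The exterior algebra and the small quantum group consist of cosets in free algebras, and
  several operations choose representatives by \<open>SOME\<close>. Computing with forms needs the
  independence of the dx_J, which the relations do not show by themselves. Hence dx_j is made to act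
  by \<open>lmul\<close> on functions of subsets: the relations act by zero, so applying an element
  to 1 gives well-defined coordinates, and straightening shows that these determine the element. If
  0 < \<gamma>_j < ml, contraction with dx_j divided by its coefficient is a homotopy; the two
  bounds keep the exponents that occur within 0..ml-1. If no such j exists, 0 \<le> \<gamma>_j -
  [j in J] \<le> ml - 1 leaves only \<gamma>_j = 0 with j outside J, or \<gamma>_j = ml with j in J.
  The coefficients at these exponents (\<open>tp\<close>) therefore form a complete invariant of a
  cohomology class. The cocycle condition turns the invariant of e_i.u or f_i.u into a multiple of
  [ml]. It vanishes because [l] = 0 means q^l = q^(-l), which makes q^(ml) its own inverse; the same
  vanishing makes the truncated forms stable under e_i and f_i.\<close>

lemma poly_mapping_eq_sum_single: "p = (\<Sum>w\<in>Poly_Mapping.keys p. Poly_Mapping.single w (Poly_Mapping.lookup p w))"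
  by (rule poly_mapping_eqI)
    (auto simp: lookup_sum lookup_single when_def in_keys_iff sum.If_cases Int_def
      simp flip: of_bool_def intro: sum.neutral)

text \<open>The linear extension of \<open>\<phi>\<close> from monomials. Both the coordinates on
  the exterior algebra and the characters of the small quantum group have this shape.\<close>

definition lin :: "('g \<Rightarrow> 'k::field) \<Rightarrow> ('g \<Rightarrow>\<^sub>0 'k) \<Rightarrow> 'k" where
  "lin \<phi> p = (\<Sum>w\<in>Poly_Mapping.keys p. Poly_Mapping.lookup p w * \<phi> w)"

lemma lin_superset:
  assumes "finite S" and "Poly_Mapping.keys p \<subseteq> S"
  shows "lin \<phi> p = (\<Sum>w\<in>S. Poly_Mapping.lookup p w * \<phi> w)"
  unfolding lin_def using assms by (intro sum.mono_neutral_left) (auto simp: in_keys_iff)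

lemma lin_zero [simp]: "lin \<phi> 0 = 0"
  by (simp add: lin_def)

lemma lin_single [simp]: "lin \<phi> (Poly_Mapping.single w c) = c * \<phi> w"
  by (subst lin_superset[where S = "{w}"]) (auto split: if_splits)

lemma lin_one [simp]: "lin \<phi> 1 = \<phi> 0"
  by (metis lin_single mult_1 single_one)

lemma lin_add [simp]: "lin \<phi> (p + p') = lin \<phi> p + lin \<phi> p'"
proof -
  let ?S = "Poly_Mapping.keys p \<union> Poly_Mapping.keys p'"
  have "lin \<phi> x = (\<Sum>w\<in>?S. Poly_Mapping.lookup x w * \<phi> w)"
    if "Poly_Mapping.keys x \<subseteq> ?S" for x
    using that by (intro lin_superset) auto
  then show ?thesis
    by (simp add: keys_add lookup_add distrib_right sum.distrib)
qed

lemma lin_uminus [simp]: "lin \<phi> (- p) = - lin \<phi> p"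
  using lin_add[of \<phi> p "- p"] by (simp add: eq_neg_iff_add_eq_0 add.commute)

lemma lin_diff [simp]: "lin \<phi> (p - p') = lin \<phi> p - lin \<phi> p'"
  using lin_add[of \<phi> p "- p'"] by simp

lemma lin_sum: "lin \<phi> (sum f A) = (\<Sum>x\<in>A. lin \<phi> (f x))"
  by (induction A rule: infinite_finite_induct) auto

lemma lin_cong: "(\<And>w. w \<in> Poly_Mapping.keys p \<Longrightarrow> \<phi> w = \<psi> w) \<Longrightarrow> lin \<phi> p = lin \<psi> p"
  by (simp add: lin_def)

lemma lin_mult_right: "lin (\<lambda>w. \<phi> w * c) p = lin \<phi> p * c"
  by (simp add: lin_def sum_distrib_right mult.assoc)

lemma lin_mult_left: "lin (\<lambda>w. c * \<phi> w) p = c * lin \<phi> p"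
  by (simp add: lin_def sum_distrib_left mult_ac)

lemma lin_fun_0 [simp]: "lin (\<lambda>w. 0) p = 0"
  by (simp add: lin_def)

text \<open>Both factors are expanded into monomials, whose exponents add (for words: concatenate).
  A multiplicative \<open>\<phi>\<close> thus gives an algebra homomorphism, and operators iterated
  along words give a composition.\<close>

lemma lin_mult: "lin \<phi> (p * p') = lin (\<lambda>u. lin (\<lambda>v. \<phi> (u + v)) p') p"
proof -
  have 1: "lin \<phi> (Poly_Mapping.single u c * p') = c * lin (\<lambda>v. \<phi> (u + v)) p'" for u c
  proof -
    have "Poly_Mapping.single u c * p' = (\<Sum>v\<in>Poly_Mapping.keys p'.
        Poly_Mapping.single (u + v) (c * Poly_Mapping.lookup p' v))"
      by (subst (1) poly_mapping_eq_sum_single[of p']) (simp add: sum_distrib_left mult_single)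
    then show ?thesis
      by (simp add: lin_sum) (simp add: lin_def sum_distrib_left mult.assoc)
  qed
  have "p * p' = (\<Sum>u\<in>Poly_Mapping.keys p. Poly_Mapping.single u (Poly_Mapping.lookup p u) * p')"
    by (subst (1) poly_mapping_eq_sum_single[of p]) (simp add: sum_distrib_right)
  then show ?thesis
    by (simp add: lin_sum 1) (simp add: lin_def)
qed

lemma lin_mult_hom:
  assumes "\<And>u v. \<phi> (u + v) = \<phi> u * \<phi> v"
  shows "lin \<phi> (p * p') = lin \<phi> p * lin \<phi> p'"
  by (simp add: lin_mult assms lin_mult_left lin_mult_right)

lemma plus_list_append [simp]: "u + v = u @ v" for u v :: "'g list"
  by (rule plus_list_def)

lemma one_eq_mon: "(1 :: 'g list \<Rightarrow>\<^sub>0 'k::field) = mon []"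
  by (metis single_one zero_list_def)

lemma carrier_free_algebra: "carrier (free_algebra X) = {p. Poly_Mapping.keys p \<subseteq> lists X}"
  by (simp add: free_algebra_def)

lemma free_algebra_simps [simp]:
  "mult (free_algebra X) = (*)" "one (free_algebra X) = 1"
  "ring.zero (free_algebra X) = 0" "ring.add (free_algebra X) = (+)"
  by (simp_all add: free_algebra_def)

lemma free_single [intro]: "set w \<subseteq> X \<Longrightarrow> Poly_Mapping.single w c \<in> carrier (free_algebra X)"
  by (auto simp: carrier_free_algebra)

lemma free_zero [simp]: "0 \<in> carrier (free_algebra X)"
  by (simp add: carrier_free_algebra)

lemma free_one [simp]: "1 \<in> carrier (free_algebra X)"
  by (simp add: one_eq_mon free_single)

lemma free_add:
  "p \<in> carrier (free_algebra X) \<Longrightarrow> p' \<in> carrier (free_algebra X) \<Longrightarrow> p + p' \<in> carrier (free_algebra X)"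
  using keys_add[of p p'] by (auto simp: carrier_free_algebra)

lemma keys_neg: "Poly_Mapping.keys (- p) = Poly_Mapping.keys (p :: 'g \<Rightarrow>\<^sub>0 'k::field)"
  by (auto simp: in_keys_iff)

lemma free_uminus: "p \<in> carrier (free_algebra X) \<Longrightarrow> - p \<in> carrier (free_algebra X)"
  by (simp add: carrier_free_algebra keys_neg)

lemma free_diff:
  "p \<in> carrier (free_algebra X) \<Longrightarrow> p' \<in> carrier (free_algebra X) \<Longrightarrow> p - p' \<in> carrier (free_algebra X)"
  using free_add[of p X "- p'"] free_uminus[of p' X] by simp

lemma free_mult:
  "p \<in> carrier (free_algebra X) \<Longrightarrow> p' \<in> carrier (free_algebra X) \<Longrightarrow> p * p' \<in> carrier (free_algebra X)"
  using keys_mult[of p p'] by (fastforce simp: carrier_free_algebra)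

lemma free_sum:
  "(\<And>x. x \<in> A \<Longrightarrow> f x \<in> carrier (free_algebra X)) \<Longrightarrow> sum f A \<in> carrier (free_algebra X)"
  by (induction A rule: infinite_finite_induct) (auto intro: free_add)

lemmas free_closed = free_single free_zero free_one free_add free_uminus free_diff free_mult free_sum

lemma ring_free_algebra: "ring (free_algebra X :: ('g list \<Rightarrow>\<^sub>0 'k::field) ring)"
proof (rule ringI)
  show "abelian_group (free_algebra X :: ('g list \<Rightarrow>\<^sub>0 'k) ring)"
  proof (rule abelian_groupI)
    fix p :: "'g list \<Rightarrow>\<^sub>0 'k"
    assume "p \<in> carrier (free_algebra X)"
    then show "\<exists>y\<in>carrier (free_algebra X). y \<oplus>\<^bsub>free_algebra X\<^esub> p = \<zero>\<^bsub>free_algebra X\<^esub>"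
      by (intro bexI[of _ "- p"]) (auto intro: free_uminus)
  qed (auto intro: free_add simp: add_ac)
  show "Group.monoid (free_algebra X :: ('g list \<Rightarrow>\<^sub>0 'k) ring)"
    by (rule monoidI) (auto intro: free_mult simp: mult.assoc)
qed (auto simp: distrib_left distrib_right)

lemma a_inv_free_algebra:
  assumes "p \<in> carrier (free_algebra X)"
  shows "a_inv (free_algebra X) p = - p"
proof -
  interpret ring "free_algebra X" by (rule ring_free_algebra)
  show ?thesis
    using assms by (intro minus_equality) (auto intro: free_uminus)
qed

text \<open>The elements of the free algebra that satisfy \<open>P\<close> form an ideal containing
  \<open>S\<close>, and \<open>Idl\<close> is the least such ideal.\<close>

lemma genideal_free_algebra_induct [consumes 2, case_names rel zero add uminus mult_left mult_right]:
  fixes p :: "'g list \<Rightarrow>\<^sub>0 'k::field"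
  assumes p: "p \<in> Idl\<^bsub>free_algebra X\<^esub> S" and S: "S \<subseteq> carrier (free_algebra X)"
    and rel: "\<And>x. x \<in> S \<Longrightarrow> P x" and "P 0"
    and add: "\<And>x y. P x \<Longrightarrow> P y \<Longrightarrow> P (x + y)" and um: "\<And>x. P x \<Longrightarrow> P (- x)"
    and ml: "\<And>a x. a \<in> carrier (free_algebra X) \<Longrightarrow> P x \<Longrightarrow> P (a * x)"
    and mr: "\<And>a x. a \<in> carrier (free_algebra X) \<Longrightarrow> P x \<Longrightarrow> P (x * a)"
  shows "P p"
proof -
  interpret ring "free_algebra X :: ('g list \<Rightarrow>\<^sub>0 'k) ring" by (rule ring_free_algebra)
  let ?I = "{x \<in> carrier (free_algebra X). P x}"
  have "ideal ?I (free_algebra X)"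
  proof (rule idealI)
    show "subgroup ?I (add_monoid (free_algebra X))"
      by (rule add.subgroupI)
        (use assms in \<open>auto intro: free_add free_uminus simp: a_inv_free_algebra simp flip: a_inv_def\<close>)
  qed (use assms in \<open>auto intro: free_mult ring_free_algebra\<close>)
  then have "Idl\<^bsub>free_algebra X\<^esub> S \<subseteq> ?I"
    using S rel by (intro genideal_minimal) auto
  then show ?thesis using p by auto
qed

section \<open>Algebras presented by generators and relations\<close>

locale presentation =
  fixes X :: "'g set" and S :: "('g list \<Rightarrow>\<^sub>0 'k::field) set"
  assumes rels: "S \<subseteq> carrier (free_algebra X)"
begin

abbreviation "Fr \<equiv> free_algebra X :: ('g list \<Rightarrow>\<^sub>0 'k) ring"
abbreviation "Rel \<equiv> Idl\<^bsub>Fr\<^esub> S"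
abbreviation "Pr \<equiv> presented_algebra X S"
abbreviation "cl \<equiv> presented_class X S"

sublocale free: ring Fr by (rule ring_free_algebra)
sublocale Rel: ideal Rel Fr by (rule free.genideal_ideal[OF rels])
sublocale Pr: ring Pr unfolding presented_algebra_def by (rule Rel.quotient_is_ring)

lemma Rel_carrier: "x \<in> Rel \<Longrightarrow> x \<in> carrier Fr"
  by (rule Rel.Icarr)

lemma Rel_rel: "x \<in> S \<Longrightarrow> x \<in> Rel"
  using free.genideal_self[OF rels] by auto

lemma Rel_add: "x \<in> Rel \<Longrightarrow> y \<in> Rel \<Longrightarrow> x + y \<in> Rel"
  using Rel.a_closed[of x y] by simp

lemma Rel_zero: "0 \<in> Rel"
  using Rel.zero_closed by simp

lemma Rel_uminus: "x \<in> Rel \<Longrightarrow> - x \<in> Rel"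
  using Rel.a_inv_closed[of x] Rel_carrier[of x] by (simp add: a_inv_free_algebra)

lemma Rel_diff: "x \<in> Rel \<Longrightarrow> y \<in> Rel \<Longrightarrow> x - y \<in> Rel"
  using Rel_add[of x "- y"] Rel_uminus[of y] by simp

lemma Rel_mult_left: "a \<in> carrier Fr \<Longrightarrow> x \<in> Rel \<Longrightarrow> a * x \<in> Rel"
  using Rel.I_l_closed[of x a] by simp

lemma Rel_mult_right: "a \<in> carrier Fr \<Longrightarrow> x \<in> Rel \<Longrightarrow> x * a \<in> Rel"
  using Rel.I_r_closed[of x a] by simp

lemma Rel_sum: "(\<And>x. x \<in> A \<Longrightarrow> f x \<in> Rel) \<Longrightarrow> sum f A \<in> Rel"
  by (induction A rule: infinite_finite_induct) (auto intro: Rel_add Rel_zero)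

lemma carrier_Pr: "carrier Pr = cl ` carrier Fr"
  by (auto simp: presented_algebra_def presented_class_def FactRing_def A_RCOSETS_def')

lemma cl_carrier: "p \<in> carrier Fr \<Longrightarrow> cl p \<in> carrier Pr"
  by (simp add: carrier_Pr)

lemma cl_eqI: "p \<in> carrier Fr \<Longrightarrow> p' \<in> carrier Fr \<Longrightarrow> p - p' \<in> Rel \<Longrightarrow> cl p = cl p'"
  using Rel_uminus[of "p - p'"] unfolding presented_class_def
  by (intro Rel.a_repr_independence') (auto simp: a_r_coset_def' intro!: bexI[of _ "p' - p"])

lemma cl_eqD: "p \<in> carrier Fr \<Longrightarrow> p' \<in> cl p \<Longrightarrow> p' \<in> carrier Fr \<and> p' - p \<in> Rel"
  by (auto simp: presented_class_def a_r_coset_def' intro: free_add Rel_carrier)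

lemma cl_self: "p \<in> carrier Fr \<Longrightarrow> p \<in> cl p"
  unfolding presented_class_def by (rule Rel.a_rcos_self)

text \<open>Functions on cosets are defined through a \<open>SOME\<close> representative. Whatever
  is constant modulo \<open>Rel\<close> can therefore be evaluated at any representative.\<close>

lemma cl_some:
  assumes "p \<in> carrier Fr"
  shows "(SOME x. x \<in> cl p) \<in> carrier Fr" and "(SOME x. x \<in> cl p) - p \<in> Rel"
  using cl_eqD[OF assms someI[of "\<lambda>x. x \<in> cl p", OF cl_self[OF assms]]] by auto

lemma cl_add:
  "p \<in> carrier Fr \<Longrightarrow> p' \<in> carrier Fr \<Longrightarrow> cl p \<oplus>\<^bsub>Pr\<^esub> cl p' = cl (p + p')"
  by (simp add: presented_algebra_def presented_class_def FactRing_def Rel.a_rcos_sum)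

lemma cl_mult:
  "p \<in> carrier Fr \<Longrightarrow> p' \<in> carrier Fr \<Longrightarrow> cl p \<otimes>\<^bsub>Pr\<^esub> cl p' = cl (p * p')"
  by (simp add: presented_algebra_def presented_class_def FactRing_def Rel.rcoset_mult_add)

lemma cl_zero: "\<zero>\<^bsub>Pr\<^esub> = cl 0"
  using free.a_rcos_zero[OF Rel.is_ideal Rel_zero]
  by (simp add: presented_algebra_def presented_class_def FactRing_def)

lemma cl_one: "\<one>\<^bsub>Pr\<^esub> = cl 1"
  by (simp add: presented_algebra_def presented_class_def FactRing_def)

end

declare One_nat_def [simp del]

section \<open>The quantum exterior algebra in coordinates\<close>

text \<open>The number of factors that dx_j has to pass on its way from the front of dx_J to its
  sorted place.\<close>

definition below :: "nat \<Rightarrow> nat set \<Rightarrow> nat" where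
  "below j J = card {i \<in> J. i < j}"

lemma below_cong: "(\<And>t. t < j \<Longrightarrow> t \<in> I \<longleftrightarrow> t \<in> J) \<Longrightarrow> below j I = below j J"
  unfolding below_def by (rule arg_cong[where f = card]) auto

lemma below_remove: "below j J = below j (J - {i}) + of_bool (i \<in> J \<and> i < j)"
proof (cases "i \<in> J \<and> i < j")
  case True
  then have "{t \<in> J. t < j} = insert i {t \<in> J - {i}. t < j}" by auto
  moreover have "finite {t \<in> J - {i}. t < j}" by simp
  ultimately show ?thesis using True by (simp add: below_def)
next
  case False
  then have "{t \<in> J. t < j} = {t \<in> J - {i}. t < j}" by auto
  then show ?thesis using False by (simp add: below_def)
qed

lemma below_insert: "i \<notin> J \<Longrightarrow> below j (insert i J) = below j J + of_bool (i < j)"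
  using below_remove[of j "insert i J" i] by simp

lemma below_self_remove [simp]: "below j (J - {j}) = below j J"
  by (rule below_cong) auto

lemma below_self_insert [simp]: "below j (insert j J) = below j J"
  by (rule below_cong) auto

lemma below_Suc: "below (Suc i) J = below i J + of_bool (i \<in> J)"
proof -
  have "{t \<in> J - {i}. t < Suc i} = {t \<in> J. t < i}" by auto
  then show ?thesis using below_remove[of "Suc i" J i] by (simp add: below_def)
qed

text \<open>An element of the quantum exterior algebra is encoded by its coordinates with respect to the
  monomials \<open>dx\<^sub>J\<close> with increasing factors.  Moving \<open>dx\<^sub>j\<close> past the smaller factors of \<open>dx\<^sub>J\<close>
  produces the power of \<open>- q\<^sup>-\<^sup>1\<close> in \<open>lmul\<close>, which is left multiplication by \<open>dx\<^sub>j\<close>.\<close>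

definition lmul :: "'k::field \<Rightarrow> nat \<Rightarrow> (nat set \<Rightarrow> 'k) \<Rightarrow> nat set \<Rightarrow> 'k" where
  "lmul q j v J = (if j \<in> J then (- inverse q) ^ below j J * v (J - {j}) else 0)"

lemma lmul_lmul_same: "lmul q j (lmul q j v) J = 0"
  by (simp add: lmul_def)

text \<open>Removing the larger index j does not change \<open>below i\<close>, while removing i
  lowers \<open>below j\<close> by one. The resulting extra factor - q^(-1) is the one in the
  relation for dx_j dx_i.\<close>

lemma lmul_lmul:
  assumes "i < j"
  shows "lmul q j (lmul q i v) J + inverse q * lmul q i (lmul q j v) J = 0"
proof (cases "i \<in> J \<and> j \<in> J")
  case True
  have 1: "below i (J - {j}) = below i J"
    using assms below_remove[of i J j] by simp
  have 2: "below j J = Suc (below j (J - {i}))"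
    using assms True below_remove[of j J i] by simp
  have 3: "J - {j} - {i} = J - {i} - {j}" by auto
  show ?thesis
    using True assms by (simp add: lmul_def 1 2 3)
qed (use assms in \<open>auto simp: lmul_def\<close>)

text \<open>The representation of the free algebra in which the letter j acts by
  \<open>lmul q j\<close>. Applied to \<open>vac\<close>, the coordinates of 1, it yields
  \<open>coords\<close>; since it kills the relations, coordinates pass to the quotient.\<close>

definition wop :: "'k::field \<Rightarrow> (nat list \<Rightarrow>\<^sub>0 'k) \<Rightarrow> (nat set \<Rightarrow> 'k) \<Rightarrow> nat set \<Rightarrow> 'k" where
  "wop q p v J = lin (\<lambda>w. foldr (lmul q) w v J) p"

abbreviation vac :: "nat set \<Rightarrow> 'k::field" where
  "vac \<equiv> \<lambda>J. of_bool (J = {})"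

definition coords :: "'k::field \<Rightarrow> (nat list \<Rightarrow>\<^sub>0 'k) \<Rightarrow> nat set \<Rightarrow> 'k" where
  "coords q p = wop q p vac"

lemma lmul_lin:
  "lmul q j (\<lambda>J. lin (\<lambda>w. \<phi> w J) p) = (\<lambda>J. lin (\<lambda>w. lmul q j (\<phi> w) J) p)"
  by (rule ext) (simp add: lmul_def lin_mult_left)

lemma foldr_lmul_lin:
  "foldr (lmul q) u (\<lambda>J. lin (\<lambda>w. \<phi> w J) p) = (\<lambda>J. lin (\<lambda>w. foldr (lmul q) u (\<phi> w) J) p)"
  by (induction u) (simp_all add: lmul_lin)

lemma wop_mult: "wop q (p * p') v = wop q p (wop q p' v)"
proof
  show "wop q (p * p') v J = wop q p (wop q p' v) J" for J
    unfolding wop_def by (simp add: lin_mult foldr_lmul_lin)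
qed

lemma foldr_lmul_zero: "foldr (lmul q) u (\<lambda>J. 0) = (\<lambda>J. 0)"
  by (induction u) (auto simp: lmul_def fun_eq_iff)

lemma wop_zero_right: "wop q p (\<lambda>J. 0) = (\<lambda>J. 0)"
  by (simp add: wop_def foldr_lmul_zero fun_eq_iff)

lemma wop_simps [simp]:
  "wop q 0 v J = 0" "wop q 1 v J = v J"
  "wop q (p + p') v J = wop q p v J + wop q p' v J"
  "wop q (p - p') v J = wop q p v J - wop q p' v J"
  "wop q (- p) v J = - wop q p v J"
  "wop q (Poly_Mapping.single w c) v J = c * foldr (lmul q) w v J"
  by (simp_all add: wop_def zero_list_def)

lemma coords_simps [simp]:
  "coords q 0 J = 0" "coords q 1 = vac"
  "coords q (p + p') J = coords q p J + coords q p' J"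
  "coords q (p - p') J = coords q p J - coords q p' J"
  by (auto simp: coords_def fun_eq_iff)

lemma coords_single: "coords q (Poly_Mapping.single w c) J = c * foldr (lmul q) w vac J"
  by (simp add: coords_def)

lemma coords_mon_Nil: "coords q (mon []) = vac"
  by (simp add: coords_single fun_eq_iff)

lemma coords_mon_Cons: "coords q (mon (j # w)) = lmul q j (coords q (mon w))"
  by (simp add: coords_single[abs_def] fun_eq_iff)

lemma coords_mult: "coords q (p * p') = wop q p (coords q p')"
  by (simp add: coords_def wop_mult)

lemma coords_single_mult:
  "coords q (Poly_Mapping.single [j] c * p) J = c * lmul q j (coords q p) J"
  by (simp add: coords_mult)

lemma coords_sum: "coords q (sum f A) J = (\<Sum>x\<in>A. coords q (f x) J)"
  by (simp add: coords_def wop_def lin_sum)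

lemma foldr_lmul_vac_supp:
  "foldr (lmul q) w vac J \<noteq> 0 \<Longrightarrow> J \<subseteq> set w \<and> card J = length w"
proof (induction w arbitrary: J)
  case (Cons j w)
  have "lmul q j (foldr (lmul q) w vac) J \<noteq> 0" using Cons.prems by simp
  then have j: "j \<in> J" and "foldr (lmul q) w vac (J - {j}) \<noteq> 0"
    unfolding lmul_def by (auto split: if_splits)
  with Cons.IH have *: "J - {j} \<subseteq> set w" "card (J - {j}) = length w" by auto
  then have "finite (J - {j})" using finite_subset by blast
  then have "card J = Suc (card (J - {j}))" using j by (intro card.remove) auto
  with * show ?case by auto
qed (auto split: if_splits)

lemma coords_supp:
  assumes "coords q p J \<noteq> 0"
  shows "\<exists>w\<in>Poly_Mapping.keys p. J \<subseteq> set w \<and> card J = length w"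
proof (rule ccontr)
  assume "\<not> ?thesis"
  then have "coords q p J = lin (\<lambda>w. 0) p"
    unfolding coords_def wop_def using foldr_lmul_vac_supp by (intro lin_cong) blast
  with assms show False by simp
qed

text \<open>In an increasing word a letter passes no smaller one, so no power of - q^(-1) appears.
  This makes the increasing monomials independent.\<close>

lemma foldr_lmul_vac_sorted:
  "sorted_wrt (<) L \<Longrightarrow> foldr (lmul q) L vac J = of_bool (J = set L)"
proof (induction L arbitrary: J)
  case (Cons a L)
  have a: "a \<notin> set L" using Cons.prems by auto
  show ?case
  proof (cases "a \<in> J \<and> J - {a} = set L")
    case True
    then have "J = insert a (set L)" by auto
    moreover have "{i \<in> insert a (set L). i < a} = {}" using Cons.prems by auto
    then have "below a (insert a (set L)) = 0" unfolding below_def by (simp only: card.empty)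
    ultimately show ?thesis using Cons a by (simp add: lmul_def)
  next
    case False
    then have "J \<noteq> insert a (set L)" using a by auto
    with False Cons show ?thesis by (auto simp: lmul_def)
  qed
qed simp

text \<open>The coefficient at \<open>J\<close> of the image, read off from its preimages. For e_i
  and f_i no power of q appears: in an increasing monomial, the factors to which the coproduct
  applies K_i or its inverse have indices other than i and i+1. If both indices are present, the
  image contains a square.\<close>

fun wact :: "'k::field \<Rightarrow> ugen \<Rightarrow> (nat set \<Rightarrow> 'k) \<Rightarrow> nat set \<Rightarrow> 'k" where
  "wact q (E i) v J = (if i \<in> J \<and> Suc i \<notin> J then v (insert (Suc i) (J - {i})) else 0)"
| "wact q (F i) v J = (if Suc i \<in> J \<and> i \<notin> J then v (insert i (J - {Suc i})) else 0)"
| "wact q (K i) v J = q powi (of_bool (i \<in> J) - of_bool (Suc i \<in> J)) * v J"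
| "wact q (Ki i) v J = q powi (- (of_bool (i \<in> J) - of_bool (Suc i \<in> J))) * v J"

lemma wact_lin: "wact q g (\<lambda>J. lin (\<lambda>w. \<phi> w J) p) J = lin (\<lambda>w. wact q g (\<phi> w) J) p"
  by (cases g) (auto simp: lin_mult_left)

lemma wact_K_lmul:
  assumes "q \<noteq> 0"
  shows "wact q (K i) (lmul q j v) J
    = q powi (of_bool (j = i) - of_bool (j = Suc i)) * lmul q j (wact q (K i) v) J"
  using assms by (auto simp: lmul_def power_int_minus power_int_diff)

lemma wact_Ki_lmul:
  assumes "q \<noteq> 0"
  shows "wact q (Ki i) (lmul q j v) J
    = q powi (- (of_bool (j = i) - of_bool (j = Suc i))) * lmul q j (wact q (Ki i) v) J"
  using assms by (auto simp: lmul_def power_int_minus power_int_diff)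

text \<open>An index up to i counts neither i nor i+1, and an index beyond i+1 counts exactly one of
  them in both sets. Only i+1 could notice the exchange.\<close>

lemma below_shift:
  assumes "j \<noteq> Suc i" "(i \<in> J) \<noteq> (Suc i \<in> J)" "(i \<in> I) \<noteq> (Suc i \<in> I)"
    and "\<And>t. t \<noteq> i \<Longrightarrow> t \<noteq> Suc i \<Longrightarrow> t \<in> I \<longleftrightarrow> t \<in> J"
  shows "below j I = below j J"
proof (cases "j \<le> i")
  case True
  then show ?thesis using assms(4) by (intro below_cong) auto
next
  case False
  let ?c = "\<lambda>J. below j (J - {i} - {Suc i})"
  have "Suc i < j" using False assms(1) by simp
  then have "below j J = Suc (?c J)" if "(i \<in> J) \<noteq> (Suc i \<in> J)" for J
    using that below_remove[of j J i] below_remove[of j "J - {i}" "Suc i"] by auto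
  moreover have "?c I = ?c J" using assms(4) by (intro below_cong) auto
  ultimately show ?thesis using assms(2,3) by simp
qed

text \<open>This is e_i.(dx_j w) = (e_i.dx_j)(K_i.w) + dx_j (e_i.w). The critical case is j = i+1
  with i and i+1 both in \<open>J\<close>: the left side is 0, and on the right the q^(-1) from K_i
  cancels the - q^(-1) from passing dx_i.\<close>

lemma wact_E_lmul:
  assumes "q \<noteq> 0"
  shows "wact q (E i) (lmul q j v) J
    = of_bool (j = Suc i) * lmul q i (wact q (K i) v) J + lmul q j (wact q (E i) v) J"
proof -
  let ?I = "insert (Suc i) (J - {i})"
  consider "j = i" | "j = Suc i" | "j \<noteq> i" "j \<noteq> Suc i" by blast
  then show ?thesis
  proof cases
    case 2
    have "below (Suc i) ?I = below i J"
      by (simp add: below_Suc)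
    moreover have "?I - {Suc i} = J - {i}" if "Suc i \<notin> J" using that by auto
    moreover have "insert (Suc i) (J - {Suc i} - {i}) = J - {i}" if "Suc i \<in> J" using that by auto
    ultimately show ?thesis
      using 2 assms below_Suc[of i J]
      by (cases "i \<in> J"; cases "Suc i \<in> J") (simp_all add: lmul_def power_int_minus power_add)
  next
    case 3
    then have "below j ?I = below j J" if "i \<in> J" "Suc i \<notin> J"
      using that by (intro below_shift[of _ i]) auto
    moreover have "?I - {j} = insert (Suc i) (J - {j} - {i})" using 3 by auto
    ultimately show ?thesis using 3 by (auto simp: lmul_def)
  qed (auto simp: lmul_def)
qed

text \<open>This is f_i.(dx_j w) = (f_i.dx_j) w + (K_i^(-1).dx_j)(f_i.w). For j = i with both i and
  i+1 in \<open>J\<close>, the q^(-1) from the inverse of K_i cancels the - q^(-1) from passing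
  dx_i.\<close>

lemma wact_F_lmul:
  assumes "q \<noteq> 0"
  shows "wact q (F i) (lmul q j v) J
    = of_bool (j = i) * lmul q (Suc i) v J
      + q powi (- (of_bool (j = i) - of_bool (j = Suc i))) * lmul q j (wact q (F i) v) J"
proof -
  let ?I = "insert i (J - {Suc i})"
  consider "j = i" | "j = Suc i" | "j \<noteq> i" "j \<noteq> Suc i" by blast
  then show ?thesis
  proof cases
    case 1
    have "below i ?I = below i J"
      by (simp, intro below_cong) auto
    moreover have "?I - {i} = J - {Suc i}" if "i \<notin> J" using that by auto
    moreover have "insert i (J - {i} - {Suc i}) = J - {Suc i}" if "i \<in> J" using that by auto
    ultimately show ?thesis
      using 1 assms below_Suc[of i J]
      by (cases "i \<in> J"; cases "Suc i \<in> J") (simp_all add: lmul_def power_int_minus power_add)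
  next
    case 3
    then have "below j ?I = below j J" if "Suc i \<in> J" "i \<notin> J"
      using that by (intro below_shift[of _ i]) auto
    moreover have "?I - {j} = insert i (J - {j} - {Suc i})" using 3 by auto
    ultimately show ?thesis using 3 by (auto simp: lmul_def)
  qed (auto simp: lmul_def)
qed

text \<open>Induction along the word: each recursive clause of \<open>word_act\<close> matches one
  of the four rules above. The clause for \<open>E\<close> refers to \<open>K\<close>, so
  \<open>K\<close> is settled first.\<close>

lemma coords_word_act:
  assumes "q \<noteq> 0"
  shows "coords q (word_act q g w) J = wact q g (coords q (mon w)) J"
proof -
  have K: "coords q (word_act q (K i) w) = wact q (K i) (coords q (mon w))" for i w
  proof (induction w)
    case (Cons j w)
    show ?case
      by (rule ext) (simp add: Cons.IH coords_single_mult coords_mon_Cons wact_K_lmul assms del: wact.simps)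
  qed (simp add: coords_mon_Nil fun_eq_iff)
  have Ki: "coords q (word_act q (Ki i) w) = wact q (Ki i) (coords q (mon w))" for i w
  proof (induction w)
    case (Cons j w)
    show ?case
      by (rule ext) (simp add: Cons.IH coords_single_mult coords_mon_Cons wact_Ki_lmul assms del: wact.simps)
  qed (simp add: coords_mon_Nil fun_eq_iff)
  have E: "coords q (word_act q (E i) w) = wact q (E i) (coords q (mon w))" for i w
  proof (induction w)
    case (Cons j w)
    show ?case
      by (rule ext) (simp add: Cons.IH coords_single_mult coords_mon_Cons K wact_E_lmul assms del: wact.simps)
  qed (simp add: coords_mon_Nil fun_eq_iff)
  have F: "coords q (word_act q (F i) w) = wact q (F i) (coords q (mon w))" for i w
  proof (induction w)
    case (Cons j w)
    show ?case
      by (rule ext) (simp add: Cons.IH coords_single_mult coords_mon_Cons wact_F_lmul assms del: wact.simps)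
  qed (simp add: coords_mon_Nil fun_eq_iff)
  show ?thesis by (cases g) (simp_all add: E F K Ki)
qed

lemma coords_free_act:
  assumes "q \<noteq> 0"
  shows "coords q (free_act q g p) = wact q g (coords q p)"
proof
  fix J
  have "coords q (free_act q g p) J = lin (\<lambda>w. coords q (word_act q g w) J) p"
    by (simp add: free_act_def coords_sum lin_def coords_mult)
  also have "\<dots> = wact q g (coords q p) J"
    by (simp add: coords_word_act assms wact_lin[symmetric] coords_single)
      (simp add: coords_def wop_def[abs_def])
  finally show "coords q (free_act q g p) J = wact q g (coords q p) J" .
qed

section \<open>The monomial basis of the quantum exterior algebra\<close>

locale quantum_exterior =
  fixes q :: "'k::field" and n :: nat
  assumes q_nonzero: "q \<noteq> 0"

sublocale quantum_exterior \<subseteq> presentation "{1..n}" "wedge_rels q n"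
  by unfold_locales (auto simp: wedge_rels_def intro!: free_closed)

context quantum_exterior
begin

lemma Pr_eq: "Pr = wedge q n"
  by (simp add: wedge_def)

lemma cl_eq: "cl = wedge_class q n"
  by (simp add: wedge_class_def fun_eq_iff)

text \<open>On the defining relations this is \<open>lmul_lmul_same\<close> and
  \<open>lmul_lmul\<close>. The vector \<open>v\<close> must vary in the induction, because a factor
  on the right changes the vector on which the relation acts.\<close>

lemma wop_Rel: "x \<in> Rel \<Longrightarrow> wop q x v = (\<lambda>J. 0)"
proof (induction x arbitrary: v rule: genideal_free_algebra_induct[OF _ rels,
      consumes 1, case_names rel zero add uminus mult_left mult_right])
  case (rel x)
  then show ?case
    using lmul_lmul[of _ _ q v]
    by (auto simp: wedge_rels_def wop_mult lmul_lmul_same fun_eq_iff mult_single)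
next
  case (mult_left a x)
  then show ?case by (simp add: wop_mult wop_zero_right)
next
  case (mult_right a x)
  then show ?case by (simp add: wop_mult)
qed (use rels in \<open>auto simp: fun_eq_iff\<close>)

lemma coords_Rel: "x - y \<in> Rel \<Longrightarrow> coords q x = coords q y"
  using wop_Rel[of "x - y" vac] by (simp add: coords_def fun_eq_iff)

text \<open>Insertion of dx_j into an increasing monomial with first factor dx_a. If j < a nothing
  moves, if j = a a square appears, and if a < j one exchange costs - q^(-1) and the induction
  hypothesis inserts dx_j into the tail.\<close>

lemma straighten:
  assumes "sorted_wrt (<) L" "set (j # L) \<subseteq> {1..n}"
  shows "mon (j # L) - (if j \<in> set L then 0
    else Poly_Mapping.single (insort j L) ((- inverse q) ^ below j (set L))) \<in> Rel"
    (is "_ - ?r j L \<in> _")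
  using assms
proof (induction L)
  case Nil
  then show ?case by (simp add: below_def Rel_zero)
next
  case (Cons a L)
  consider "j < a" | "j = a" | "a < j" by linarith
  then show ?case
  proof cases
    case 1
    then have "j \<notin> set (a # L)" "{i \<in> set (a # L). i < j} = {}" using Cons.prems by auto
    moreover have "below j (set (a # L)) = 0"
      using calculation(2) unfolding below_def by (simp only: card.empty)
    ultimately show ?thesis using 1 by (simp add: Rel_zero del: list.set)
  next
    case 2
    have "mon [a, a] \<in> Rel" using Cons.prems by (intro Rel_rel) (auto simp: wedge_rels_def)
    then have "mon [a, a] * mon L \<in> Rel"
      using Cons.prems by (intro Rel_mult_right free_closed) auto
    then show ?thesis using 2 by (simp add: mult_single)
  next
    case 3
    let ?x = "mon [j, a] + cst (inverse q) * mon [a, j]"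
    let ?y = "mon (j # L) - ?r j L"
    have a: "a \<notin> set L" using Cons.prems by auto
    have "?x \<in> wedge_rels q n"
      unfolding wedge_rels_def using Cons.prems 3
      by (intro UnI2 CollectI exI[of _ a] exI[of _ j]) auto
    then have "?x \<in> Rel" by (rule Rel_rel)
    then have 4: "?x * mon L \<in> Rel"
      using Cons.prems by (intro Rel_mult_right free_closed) auto
    have "?y \<in> Rel" using Cons by auto
    then have 5: "Poly_Mapping.single [a] (- inverse q) * ?y \<in> Rel"
      using Cons.prems by (intro Rel_mult_left free_closed) auto
    have "mon (j # a # L) - ?r j (a # L)
      = ?x * mon L + Poly_Mapping.single [a] (- inverse q) * ?y"
      using 3 a by (simp add: algebra_simps mult_single below_insert single_uminus)
        (simp add: power_add flip: single_add)
    then show ?thesis using Rel_add[OF 4 5] by simp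
  qed
qed

definition expand :: "(nat set \<Rightarrow> 'k) \<Rightarrow> (nat list \<Rightarrow>\<^sub>0 'k)" where
  "expand v = (\<Sum>J\<in>Pow {1..n}. Poly_Mapping.single (sorted_list_of_set J) (v J))"

lemma expand_carrier: "expand v \<in> carrier Fr"
  unfolding expand_def
  by (intro free_sum free_single) (use finite_subset in fastforce)

lemma expand_add: "expand (\<lambda>J. v J + v' J) = expand v + expand v'"
  by (simp add: expand_def single_add sum.distrib)

lemma expand_scale: "expand (\<lambda>J. c * v J) = cst c * expand v"
  by (simp add: expand_def sum_distrib_left mult_single)

lemma coords_expand:
  assumes "\<And>J. v J \<noteq> 0 \<Longrightarrow> J \<subseteq> {1..n}"
  shows "coords q (expand v) = v"
proof
  fix J
  have "coords q (expand v) J = (\<Sum>I\<in>Pow {1..n}. v I * of_bool (J = I))"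
    unfolding expand_def coords_sum
  proof (rule sum.cong)
    fix I assume "I \<in> Pow {1..n}"
    then have "finite I" using finite_subset by auto
    then show "coords q (Poly_Mapping.single (sorted_list_of_set I) (v I)) J = v I * of_bool (J = I)"
      by (simp add: foldr_lmul_vac_sorted coords_single)
  qed simp
  also have "\<dots> = (\<Sum>I\<in>Pow {1..n}. if I = J then v J else 0)"
    by (intro sum.cong) auto
  also have "\<dots> = v J"
    using assms[of J] by (subst sum.delta) auto
  finally show "coords q (expand v) J = v J" .
qed

lemma coords_supp_carrier: "p \<in> carrier Fr \<Longrightarrow> coords q p J \<noteq> 0 \<Longrightarrow> J \<subseteq> {1..n}"
  using coords_supp[of q p J] by (fastforce simp: carrier_free_algebra)

text \<open>The tail is replaced by its expansion into increasing monomials, dx_j is multiplied on,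
  and each product is straightened; the resulting coefficients are those of
  \<open>lmul\<close>.\<close>

lemma mon_expand: "set w \<subseteq> {1..n} \<Longrightarrow> mon w - expand (coords q (mon w)) \<in> Rel"
proof (induction w)
  case Nil
  have "expand vac = (\<Sum>J\<in>Pow {1..n}. if J = {} then mon [] else 0)"
    unfolding expand_def by (intro sum.cong) auto
  also have "\<dots> = mon []" by simp
  finally show ?case by (simp add: coords_mon_Nil Rel_zero)
next
  case (Cons j w)
  define v where "v = coords q (mon w)"
  have j: "j \<in> {1..n}" using Cons by auto
  have "mon w - expand v \<in> Rel" using Cons by (simp add: v_def)
  then have 1: "mon [j] * (mon w - expand v) \<in> Rel"
    using j by (intro Rel_mult_left free_closed) auto
  let ?t = "\<lambda>J. if j \<in> J then 0
    else Poly_Mapping.single (sorted_list_of_set (insert j J)) ((- inverse q) ^ below j J)"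
  have 2: "cst (v J) * (mon (j # sorted_list_of_set J) - ?t J) \<in> Rel" if "J \<in> Pow {1..n}" for J
  proof -
    have "finite J" using that finite_subset by auto
    with that j show ?thesis
      using straighten[of "sorted_list_of_set J" j]
      by (intro Rel_mult_left free_closed) (auto simp: sorted_list_of_set_insert)
  qed
  \<comment> \<open>Only the \<open>J\<close> without j contribute. Inserting j maps them
    bijectively to the sets containing j, outside of which \<open>lmul q j v\<close>
    vanishes.\<close>
  have 3: "(\<Sum>J\<in>Pow {1..n}. cst (v J) * ?t J) = expand (lmul q j v)"
  proof -
    have "(\<Sum>J\<in>Pow {1..n}. cst (v J) * ?t J) = (\<Sum>J\<in>{J\<in>Pow {1..n}. j \<notin> J}. cst (v J) * ?t J)"
      by (intro sum.mono_neutral_right) auto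
    also have "\<dots> = (\<Sum>J\<in>{J\<in>Pow {1..n}. j \<in> J}.
        Poly_Mapping.single (sorted_list_of_set J) (lmul q j v J))"
      by (rule sum.reindex_bij_witness[of _ "\<lambda>J. J - {j}" "insert j"])
        (use j in \<open>auto simp: mult_single lmul_def insert_absorb mult.commute\<close>)
    also have "\<dots> = expand (lmul q j v)"
      unfolding expand_def by (intro sum.mono_neutral_left) (auto simp: lmul_def)
    finally show ?thesis .
  qed
  have "mon (j # w) - expand (coords q (mon (j # w)))
    = mon [j] * (mon w - expand v)
      + (\<Sum>J\<in>Pow {1..n}. cst (v J) * (mon (j # sorted_list_of_set J) - ?t J))"
  proof -
    have "mon [j] * expand v = (\<Sum>J\<in>Pow {1..n}. cst (v J) * mon (j # sorted_list_of_set J))"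
      by (simp add: expand_def sum_distrib_left mult_single)
    moreover have "coords q (mon (j # w)) = lmul q j v"
      by (simp add: coords_mon_Cons v_def)
    ultimately show ?thesis
      by (simp add: right_diff_distrib sum_subtractf 3 mult_single)
  qed
  then show ?case by (simp only: Rel_add[OF 1 Rel_sum[OF 2]])
qed

lemma expand_coords:
  assumes "p \<in> carrier Fr"
  shows "p - expand (coords q p) \<in> Rel"
proof -
  have "(\<Sum>w\<in>A. Poly_Mapping.single w (c w))
      - expand (coords q (\<Sum>w\<in>A. Poly_Mapping.single w (c w))) \<in> Rel"
    if "finite A" "A \<subseteq> lists {1..n}" for A and c :: "nat list \<Rightarrow> 'k"
    using that
  proof (induction A)
    case empty
    have "expand (coords q 0) = 0" by (simp add: expand_def)
    then show ?case by (simp only: sum.empty) (simp add: Rel_zero)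
  next
    case (insert w A)
    let ?r = "\<Sum>w\<in>A. Poly_Mapping.single w (c w)"
    have s: "expand (coords q (Poly_Mapping.single w (c w))) = cst (c w) * expand (coords q (mon w))"
      by (simp add: expand_scale[symmetric] coords_single[abs_def])
    have "cst (c w) * (mon w - expand (coords q (mon w))) \<in> Rel"
      using insert by (intro Rel_mult_left free_closed mon_expand) auto
    then have "Poly_Mapping.single w (c w) - expand (coords q (Poly_Mapping.single w (c w))) \<in> Rel"
      unfolding s by (simp add: right_diff_distrib mult_single)
    moreover have "?r - expand (coords q ?r) \<in> Rel" using insert by auto
    ultimately have "Poly_Mapping.single w (c w) - expand (coords q (Poly_Mapping.single w (c w)))
        + (?r - expand (coords q ?r)) \<in> Rel" by (rule Rel_add)
    moreover have "expand (coords q (Poly_Mapping.single w (c w) + ?r))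
        = expand (coords q (Poly_Mapping.single w (c w))) + expand (coords q ?r)"
      by (simp add: expand_add[symmetric])
        (rule arg_cong[where f = expand], simp add: fun_eq_iff)
    ultimately show ?case using insert by (simp add: algebra_simps expand_add)
  qed
  from this[of "Poly_Mapping.keys p" "Poly_Mapping.lookup p"] assms show ?thesis
    by (simp add: carrier_free_algebra poly_mapping_eq_sum_single[symmetric])
qed

text \<open>The basis theorem: coordinates are well defined because the relations act by zero
  (independence), and they suffice because every element is congruent to its expansion
  (spanning).\<close>

lemma cl_eq_iff:
  assumes "p \<in> carrier Fr" "p' \<in> carrier Fr"
  shows "cl p = cl p' \<longleftrightarrow> coords q p = coords q p'"
proof
  assume "cl p = cl p'"
  then have "p - p' \<in> Rel" using assms cl_eqD[of p' p] cl_self[of p] by simp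
  then show "coords q p = coords q p'" by (rule coords_Rel)
next
  assume "coords q p = coords q p'"
  then have "p - p' \<in> Rel"
    using Rel_diff[OF expand_coords[OF assms(1)] expand_coords[OF assms(2)]] by simp
  then show "cl p = cl p'" using assms by (rule cl_eqI[rotated 2])
qed

definition wcoord :: "(nat list \<Rightarrow>\<^sub>0 'k) set \<Rightarrow> nat set \<Rightarrow> 'k" where
  "wcoord C = coords q (SOME p. p \<in> C)"

lemma wcoord_cl: "p \<in> carrier Fr \<Longrightarrow> wcoord (cl p) = coords q p"
  unfolding wcoord_def by (intro coords_Rel cl_some)

lemma wedge_cases:
  assumes "C \<in> carrier (wedge q n)"
  obtains p where "p \<in> carrier Fr" "C = cl p"
  using assms carrier_Pr by (auto simp: Pr_eq)

lemma wcoord_inj: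
  "C \<in> carrier (wedge q n) \<Longrightarrow> C' \<in> carrier (wedge q n) \<Longrightarrow> wcoord C = wcoord C' \<Longrightarrow> C = C'"
  by (elim wedge_cases) (simp add: wcoord_cl cl_eq_iff)

lemma wcoord_add:
  "C \<in> carrier (wedge q n) \<Longrightarrow> C' \<in> carrier (wedge q n)
    \<Longrightarrow> wcoord (C \<oplus>\<^bsub>wedge q n\<^esub> C') J = wcoord C J + wcoord C' J"
  by (elim wedge_cases) (simp add: wcoord_cl cl_add free_add flip: Pr_eq)

lemma wcoord_zero [simp]: "wcoord (\<zero>\<^bsub>wedge q n\<^esub>) J = 0"
  by (simp add: cl_zero wcoord_cl flip: Pr_eq)

lemma wedge_scale_closed: "C \<in> carrier (wedge q n) \<Longrightarrow> wedge_scale q n c C \<in> carrier (wedge q n)"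
  unfolding wedge_scale_def Pr_eq[symmetric] cl_eq[symmetric]
  by (intro Pr.m_closed cl_carrier free_closed) auto

lemma wcoord_scale:
  "C \<in> carrier (wedge q n) \<Longrightarrow> wcoord (wedge_scale q n c C) J = c * wcoord C J"
  unfolding wedge_scale_def Pr_eq[symmetric] cl_eq[symmetric]
  by (auto simp: carrier_Pr cl_mult wcoord_cl free_closed coords_mult)

lemma wedge_lmul_closed:
  "j \<in> {1..n} \<Longrightarrow> C \<in> carrier (wedge q n)
    \<Longrightarrow> wedge_class q n (mon [j]) \<otimes>\<^bsub>wedge q n\<^esub> C \<in> carrier (wedge q n)"
  unfolding Pr_eq[symmetric] cl_eq[symmetric]
  by (intro Pr.m_closed cl_carrier free_closed) auto

lemma wcoord_lmul:
  "j \<in> {1..n} \<Longrightarrow> C \<in> carrier (wedge q n)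
    \<Longrightarrow> wcoord (wedge_class q n (mon [j]) \<otimes>\<^bsub>wedge q n\<^esub> C) = lmul q j (wcoord C)"
  unfolding Pr_eq[symmetric] cl_eq[symmetric]
  by (auto simp: carrier_Pr cl_mult wcoord_cl free_closed coords_mult fun_eq_iff)

lemma wcoord_supp: "C \<in> carrier (wedge q n) \<Longrightarrow> wcoord C J \<noteq> 0 \<Longrightarrow> J \<subseteq> {1..n}"
  by (elim wedge_cases) (auto simp: wcoord_cl dest: coords_supp_carrier)

lemma wcoord_surj:
  assumes "\<And>J. v J \<noteq> 0 \<Longrightarrow> J \<subseteq> {1..n}"
  shows "\<exists>C\<in>carrier (wedge q n). wcoord C = v"
  using coords_expand[OF assms] expand_carrier[of v]
  by (intro bexI[of _ "cl (expand v)"]) (simp_all add: wcoord_cl cl_carrier flip: Pr_eq)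

text \<open>For the converse, \<open>expand\<close> of the coordinates is a representative whose
  words all have length s. Other representatives need not be homogeneous.\<close>

lemma wedge_deg_iff:
  "C \<in> wedge_deg q n s \<longleftrightarrow> C \<in> carrier (wedge q n) \<and> (\<forall>J. wcoord C J \<noteq> 0 \<longrightarrow> card J = s)"
proof safe
  assume "C \<in> wedge_deg q n s"
  then obtain p where p: "C = cl p" "\<And>w. w \<in> Poly_Mapping.keys p \<Longrightarrow> w \<in> lists {1..n} \<and> length w = s"
    by (auto simp: wedge_deg_def cl_eq)
  then have c: "p \<in> carrier Fr" by (auto simp: carrier_free_algebra)
  with p show "C \<in> carrier (wedge q n)" by (simp add: cl_carrier flip: Pr_eq)
  fix J assume "wcoord C J \<noteq> 0"
  then show "card J = s" using p c coords_supp[of q p J] by (auto simp: wcoord_cl)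
next
  assume C: "C \<in> carrier (wedge q n)" and s: "\<forall>J. wcoord C J \<noteq> 0 \<longrightarrow> card J = s"
  let ?p = "expand (wcoord C)"
  have "wcoord (cl ?p) = wcoord C"
    using wcoord_supp[OF C] by (simp add: wcoord_cl expand_carrier coords_expand)
  then have "C = cl ?p"
    using C by (intro wcoord_inj) (auto simp: expand_carrier cl_carrier simp flip: Pr_eq)
  moreover have "w \<in> lists {1..n} \<and> length w = s" if "w \<in> Poly_Mapping.keys ?p" for w
  proof -
    from that obtain J where "J \<in> Pow {1..n}" "w = sorted_list_of_set J" "wcoord C J \<noteq> 0"
      using keys_sum[of "\<lambda>J. Poly_Mapping.single (sorted_list_of_set J) (wcoord C J)" "Pow {1..n}"]
      by (auto simp: expand_def split: if_splits)
    then show ?thesis using s finite_subset[of J "{1..n}"] by auto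
  qed
  ultimately show "C \<in> wedge_deg q n s" by (auto simp: wedge_deg_def cl_eq)
qed

lemma word_act_carrier:
  assumes "g \<in> uq_gens n"
  shows "set w \<subseteq> {1..n} \<Longrightarrow> word_act q g w \<in> carrier Fr"
proof -
  have K: "set w \<subseteq> {1..n} \<Longrightarrow> word_act q (K i) w \<in> carrier Fr" for i w
    by (induction w) (auto intro!: free_closed)
  have Ki: "set w \<subseteq> {1..n} \<Longrightarrow> word_act q (Ki i) w \<in> carrier Fr" for i w
    by (induction w) (auto intro!: free_closed)
  have E: "set w \<subseteq> {1..n} \<Longrightarrow> word_act q (E i) w \<in> carrier Fr" if "i \<in> {1..n-1}" for i w
    using that by (induction w) (auto intro!: free_closed K)
  have F: "set w \<subseteq> {1..n} \<Longrightarrow> word_act q (F i) w \<in> carrier Fr" if "i \<in> {1..n-1}" for i w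
    using that by (induction w) (auto intro!: free_closed)
  show "set w \<subseteq> {1..n} \<Longrightarrow> word_act q g w \<in> carrier Fr"
    using assms E F K Ki by (auto simp: uq_gens_def)
qed

text \<open>The coordinates of the result depend only on those of the chosen representative. Hence
  the action on cosets is independent of the choice, without a separate check that it preserves the
  ideal.\<close>

lemma wedge_act_cl:
  assumes "g \<in> uq_gens n" "C \<in> carrier (wedge q n)"
  shows "wedge_act q n g C \<in> carrier (wedge q n)" "wcoord (wedge_act q n g C) = wact q g (wcoord C)"
proof -
  obtain p where p: "p \<in> carrier Fr" "C = cl p" using assms(2) by (rule wedge_cases)
  let ?s = "SOME p. p \<in> C"
  have "?s \<in> carrier Fr" using p cl_some[of p] by simp
  then have f: "free_act q g ?s \<in> carrier Fr"
    unfolding free_act_def using word_act_carrier[OF assms(1)]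
    by (intro free_closed) (auto simp: carrier_free_algebra)
  then show "wedge_act q n g C \<in> carrier (wedge q n)"
    by (simp add: wedge_act_def cl_carrier flip: Pr_eq cl_eq)
  show "wcoord (wedge_act q n g C) = wact q g (wcoord C)"
    using f q_nonzero by (simp add: wedge_act_def wcoord_cl coords_free_act flip: cl_eq)
      (simp add: wcoord_def)
qed

end

section \<open>Differential forms in coordinates\<close>

lemma xterm_keys: "Poly_Mapping.keys (xterm n c \<beta>) \<subseteq> exps n"
  by (simp add: xterm_def)

lemma lookup_xterm: "Poly_Mapping.lookup (xterm n c \<gamma>) \<beta> = (if \<gamma> = \<beta> \<and> \<beta> \<in> exps n then c else 0)"
  by (auto simp: xterm_def lookup_single when_def)

lemma A_act_keys: "Poly_Mapping.keys (A_act q n g \<beta>) \<subseteq> exps n"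
  by (cases g) (simp_all add: xterm_keys)

lemma (in abelian_monoid) abelian_monoid_finsum_hom:
  assumes "\<And>x y. x \<in> carrier G \<Longrightarrow> y \<in> carrier G \<Longrightarrow> \<phi> (x \<oplus> y) = \<phi> x + (\<phi> y :: 'v::comm_monoid_add)"
    and "\<phi> \<zero> = 0" and "\<And>x. x \<in> A \<Longrightarrow> h x \<in> carrier G"
  shows "\<phi> (\<Oplus>x\<in>A. h x) = (\<Sum>x\<in>A. \<phi> (h x))"
  using assms(3)
proof (induction A rule: infinite_finite_induct)
  case (insert x A)
  then have "\<phi> (\<Oplus>x\<in>insert x A. h x) = \<phi> (h x \<oplus> (\<Oplus>x\<in>A. h x))"
    by (subst finsum_insert) auto
  also have "\<dots> = \<phi> (h x) + \<phi> (\<Oplus>x\<in>A. h x)"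
    using insert by (intro assms(1) finsum_closed) auto
  finally show ?case using insert by simp
qed (use assms(2) in simp_all)

text \<open>\<open>u \<alpha> J\<close> stands for the coordinate of a form at \<open>x\<^sup>(\<^sup>\<alpha>\<^sup>) \<otimes> dx\<^sub>J\<close>.  Coefficients are written in terms of
  the exponent \<open>\<beta>\<close> of the result, e.g. \<open>[\<beta>\<^sub>i]\<close> is the \<open>[\<alpha>\<^sub>i + 1]\<close> of \<open>A_act\<close>.\<close>

fun gop :: "'k::field \<Rightarrow> nat \<Rightarrow> ugen \<Rightarrow> ((nat \<Rightarrow> int) \<Rightarrow> nat set \<Rightarrow> 'k) \<Rightarrow> (nat \<Rightarrow> int) \<Rightarrow> nat set \<Rightarrow> 'k"
  where
  "gop q n (E i) u \<beta> J = (if \<beta> \<in> exps n then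
     qint q (\<beta> i) * wact q (K i) (u (\<beta>(i := \<beta> i - 1, Suc i := \<beta> (Suc i) + 1))) J
     + wact q (E i) (u \<beta>) J else 0)"
| "gop q n (F i) u \<beta> J = (if \<beta> \<in> exps n then
     qint q (\<beta> (Suc i)) * u (\<beta>(i := \<beta> i + 1, Suc i := \<beta> (Suc i) - 1)) J
     + q powi (- (\<beta> i - \<beta> (Suc i))) * wact q (F i) (u \<beta>) J else 0)"
| "gop q n (K i) u \<beta> J = (if \<beta> \<in> exps n then
     q powi (\<beta> i - \<beta> (Suc i)) * wact q (K i) (u \<beta>) J else 0)"
| "gop q n (Ki i) u \<beta> J = (if \<beta> \<in> exps n then
     q powi (- (\<beta> i - \<beta> (Suc i))) * wact q (Ki i) (u \<beta>) J else 0)"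

text \<open>The prefix sum is taken over the target exponent \<open>\<beta>\<close>; it stops before
  j, so it agrees with that of the source exponent, which differs from \<open>\<beta>\<close> only
  at j.\<close>

definition dop :: "'k::field \<Rightarrow> nat \<Rightarrow> ((nat \<Rightarrow> int) \<Rightarrow> nat set \<Rightarrow> 'k) \<Rightarrow> (nat \<Rightarrow> int) \<Rightarrow> nat set \<Rightarrow> 'k"
  where "dop q n u \<beta> J = (if \<beta> \<in> exps n then
    \<Sum>j\<in>{1..n}. q powi (- (\<Sum>i\<in>{1..<j}. \<beta> i)) * lmul q j (u (\<beta>(j := \<beta> j + 1))) J else 0)"

context quantum_exterior
begin

sublocale W: ring "wedge q n"
  using Pr.ring_axioms by (simp add: Pr_eq)

definition co :: "'k form \<Rightarrow> (nat \<Rightarrow> int) \<Rightarrow> nat set \<Rightarrow> 'k" where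
  "co f \<alpha> J = wcoord (f \<alpha>) J"

lemma Omega_carrier_iff: "f \<in> carrier (Omega q n) \<longleftrightarrow>
    (\<forall>\<alpha>. f \<alpha> \<in> carrier (wedge q n)) \<and> finite (supp q n f) \<and> supp q n f \<subseteq> exps n"
  by (simp add: Omega_def)

lemma Omega_app: "f \<in> carrier (Omega q n) \<Longrightarrow> f \<alpha> \<in> carrier (wedge q n)"
  by (simp add: Omega_carrier_iff)

lemma Omega_simps [simp]:
  "\<zero>\<^bsub>Omega q n\<^esub> = (\<lambda>\<alpha>. \<zero>\<^bsub>wedge q n\<^esub>)"
  "f \<oplus>\<^bsub>Omega q n\<^esub> g = (\<lambda>\<alpha>. f \<alpha> \<oplus>\<^bsub>wedge q n\<^esub> g \<alpha>)"
  "c \<odot>\<^bsub>Omega q n\<^esub> f = (\<lambda>\<alpha>. wedge_scale q n c (f \<alpha>))"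
  by (simp_all add: Omega_def)

lemma wcoord_eq_0_iff: "C \<in> carrier (wedge q n) \<Longrightarrow> wcoord C = (\<lambda>J. 0) \<longleftrightarrow> C = \<zero>\<^bsub>wedge q n\<^esub>"
  using wcoord_inj[of C "\<zero>\<^bsub>wedge q n\<^esub>"] by (auto simp: fun_eq_iff)

lemma supp_co: "f \<in> carrier (Omega q n) \<Longrightarrow> supp q n f = {\<alpha>. \<exists>J. co f \<alpha> J \<noteq> 0}"
  using wcoord_eq_0_iff[OF Omega_app[of f]] by (auto simp: supp_def co_def fun_eq_iff)

lemma Omega_carrierI:
  assumes "\<And>\<alpha>. f \<alpha> \<in> carrier (wedge q n)" "finite A"
    and "\<And>\<alpha>. f \<alpha> \<noteq> \<zero>\<^bsub>wedge q n\<^esub> \<Longrightarrow> \<alpha> \<in> A \<and> \<alpha> \<in> exps n"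
  shows "f \<in> carrier (Omega q n)"
  using assms finite_subset[of "supp q n f" A] by (auto simp: Omega_carrier_iff supp_def)

lemma Omega_zero_closed: "\<zero>\<^bsub>Omega q n\<^esub> \<in> carrier (Omega q n)"
  by (rule Omega_carrierI[where A = "{}"]) auto

lemma Omega_add_closed:
  assumes "f \<in> carrier (Omega q n)" "g \<in> carrier (Omega q n)"
  shows "f \<oplus>\<^bsub>Omega q n\<^esub> g \<in> carrier (Omega q n)"
proof (rule Omega_carrierI[where A = "supp q n f \<union> supp q n g"])
  fix \<alpha> assume "(f \<oplus>\<^bsub>Omega q n\<^esub> g) \<alpha> \<noteq> \<zero>\<^bsub>wedge q n\<^esub>"
  then have "f \<alpha> \<noteq> \<zero>\<^bsub>wedge q n\<^esub> \<or> g \<alpha> \<noteq> \<zero>\<^bsub>wedge q n\<^esub>" by auto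
  then show "\<alpha> \<in> supp q n f \<union> supp q n g \<and> \<alpha> \<in> exps n"
    using assms by (auto simp: Omega_carrier_iff supp_def)
qed (use assms in \<open>auto simp: Omega_carrier_iff\<close>)

lemma abelian_group_Omega: "abelian_group (Omega q n)"
proof (rule abelian_groupI)
  fix f assume f: "f \<in> carrier (Omega q n)"
  show "\<exists>g\<in>carrier (Omega q n). g \<oplus>\<^bsub>Omega q n\<^esub> f = \<zero>\<^bsub>Omega q n\<^esub>"
  proof (intro bexI[of _ "\<lambda>\<alpha>. \<ominus>\<^bsub>wedge q n\<^esub> f \<alpha>"])
    show "(\<lambda>\<alpha>. \<ominus>\<^bsub>wedge q n\<^esub> f \<alpha>) \<in> carrier (Omega q n)"
      using f by (intro Omega_carrierI[where A = "supp q n f"])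
        (auto simp: Omega_carrier_iff supp_def)
  qed (use f in \<open>auto simp: Omega_carrier_iff W.l_neg\<close>)
qed (use Omega_zero_closed Omega_add_closed in \<open>auto simp: Omega_carrier_iff W.a_ac\<close>)

sublocale Om: abelian_group "Omega q n"
  by (rule abelian_group_Omega)

lemma co_inj:
  "f \<in> carrier (Omega q n) \<Longrightarrow> g \<in> carrier (Omega q n) \<Longrightarrow> co f = co g \<Longrightarrow> f = g"
  by (rule ext, rule wcoord_inj) (auto simp: Omega_app[of f] Omega_app[of g] co_def fun_eq_iff)

lemma co_zero: "co \<zero>\<^bsub>Omega q n\<^esub> \<alpha> J = 0"
  by (simp add: co_def)

lemma co_add: "f \<in> carrier (Omega q n) \<Longrightarrow> g \<in> carrier (Omega q n)
    \<Longrightarrow> co (f \<oplus>\<^bsub>Omega q n\<^esub> g) \<alpha> J = co f \<alpha> J + co g \<alpha> J"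
  by (simp add: co_def wcoord_add Omega_app[of f] Omega_app[of g])

lemma co_smult: "f \<in> carrier (Omega q n) \<Longrightarrow> co (c \<odot>\<^bsub>Omega q n\<^esub> f) \<alpha> J = c * co f \<alpha> J"
  by (simp add: co_def wcoord_scale Omega_app[of f])

lemma wedge_scale_zero: "wedge_scale q n c \<zero>\<^bsub>wedge q n\<^esub> = \<zero>\<^bsub>wedge q n\<^esub>"
  by (rule wcoord_inj) (auto simp: wedge_scale_closed wcoord_scale fun_eq_iff)

lemma Omega_smult_closed:
  "f \<in> carrier (Omega q n) \<Longrightarrow> c \<odot>\<^bsub>Omega q n\<^esub> f \<in> carrier (Omega q n)"
proof (rule Omega_carrierI[where A = "supp q n f"])
  assume f: "f \<in> carrier (Omega q n)"
  show "(c \<odot>\<^bsub>Omega q n\<^esub> f) \<alpha> \<in> carrier (wedge q n)" for \<alpha>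
    using wedge_scale_closed[OF Omega_app[OF f]] by simp
  fix \<alpha> assume "(c \<odot>\<^bsub>Omega q n\<^esub> f) \<alpha> \<noteq> \<zero>\<^bsub>wedge q n\<^esub>"
  then have "\<alpha> \<in> supp q n f" using wedge_scale_zero by (auto simp: supp_def)
  then show "\<alpha> \<in> supp q n f \<and> \<alpha> \<in> exps n" using f by (auto simp: Omega_carrier_iff)
qed (simp add: Omega_carrier_iff)

lemma co_finsum:
  assumes "\<And>x. x \<in> A \<Longrightarrow> h x \<in> carrier (Omega q n)"
  shows "co (\<Oplus>\<^bsub>Omega q n\<^esub>x\<in>A. h x) \<alpha> J = (\<Sum>x\<in>A. co (h x) \<alpha> J)"
  by (rule Om.abelian_monoid_finsum_hom[of "\<lambda>f. co f \<alpha> J", OF co_add co_zero assms])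

lemma co_supp:
  assumes f: "f \<in> carrier (Omega q n)" and "co f \<alpha> J \<noteq> 0"
  shows "\<alpha> \<in> exps n \<and> J \<subseteq> {1..n}"
proof
  have "\<alpha> \<in> supp q n f" unfolding supp_co[OF f] using assms(2) by blast
  then show "\<alpha> \<in> exps n" using f by (auto simp: Omega_carrier_iff)
  show "J \<subseteq> {1..n}" using assms(2) wcoord_supp[OF Omega_app[OF f], of \<alpha> J] unfolding co_def by blast
qed

lemma co_surj:
  assumes "finite {\<alpha>. \<exists>J. u \<alpha> J \<noteq> 0}" and "\<And>\<alpha> J. u \<alpha> J \<noteq> 0 \<Longrightarrow> \<alpha> \<in> exps n \<and> J \<subseteq> {1..n}"
  shows "\<exists>f\<in>carrier (Omega q n). co f = u"
proof -
  have "\<exists>C. C \<in> carrier (wedge q n) \<and> wcoord C = u \<alpha>" for \<alpha>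
    using wcoord_surj[of "u \<alpha>"] assms(2)[of \<alpha>] by blast
  then have "\<exists>f. \<forall>\<alpha>. f \<alpha> \<in> carrier (wedge q n) \<and> wcoord (f \<alpha>) = u \<alpha>"
    by (intro choice allI)
  then obtain f where f: "\<And>\<alpha>. f \<alpha> \<in> carrier (wedge q n)" "\<And>\<alpha>. wcoord (f \<alpha>) = u \<alpha>"
    by auto
  have "f \<in> carrier (Omega q n)"
  proof (rule Omega_carrierI[OF f(1) assms(1)])
    fix \<alpha> assume "f \<alpha> \<noteq> \<zero>\<^bsub>wedge q n\<^esub>"
    then have "u \<alpha> \<noteq> (\<lambda>J. 0)"
      using wcoord_eq_0_iff[OF f(1), of \<alpha>] unfolding f(2) by simp
    then obtain J where "u \<alpha> J \<noteq> 0" by blast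
    then show "\<alpha> \<in> {\<alpha>. \<exists>J. u \<alpha> J \<noteq> 0} \<and> \<alpha> \<in> exps n" using assms(2) by blast
  qed
  moreover have "co f = u" by (simp add: co_def f(2) fun_eq_iff)
  ultimately show ?thesis by blast
qed

lemma co_tens:
  "w \<in> carrier (wedge q n) \<Longrightarrow> co (tens q n a w) \<alpha> J = Poly_Mapping.lookup a \<alpha> * wcoord w J"
  by (simp add: co_def tens_def wcoord_scale)

lemma tens_closed:
  assumes "w \<in> carrier (wedge q n)" "Poly_Mapping.keys a \<subseteq> exps n"
  shows "tens q n a w \<in> carrier (Omega q n)"
proof (rule Omega_carrierI[where A = "Poly_Mapping.keys a"])
  fix \<alpha> assume *: "tens q n a w \<alpha> \<noteq> \<zero>\<^bsub>wedge q n\<^esub>"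
  have "wcoord (wedge_scale q n 0 w) = (\<lambda>J. 0)"
    by (rule ext) (simp add: wcoord_scale assms(1))
  then have "wedge_scale q n 0 w = \<zero>\<^bsub>wedge q n\<^esub>"
    by (simp add: wcoord_eq_0_iff wedge_scale_closed assms(1))
  with * have "Poly_Mapping.lookup a \<alpha> \<noteq> 0" unfolding tens_def by metis
  then show "\<alpha> \<in> Poly_Mapping.keys a \<and> \<alpha> \<in> exps n" using assms(2) by (auto simp: in_keys_iff)
qed (simp_all add: tens_def wedge_scale_closed assms(1))

text \<open>The coefficient at \<open>\<beta>\<close> is fed by the single exponent
  \<open>\<beta>'\<close>. As \<open>X\<close> vanishes off the support, \<open>\<beta>'\<close>
  need not lie in it.\<close>

lemma sum_supp_xterm:
  assumes "f \<in> carrier (Omega q n)" and "\<And>\<alpha>. \<alpha> \<notin> supp q n f \<Longrightarrow> X \<alpha> = 0"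
    and "\<And>\<alpha>. T \<alpha> = \<beta> \<longleftrightarrow> \<alpha> = \<beta>'"
  shows "(\<Sum>\<alpha>\<in>supp q n f. Poly_Mapping.lookup (xterm n (c \<alpha>) (T \<alpha>)) \<beta> * X \<alpha>)
    = (if \<beta> \<in> exps n then c \<beta>' * X \<beta>' else 0)"
proof -
  have "(\<Sum>\<alpha>\<in>supp q n f. Poly_Mapping.lookup (xterm n (c \<alpha>) (T \<alpha>)) \<beta> * X \<alpha>)
    = (\<Sum>\<alpha>\<in>supp q n f. if \<alpha> = \<beta>' then (if \<beta> \<in> exps n then c \<beta>' * X \<beta>' else 0) else 0)"
    by (intro sum.cong) (auto simp: lookup_xterm assms(3))
  also have "\<dots> = (if \<beta> \<in> exps n then c \<beta>' * X \<beta>' else 0)"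
    using assms(1,2) by (subst sum.delta) (auto simp: Omega_carrier_iff)
  finally show ?thesis .
qed

lemma tens_act_closed:
  assumes "g \<in> uq_gens n" "w \<in> carrier (wedge q n)"
  shows "tens_act q n g \<alpha> w \<in> carrier (Omega q n)"
proof (cases g)
  case (E i)
  then have "K i \<in> uq_gens n" using assms(1) by (auto simp: uq_gens_def)
  with E assms show ?thesis
    by (simp only: tens_act.simps)
      (intro Omega_add_closed tens_closed wedge_act_cl(1) A_act_keys xterm_keys)
qed (use assms in \<open>simp_all only: tens_act.simps\<close>,
  (intro Omega_add_closed tens_closed wedge_act_cl(1) A_act_keys xterm_keys; assumption)+)

lemma Omega_gen_closed:
  "g \<in> uq_gens n \<Longrightarrow> f \<in> carrier (Omega q n) \<Longrightarrow> Omega_gen q n g f \<in> carrier (Omega q n)"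
  unfolding Omega_gen_def by (intro Om.finsum_closed Pi_I tens_act_closed) (simp_all add: Omega_app[of f])

lemma wact_zero [simp]: "wact q g (\<lambda>J. 0) J = 0"
  by (cases g) auto

lemma upd_shift:
  assumes "i \<noteq> j"
  shows "\<alpha>(i := \<alpha> i + (c::int), j := \<alpha> j + d) = \<beta> \<longleftrightarrow> \<alpha> = \<beta>(i := \<beta> i - c, j := \<beta> j - d)"
  using assms by (fastforce simp: fun_eq_iff)

lemma co_Omega_gen:
  assumes g: "g \<in> uq_gens n" and f: "f \<in> carrier (Omega q n)"
  shows "co (Omega_gen q n g f) \<beta> J = gop q n g (co f) \<beta> J"
proof -
  have c: "co f \<alpha> = wcoord (f \<alpha>)" for \<alpha>
    by (simp add: co_def fun_eq_iff)
  have z: "wcoord (f \<alpha>) = (\<lambda>J. 0)" if "\<alpha> \<notin> supp q n f" for \<alpha>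
    using that by (auto simp: supp_def)
  have W: "wcoord (wedge_act q n g (f \<alpha>)) = wact q g (wcoord (f \<alpha>))"
    "wedge_act q n g (f \<alpha>) \<in> carrier (wedge q n)" if "g \<in> uq_gens n" for \<alpha> g
    using wedge_act_cl[OF that Omega_app[OF f]] by auto
  have "co (Omega_gen q n g f) \<beta> J = (\<Sum>\<alpha>\<in>supp q n f. co (tens_act q n g \<alpha> (f \<alpha>)) \<beta> J)"
    unfolding Omega_gen_def using tens_act_closed[OF g Omega_app[OF f]] by (intro co_finsum)
  also have "\<dots> = gop q n g (co f) \<beta> J"
  proof (cases g)
    case (E i)
    then have i: "E i \<in> uq_gens n" "K i \<in> uq_gens n" using g by (auto simp: uq_gens_def)
    have "co (tens_act q n g \<alpha> (f \<alpha>)) \<beta> J =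
      Poly_Mapping.lookup (xterm n (qint q (\<alpha> i + 1)) (\<alpha>(i := \<alpha> i + 1, Suc i := \<alpha> (Suc i) - 1))) \<beta>
        * wact q (K i) (wcoord (f \<alpha>)) J
      + Poly_Mapping.lookup (xterm n 1 \<alpha>) \<beta> * wact q (E i) (wcoord (f \<alpha>)) J" for \<alpha>
      using E i W by (simp add: co_add co_tens tens_closed xterm_keys del: Omega_simps wact.simps)
    moreover have "(\<alpha>(i := \<alpha> i + 1, Suc i := \<alpha> (Suc i) - 1) = \<beta>)
        = (\<alpha> = \<beta>(i := \<beta> i - 1, Suc i := \<beta> (Suc i) + 1))" for \<alpha>
      using upd_shift[of i "Suc i" \<alpha> 1 "-1" \<beta>] by simp
    note sum_supp_xterm[OF f _ this, of "\<lambda>\<alpha>. wact q (K i) (wcoord (f \<alpha>)) J" "\<lambda>\<alpha>. qint q (\<alpha> i + 1)"]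
    \<comment> \<open>The second term of the coproduct leaves the exponent alone, so
      \<open>sum_supp_xterm\<close> is used with the identity as its shift; this supplies the
      matching premise.\<close>
    moreover have "(\<alpha> = \<beta>) = (\<alpha> = \<beta>)" for \<alpha> ..
    note sum_supp_xterm[OF f _ this, of "\<lambda>\<alpha>. wact q (E i) (wcoord (f \<alpha>)) J" "\<lambda>\<alpha>. 1"]
    ultimately show ?thesis
      unfolding E gop.simps c by (simp add: sum.distrib z del: wact.simps)
  next
    case (F i)
    then have i: "F i \<in> uq_gens n" using g by simp
    have "co (tens_act q n g \<alpha> (f \<alpha>)) \<beta> J =
      Poly_Mapping.lookup (xterm n (qint q (\<alpha> (Suc i) + 1)) (\<alpha>(i := \<alpha> i - 1, Suc i := \<alpha> (Suc i) + 1))) \<beta>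
        * wcoord (f \<alpha>) J
      + Poly_Mapping.lookup (xterm n (q powi (- (\<alpha> i - \<alpha> (Suc i)))) \<alpha>) \<beta> * wact q (F i) (wcoord (f \<alpha>)) J" for \<alpha>
      using F i W Omega_app[OF f]
      by (simp add: co_add co_tens tens_closed xterm_keys del: Omega_simps wact.simps)
    moreover have "(\<alpha>(i := \<alpha> i - 1, Suc i := \<alpha> (Suc i) + 1) = \<beta>)
        = (\<alpha> = \<beta>(i := \<beta> i + 1, Suc i := \<beta> (Suc i) - 1))" for \<alpha>
      using upd_shift[of i "Suc i" \<alpha> "-1" 1 \<beta>] by simp
    note sum_supp_xterm[OF f _ this, of "\<lambda>\<alpha>. wcoord (f \<alpha>) J" "\<lambda>\<alpha>. qint q (\<alpha> (Suc i) + 1)"]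
    moreover have "(\<alpha> = \<beta>) = (\<alpha> = \<beta>)" for \<alpha> ..
    note sum_supp_xterm[OF f _ this, of "\<lambda>\<alpha>. wact q (F i) (wcoord (f \<alpha>)) J"
      "\<lambda>\<alpha>. q powi (- (\<alpha> i - \<alpha> (Suc i)))"]
    ultimately show ?thesis
      unfolding F gop.simps c by (simp add: sum.distrib z del: wact.simps)
  next
    case (K i)
    then have i: "K i \<in> uq_gens n" using g by simp
    have "co (tens_act q n g \<alpha> (f \<alpha>)) \<beta> J =
      Poly_Mapping.lookup (xterm n (q powi (\<alpha> i - \<alpha> (Suc i))) \<alpha>) \<beta> * wact q (K i) (wcoord (f \<alpha>)) J" for \<alpha>
      using K i W by (simp add: co_tens del: Omega_simps wact.simps)
    moreover have "(\<alpha> = \<beta>) = (\<alpha> = \<beta>)" for \<alpha> ..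
    note sum_supp_xterm[OF f _ this, of "\<lambda>\<alpha>. wact q (K i) (wcoord (f \<alpha>)) J"
      "\<lambda>\<alpha>. q powi (\<alpha> i - \<alpha> (Suc i))"]
    ultimately show ?thesis
      unfolding K gop.simps c by (simp add: z del: wact.simps)
  next
    case (Ki i)
    then have i: "Ki i \<in> uq_gens n" using g by simp
    have "co (tens_act q n g \<alpha> (f \<alpha>)) \<beta> J =
      Poly_Mapping.lookup (xterm n (q powi (- (\<alpha> i - \<alpha> (Suc i)))) \<alpha>) \<beta> * wact q (Ki i) (wcoord (f \<alpha>)) J" for \<alpha>
      using Ki i W by (simp add: co_tens del: Omega_simps wact.simps)
    moreover have "(\<alpha> = \<beta>) = (\<alpha> = \<beta>)" for \<alpha> ..
    note sum_supp_xterm[OF f _ this, of "\<lambda>\<alpha>. wact q (Ki i) (wcoord (f \<alpha>)) J"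
      "\<lambda>\<alpha>. q powi (- (\<alpha> i - \<alpha> (Suc i)))"]
    ultimately show ?thesis
      unfolding Ki gop.simps c by (simp add: z del: wact.simps)
  qed
  finally show ?thesis .
qed

lemma d_term_closed:
  "j \<in> {1..n} \<Longrightarrow> w \<in> carrier (wedge q n) \<Longrightarrow>
    tens q n (xterm n c \<beta>) (wedge_class q n (mon [j]) \<otimes>\<^bsub>wedge q n\<^esub> w) \<in> carrier (Omega q n)"
  by (intro tens_closed wedge_lmul_closed xterm_keys)

lemma dOmega_closed: "f \<in> carrier (Omega q n) \<Longrightarrow> dOmega q n f \<in> carrier (Omega q n)"
  unfolding dOmega_def
  by (intro Om.finsum_closed Pi_I d_term_closed) (simp_all add: Omega_app[of f])

lemma co_dOmega:
  assumes f: "f \<in> carrier (Omega q n)"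
  shows "co (dOmega q n f) \<beta> J = dop q n (co f) \<beta> J"
proof -
  have c: "co f \<alpha> = wcoord (f \<alpha>)" for \<alpha>
    by (simp add: co_def fun_eq_iff)
  have z: "wcoord (f \<alpha>) = (\<lambda>J. 0)" if "\<alpha> \<notin> supp q n f" for \<alpha>
    using that by (auto simp: supp_def)
  let ?t = "\<lambda>\<alpha> j. tens q n (xterm n (q powi (- (\<Sum>i\<in>{1..<j}. \<alpha> i))) (\<alpha>(j := \<alpha> j - 1)))
              (wedge_class q n (mon [j]) \<otimes>\<^bsub>wedge q n\<^esub> f \<alpha>)"
  have t: "?t \<alpha> j \<in> carrier (Omega q n)" if "j \<in> {1..n}" for \<alpha> j
    using that Omega_app[OF f] by (rule d_term_closed)
  have "co (dOmega q n f) \<beta> J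
      = (\<Sum>\<alpha>\<in>supp q n f. co (\<Oplus>\<^bsub>Omega q n\<^esub>j\<in>{1..n}. ?t \<alpha> j) \<beta> J)"
    unfolding dOmega_def using t by (intro co_finsum Om.finsum_closed Pi_I)
  also have "\<dots> = (\<Sum>\<alpha>\<in>supp q n f. \<Sum>j\<in>{1..n}. co (?t \<alpha> j) \<beta> J)"
    using t by (intro sum.cong refl co_finsum)
  also have "\<dots> = (\<Sum>\<alpha>\<in>supp q n f. \<Sum>j\<in>{1..n}.
      Poly_Mapping.lookup (xterm n (q powi (- (\<Sum>i\<in>{1..<j}. \<alpha> i))) (\<alpha>(j := \<alpha> j - 1))) \<beta>
        * lmul q j (wcoord (f \<alpha>)) J)"
    by (intro sum.cong refl) (simp add: co_tens wedge_lmul_closed wcoord_lmul Omega_app[OF f])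
  also have "\<dots> = (\<Sum>j\<in>{1..n}. \<Sum>\<alpha>\<in>supp q n f.
      Poly_Mapping.lookup (xterm n (q powi (- (\<Sum>i\<in>{1..<j}. \<alpha> i))) (\<alpha>(j := \<alpha> j - 1))) \<beta>
        * lmul q j (wcoord (f \<alpha>)) J)"
    by (rule sum.swap)
  also have "\<dots> = (\<Sum>j\<in>{1..n}. if \<beta> \<in> exps n then
      q powi (- (\<Sum>i\<in>{1..<j}. (\<beta>(j := \<beta> j + 1)) i)) * lmul q j (wcoord (f (\<beta>(j := \<beta> j + 1)))) J else 0)"
  proof (intro sum.cong refl sum_supp_xterm[OF f])
    show "lmul q j (wcoord (f \<alpha>)) J = 0" if "\<alpha> \<notin> supp q n f" for \<alpha> j
      using z[OF that] by (simp add: lmul_def)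
    show "\<alpha>(j := \<alpha> j - 1) = \<beta> \<longleftrightarrow> \<alpha> = \<beta>(j := \<beta> j + 1)" for \<alpha> j
      by (fastforce simp: fun_eq_iff)
  qed
  also have "\<dots> = dop q n (co f) \<beta> J"
  proof (cases "\<beta> \<in> exps n")
    case True
    have "(\<Sum>i\<in>{1..<j}. (\<beta>(j := \<beta> j + 1)) i) = (\<Sum>i\<in>{1..<j}. \<beta> i)" for j
      by (rule sum.cong) simp_all
    then show ?thesis using True unfolding dop_def c by simp
  qed (simp add: dop_def)
  finally show ?thesis .
qed

end

section \<open>The differential in weight coordinates\<close>

lemma qint_zero [simp]: "qint q 0 = 0"
  by (simp add: qint_def)

text \<open>Both follow after multiplication by q - q^(-1). The first form is the one that e_i
  needs, the second the one for f_i.\<close>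

lemma qint_rec:
  assumes "q \<noteq> 0" "q - inverse q \<noteq> 0"
  shows "qint q a = q * qint q (a - 1) + q * q powi (- a)"
    and "qint q a = inverse q * qint q (a - 1) + inverse q * q powi a"
proof -
  have 1: "q powi (a - 1) = q powi a / q" "q powi (1 - a) = q * q powi (- a)"
    using assms(1) by (simp_all add: power_int_diff power_int_minus divide_inverse)
  have 2: "qint q b * (q - inverse q) = q powi b - q powi (- b)" for b
    using assms(2) by (simp add: qint_def)
  have "qint q a * (q - inverse q) = (q * qint q (a - 1) + q * q powi (- a)) * (q - inverse q)"
    using assms(1) by (simp add: distrib_right 2 mult.assoc 1) (simp add: field_simps)
  then show "qint q a = q * qint q (a - 1) + q * q powi (- a)"
    using assms(2) by simp
  have "qint q a * (q - inverse q)
      = (inverse q * qint q (a - 1) + inverse q * q powi a) * (q - inverse q)"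
    using assms(1) by (simp add: distrib_right 2 mult.assoc 1) (simp add: field_simps)
  then show "qint q a = inverse q * qint q (a - 1) + inverse q * q powi a"
    using assms(2) by simp
qed

text \<open>The form \<open>x\<^sup>(\<^sup>\<alpha>\<^sup>) \<otimes> dx\<^sub>J\<close> has weight \<open>\<gamma> = \<alpha> + 1\<^sub>J\<close>, which the differential preserves;
  \<open>sh J \<gamma>\<close> recovers \<open>\<alpha>\<close>.\<close>

definition sh :: "nat set \<Rightarrow> (nat \<Rightarrow> int) \<Rightarrow> nat \<Rightarrow> int" where
  "sh J \<gamma> = (\<lambda>i. \<gamma> i - of_bool (i \<in> J))"

text \<open>The prefix sum runs over the weight instead of the exponent, so that the scalar does not
  depend on \<open>J\<close>.\<close>

definition dcoef :: "'k::field \<Rightarrow> (nat \<Rightarrow> int) \<Rightarrow> nat \<Rightarrow> 'k" where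
  "dcoef q \<gamma> j = q powi (- (\<Sum>i\<in>{1..<j}. \<gamma> i))"

lemma sh_surj: obtains \<gamma> where "\<beta> = sh J \<gamma>"
  by (rule that[of "\<lambda>i. \<beta> i + of_bool (i \<in> J)"]) (simp add: sh_def)

lemma sh_exps_remove:
  assumes "sh J \<gamma> \<in> exps n" "J \<subseteq> {1..n}"
  shows "sh (J - I) \<gamma> \<in> exps n"
  using assms by (auto simp: exps_def sh_def of_bool_def split: if_splits)

lemma sh_upd_remove: "j \<in> J \<Longrightarrow> (sh J \<gamma>)(j := sh J \<gamma> j + 1) = sh (J - {j}) \<gamma>"
  by (auto simp: sh_def fun_eq_iff)

lemma dcoef_nonzero: "q \<noteq> 0 \<Longrightarrow> dcoef q \<gamma> j \<noteq> 0"
  by (simp add: dcoef_def)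

lemma dcoef_Suc:
  assumes "q \<noteq> 0" "i \<ge> 1"
  shows "dcoef q \<gamma> (Suc i) = dcoef q \<gamma> i * q powi (- \<gamma> i)"
  using assms by (simp add: dcoef_def atLeastLessThanSuc power_int_diff power_int_minus field_simps)

text \<open>The prefix sums of exponent and weight differ by \<open>below j J\<close>. The resulting
  q^(below j J) cancels the powers of q^(-1) in \<open>lmul\<close>, which leaves a Koszul sign and
  a scalar depending on the weight alone.\<close>

lemma dop_sh:
  assumes "q \<noteq> 0" "J \<subseteq> {1..n}" "sh J \<gamma> \<in> exps n"
  shows "dop q n u (sh J \<gamma>) J
    = (\<Sum>j\<in>J. (- 1) ^ below j J * dcoef q \<gamma> j * u (sh (J - {j}) \<gamma>) (J - {j}))"
proof -
  have "dop q n u (sh J \<gamma>) J = (\<Sum>j\<in>{1..n}. q powi (- (\<Sum>i\<in>{1..<j}. sh J \<gamma> i)) *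
      lmul q j (u ((sh J \<gamma>)(j := sh J \<gamma> j + 1))) J)"
    using assms(3) by (simp add: dop_def)
  also have "\<dots> = (\<Sum>j\<in>J. q powi (- (\<Sum>i\<in>{1..<j}. sh J \<gamma> i)) *
      lmul q j (u ((sh J \<gamma>)(j := sh J \<gamma> j + 1))) J)"
    using assms(2) by (intro sum.mono_neutral_right) (auto simp: lmul_def)
  also have "\<dots> = (\<Sum>j\<in>J. (- 1) ^ below j J * dcoef q \<gamma> j * u (sh (J - {j}) \<gamma>) (J - {j}))"
  proof (rule sum.cong)
    fix j assume j: "j \<in> J"
    have "{i \<in> J. i < j} = {1..<j} \<inter> {i. i \<in> J}" using assms(2) by auto
    then have "(\<Sum>i\<in>{1..<j}. of_bool (i \<in> J)) = int (below j J)"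
      by (simp add: below_def sum.If_cases of_bool_def)
    then have "- (\<Sum>i\<in>{1..<j}. sh J \<gamma> i) = int (below j J) + - (\<Sum>i\<in>{1..<j}. \<gamma> i)"
      by (simp add: sh_def sum_subtractf)
    moreover have "q powi (a + b) = q powi a * q powi b" for a b
      using assms(1) by (simp add: power_int_add)
    ultimately have "q powi (- (\<Sum>i\<in>{1..<j}. sh J \<gamma> i)) = q ^ below j J * dcoef q \<gamma> j"
      by (simp only: dcoef_def power_int_of_nat)
    moreover have "q ^ below j J * (- inverse q) ^ below j J = (- 1) ^ below j J"
      using assms(1) by (simp flip: power_mult_distrib)
    ultimately show "q powi (- (\<Sum>i\<in>{1..<j}. sh J \<gamma> i)) *
      lmul q j (u ((sh J \<gamma>)(j := sh J \<gamma> j + 1))) J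
      = (- 1) ^ below j J * dcoef q \<gamma> j * u (sh (J - {j}) \<gamma>) (J - {j})"
      using j by (simp add: lmul_def sh_upd_remove mult_ac)
  qed simp
  finally show ?thesis .
qed

section \<open>Commutation of the generators with the differential\<close>

definition supported :: "nat \<Rightarrow> ((nat \<Rightarrow> int) \<Rightarrow> nat set \<Rightarrow> 'k::field) \<Rightarrow> bool" where
  "supported n u \<longleftrightarrow> (\<forall>\<alpha> J. u \<alpha> J \<noteq> 0 \<longrightarrow> \<alpha> \<in> exps n \<and> J \<subseteq> {1..n})"

lemma supported_dop:
  assumes "supported n u"
  shows "supported n (dop q n u)"
  unfolding supported_def
proof (intro allI impI conjI)
  fix \<beta> J assume *: "dop q n u \<beta> J \<noteq> 0"
  then show "\<beta> \<in> exps n" by (auto simp: dop_def split: if_splits)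
  from * obtain j where j: "j \<in> {1..n}" "lmul q j (u (\<beta>(j := \<beta> j + 1))) J \<noteq> 0"
    by (auto simp: dop_def split: if_splits elim!: sum.not_neutral_contains_not_neutral)
  then have "u (\<beta>(j := \<beta> j + 1)) (J - {j}) \<noteq> 0" by (auto simp: lmul_def split: if_splits)
  then have "J - {j} \<subseteq> {1..n}" using assms unfolding supported_def by blast
  then show "J \<subseteq> {1..n}" using j(1) by auto
qed

lemma supported_gop:
  assumes "supported n u" "g \<in> uq_gens n"
  shows "supported n (gop q n g u)"
  unfolding supported_def
proof (intro allI impI conjI)
  fix \<beta> J assume *: "gop q n g u \<beta> J \<noteq> 0"
  then show "\<beta> \<in> exps n" by (cases g) (auto split: if_splits)
  have u: "I \<subseteq> {1..n}" if "u \<alpha> I \<noteq> 0" for \<alpha> I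
    using assms(1) that unfolding supported_def by blast
  show "J \<subseteq> {1..n}"
  proof (cases g)
    case (E i)
    then have i: "i \<in> {1..n}" using assms(2) by (auto simp: uq_gens_def)
    from * have "u (\<beta>(i := \<beta> i - 1, Suc i := \<beta> (Suc i) + 1)) J \<noteq> 0
        \<or> u \<beta> (insert (Suc i) (J - {i})) \<noteq> 0"
      by (auto simp: E split: if_splits)
    then show ?thesis using u i by blast
  next
    case (F i)
    then have i: "Suc i \<in> {1..n}" using assms(2) by (auto simp: uq_gens_def)
    from * have "u (\<beta>(i := \<beta> i + 1, Suc i := \<beta> (Suc i) - 1)) J \<noteq> 0
        \<or> u \<beta> (insert i (J - {Suc i})) \<noteq> 0"
      by (auto simp: F split: if_splits)
    then show ?thesis using u i by blast
  next
    case (K i)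
    with * u show ?thesis by (auto split: if_splits)
  next
    case (Ki i)
    with * u show ?thesis by (auto split: if_splits)
  qed
qed

text \<open>Both terms of the coproduct read \<open>u\<close> in the same shifted weight: the first
  moves a unit between exponents, the second exchanges dx_i and dx_(i+1).\<close>

lemma gop_E_sh:
  assumes "sh J \<gamma> \<in> exps n"
  shows "gop q n (E i) u (sh J \<gamma>) J = qint q (\<gamma> i - of_bool (i \<in> J))
      * q powi (of_bool (i \<in> J) - of_bool (Suc i \<in> J))
      * u (sh J (\<gamma>(i := \<gamma> i - 1, Suc i := \<gamma> (Suc i) + 1))) J
    + (if i \<in> J \<and> Suc i \<notin> J then u (sh (insert (Suc i) (J - {i}))
        (\<gamma>(i := \<gamma> i - 1, Suc i := \<gamma> (Suc i) + 1))) (insert (Suc i) (J - {i})) else 0)"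
proof -
  let ?\<gamma> = "\<gamma>(i := \<gamma> i - 1, Suc i := \<gamma> (Suc i) + 1)"
  have 1: "(sh J \<gamma>)(i := sh J \<gamma> i - 1, Suc i := sh J \<gamma> (Suc i) + 1) = sh J ?\<gamma>"
    by (auto simp: sh_def fun_eq_iff)
  have 2: "sh J \<gamma> = sh (insert (Suc i) (J - {i})) ?\<gamma>" if "i \<in> J" "Suc i \<notin> J"
    using that by (auto simp: sh_def fun_eq_iff)
  show ?thesis
    using assms
    by (cases "i \<in> J \<and> Suc i \<notin> J")
      (simp_all only: gop.simps 1 wact.simps if_True if_False simp_thms,
        simp_all add: 2[symmetric] sh_def[of J \<gamma>])
qed

lemma gop_F_sh:
  assumes "sh J \<gamma> \<in> exps n"
  shows "gop q n (F i) u (sh J \<gamma>) J = qint q (\<gamma> (Suc i) - of_bool (Suc i \<in> J))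
      * u (sh J (\<gamma>(i := \<gamma> i + 1, Suc i := \<gamma> (Suc i) - 1))) J
    + (if Suc i \<in> J \<and> i \<notin> J then q powi (- (\<gamma> i - \<gamma> (Suc i) + 1)) * u (sh (insert i (J - {Suc i}))
        (\<gamma>(i := \<gamma> i + 1, Suc i := \<gamma> (Suc i) - 1))) (insert i (J - {Suc i})) else 0)"
proof -
  let ?\<gamma> = "\<gamma>(i := \<gamma> i + 1, Suc i := \<gamma> (Suc i) - 1)"
  have 1: "(sh J \<gamma>)(i := sh J \<gamma> i + 1, Suc i := sh J \<gamma> (Suc i) - 1) = sh J ?\<gamma>"
    by (auto simp: sh_def fun_eq_iff)
  have 2: "sh J \<gamma> = sh (insert i (J - {Suc i})) ?\<gamma>"
    and 3: "sh J \<gamma> i - sh J \<gamma> (Suc i) = \<gamma> i - \<gamma> (Suc i) + 1" if "Suc i \<in> J" "i \<notin> J"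
    using that by (auto simp: sh_def fun_eq_iff)
  show ?thesis
    using assms
    by (cases "Suc i \<in> J \<and> i \<notin> J")
      (simp_all only: gop.simps 1 wact.simps 3 if_True if_False simp_thms mult_zero_right,
        simp_all add: 2[symmetric] sh_def[of J \<gamma>])
qed

lemma gop_K_sh:
  assumes "q \<noteq> 0" "sh J \<gamma> \<in> exps n"
  shows "gop q n (K i) u (sh J \<gamma>) J = q powi (\<gamma> i - \<gamma> (Suc i)) * u (sh J \<gamma>) J"
    and "gop q n (Ki i) u (sh J \<gamma>) J = q powi (- (\<gamma> i - \<gamma> (Suc i))) * u (sh J \<gamma>) J"
  using assms by (simp_all add: sh_def[of J \<gamma>] flip: power_int_add mult.assoc)

lemma sum_split2:
  fixes f :: "nat \<Rightarrow> 'a::comm_monoid_add"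
  assumes "finite J"
  shows "sum f J = sum f (J - {i, Suc i}) + (if i \<in> J then f i else 0) + (if Suc i \<in> J then f (Suc i) else 0)"
proof -
  have 1: "sum f J = sum f (J - {i}) + (if i \<in> J then f i else 0)"
    using assms by (auto simp: sum.remove add.commute)
  have 2: "sum f (J - {i}) = sum f (J - {i} - {Suc i}) + (if Suc i \<in> J then f (Suc i) else 0)"
    using assms sum.remove[of "J - {i}" "Suc i" f] by (auto simp: add.commute)
  have "J - {i} - {Suc i} = J - {i, Suc i}" by auto
  with 1 2 show ?thesis by (simp add: add_ac)
qed

text \<open>A prefix sum notices a transfer between i and i+1 only if it contains i but not i+1,
  which happens for j = i+1 alone.\<close>

lemma dcoef_shift:
  assumes "q \<noteq> 0" "i \<ge> 1"
  shows "j \<noteq> Suc i \<Longrightarrow> dcoef q (\<gamma>(i := \<gamma> i + d, Suc i := \<gamma> (Suc i) - d)) j = dcoef q \<gamma> j"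
    and "dcoef q (\<gamma>(i := \<gamma> i + d, Suc i := \<gamma> (Suc i) - d)) (Suc i) = q powi (- d) * dcoef q \<gamma> (Suc i)"
proof -
  let ?\<gamma> = "\<gamma>(i := \<gamma> i + d, Suc i := \<gamma> (Suc i) - d)"
  have *: "(\<Sum>t\<in>{1..<i}. ?\<gamma> t) = (\<Sum>t\<in>{1..<i}. \<gamma> t)" by (rule sum.cong) auto
  then show "dcoef q ?\<gamma> (Suc i) = q powi (- d) * dcoef q \<gamma> (Suc i)"
    using assms by (simp add: dcoef_Suc) (simp add: dcoef_def power_int_diff power_int_minus divide_inverse mult_ac)
  show "dcoef q ?\<gamma> j = dcoef q \<gamma> j" if "j \<noteq> Suc i"
  proof (cases "j \<le> i")
    case True
    have "(\<Sum>t\<in>{1..<j}. ?\<gamma> t) = (\<Sum>t\<in>{1..<j}. \<gamma> t)" using True by (intro sum.cong) auto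
    then show ?thesis by (simp add: dcoef_def)
  next
    case False
    with that assms(2) have m: "i \<in> {1..<j}" "Suc i \<in> {1..<j}" by auto
    have "(\<Sum>t\<in>{1..<j} - {i, Suc i}. ?\<gamma> t) = (\<Sum>t\<in>{1..<j} - {i, Suc i}. \<gamma> t)"
      by (intro sum.cong) auto
    then have "(\<Sum>t\<in>{1..<j}. ?\<gamma> t) = (\<Sum>t\<in>{1..<j}. \<gamma> t)"
      using m by (subst (1 2) sum_split2[where i = i]) simp_all
    then show ?thesis by (simp add: dcoef_def)
  qed
qed

lemma sh_exps_shift:
  assumes "sh J \<gamma> \<in> exps n" "a \<in> {1..n}" "b \<in> {1..n}" "a \<noteq> b" "sh J \<gamma> a \<noteq> 0"
  shows "sh J (\<gamma>(a := \<gamma> a - 1, b := \<gamma> b + 1)) \<in> exps n"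
  unfolding exps_def
proof (intro CollectI conjI ballI allI impI)
  have "sh J \<gamma> a \<ge> 0" using assms by (auto simp: exps_def)
  then have a: "sh J \<gamma> a \<ge> 1" using assms(5) by linarith
  fix t
  have s: "sh J (\<gamma>(a := \<gamma> a - 1, b := \<gamma> b + 1)) t = sh J \<gamma> t - of_bool (t = a) + of_bool (t = b)"
    using assms(4) by (auto simp: sh_def)
  show "sh J (\<gamma>(a := \<gamma> a - 1, b := \<gamma> b + 1)) t \<ge> 0" if "t \<in> {1..n}"
    unfolding s using that assms(1) a by (cases "t = a") (auto simp: exps_def)
  show "sh J (\<gamma>(a := \<gamma> a - 1, b := \<gamma> b + 1)) t = 0" if "t \<notin> {1..n}"
    unfolding s using that assms(1-3) by (auto simp: exps_def)
qed

lemma below_swap: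
  assumes "i \<in> J" "Suc i \<notin> J" "j \<noteq> i" "j \<noteq> Suc i"
  shows "below j (insert (Suc i) (J - {i})) = below j J"
  using assms by (intro below_shift[of _ i]) auto

lemma below_swap':
  assumes "Suc i \<in> J" "i \<notin> J" "j \<noteq> i" "j \<noteq> Suc i"
  shows "below j (insert i (J - {Suc i})) = below j J"
  using assms by (intro below_shift[of _ i]) auto

text \<open>Both sides are sums over removed indices j. The terms with j different from i and i+1
  agree one by one (\<open>A\<close>, \<open>B\<close>). The at most two remaining terms are
  compared according to whether i and i+1 lie in \<open>J\<close>; if i does, the comparison is the
  recursion for [\<gamma>_i].\<close>

lemma dop_gop_E:
  assumes q: "q \<noteq> 0" "q - inverse q \<noteq> 0" and i: "i \<in> {1..n-1}"
    and J: "J \<subseteq> {1..n}" and ex: "sh J \<gamma> \<in> exps n"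
  shows "dop q n (gop q n (E i) u) (sh J \<gamma>) J = gop q n (E i) (dop q n u) (sh J \<gamma>) J"
proof -
  let ?\<gamma> = "\<gamma>(i := \<gamma> i - 1, Suc i := \<gamma> (Suc i) + 1)"
  let ?J = "insert (Suc i) (J - {i})"
  define U where "U I = u (sh I ?\<gamma>) I" for I
  define s where "s I j = (- 1 :: 'a) ^ below j I" for I j
  define Q where "Q = q powi (- \<gamma> i)"
  define a where "a = qint q (\<gamma> i - 1)"
  define A where "A = (\<Sum>j\<in>J - {i, Suc i}. s J j * dcoef q \<gamma> j * U (J - {j}))"
  define B where "B = (\<Sum>j\<in>J - {i, Suc i}. s J j * dcoef q \<gamma> j * U (insert (Suc i) (J - {i}) - {j}))"
  have i': "i \<ge> 1" "i \<in> {1..n}" "Suc i \<in> {1..n}" using i by auto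
  have fin: "finite J" using J finite_subset by blast
  have qa: "qint q (\<gamma> i) = q * a + q * Q" unfolding a_def Q_def by (rule qint_rec[OF q])
  have cS: "dcoef q \<gamma> (Suc i) = dcoef q \<gamma> i * Q"
    unfolding Q_def using q i' by (intro dcoef_Suc) auto
  have c': "dcoef q ?\<gamma> j = dcoef q \<gamma> j" if "j \<noteq> Suc i" for j
    using dcoef_shift(1)[OF q(1) i'(1) that, of \<gamma> "-1"] by simp
  have c'S: "dcoef q ?\<gamma> (Suc i) = q * dcoef q \<gamma> (Suc i)"
    using dcoef_shift(2)[OF q(1) i'(1), of \<gamma> "-1"] by simp
  have sS: "s J (Suc i) = (if i \<in> J then - s J i else s J i)" for J
    by (simp add: s_def below_Suc power_add)
  have dopJ: "qint q (\<gamma> i - of_bool (i \<in> J)) * dop q n u (sh J ?\<gamma>) J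
    = qint q (\<gamma> i - of_bool (i \<in> J)) * (\<Sum>j\<in>J. s J j * dcoef q ?\<gamma> j * U (J - {j}))"
  proof (cases "sh J \<gamma> i = 0")
    case False
    then show ?thesis
      using sh_exps_shift[OF ex i'(2,3)] dop_sh[OF q(1) J, of ?\<gamma> u] by (simp add: U_def s_def)
  qed (simp add: sh_def)
  have dopJ': "dop q n u (sh ?J ?\<gamma>) ?J = (\<Sum>j\<in>?J. s ?J j * dcoef q ?\<gamma> j * U (?J - {j}))"
    if "i \<in> J" "Suc i \<notin> J"
  proof -
    have "sh ?J ?\<gamma> = sh J \<gamma>" using that by (auto simp: sh_def fun_eq_iff)
    then show ?thesis using J i' ex by (subst dop_sh[OF q(1)]) (auto simp: U_def s_def)
  qed
  have lhs: "dop q n (gop q n (E i) u) (sh J \<gamma>) J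
    = (\<Sum>j\<in>J. s J j * dcoef q \<gamma> j * (qint q (\<gamma> i - of_bool (i \<in> J - {j}))
        * q powi (of_bool (i \<in> J - {j}) - of_bool (Suc i \<in> J - {j})) * U (J - {j})
      + (if i \<in> J - {j} \<and> Suc i \<notin> J - {j} then U (insert (Suc i) (J - {j} - {i})) else 0)))"
    using sh_exps_remove[OF ex J] unfolding s_def U_def
    by (subst dop_sh[OF q(1) J ex], intro sum.cong refl) (simp only: gop_E_sh)
  have A1: "(\<Sum>j\<in>J - {i, Suc i}. s J j * dcoef q ?\<gamma> j * U (J - {j})) = A"
    unfolding A_def by (intro sum.cong) (auto simp: c')
  have B1: "(\<Sum>j\<in>?J - {i, Suc i}. s ?J j * dcoef q ?\<gamma> j * U (?J - {j})) = B" if "i \<in> J" "Suc i \<notin> J"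
    unfolding B_def
  proof (rule sum.cong)
    show "?J - {i, Suc i} = J - {i, Suc i}" by auto
    fix j assume "j \<in> J - {i, Suc i}"
    then show "s ?J j * dcoef q ?\<gamma> j * U (?J - {j}) = s J j * dcoef q \<gamma> j * U (?J - {j})"
      using below_swap[OF that, of j] by (simp add: c' s_def)
  qed
  have lhs0: "(\<Sum>j\<in>J - {i, Suc i}. s J j * dcoef q \<gamma> j * (qint q (\<gamma> i - of_bool (i \<in> J - {j}))
        * q powi (of_bool (i \<in> J - {j}) - of_bool (Suc i \<in> J - {j})) * U (J - {j})
      + (if i \<in> J - {j} \<and> Suc i \<notin> J - {j} then U (insert (Suc i) (J - {j} - {i})) else 0)))
    = qint q (\<gamma> i - of_bool (i \<in> J)) * q powi (of_bool (i \<in> J) - of_bool (Suc i \<in> J)) * A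
      + (if i \<in> J \<and> Suc i \<notin> J then B else 0)"
  proof -
    have t: "s J j * dcoef q \<gamma> j * (qint q (\<gamma> i - of_bool (i \<in> J - {j}))
        * q powi (of_bool (i \<in> J - {j}) - of_bool (Suc i \<in> J - {j})) * U (J - {j})
      + (if i \<in> J - {j} \<and> Suc i \<notin> J - {j} then U (insert (Suc i) (J - {j} - {i})) else 0))
      = qint q (\<gamma> i - of_bool (i \<in> J)) * q powi (of_bool (i \<in> J) - of_bool (Suc i \<in> J))
          * (s J j * dcoef q \<gamma> j * U (J - {j}))
        + (if i \<in> J \<and> Suc i \<notin> J then s J j * dcoef q \<gamma> j * U (?J - {j}) else 0)"
      if "j \<in> J - {i, Suc i}" for j
    proof -
      have "insert (Suc i) (J - {j} - {i}) = ?J - {j}" using that by auto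
      then show ?thesis using that by (auto simp: algebra_simps)
    qed
    show ?thesis
      by (rule trans, rule sum.cong[OF refl], erule t, cases "i \<in> J \<and> Suc i \<notin> J")
        (simp_all only: if_True if_False sum.distrib sum_distrib_left
        A_def B_def sum.neutral_const add_0_right simp_thms)
  qed
  have J1: "J - {Suc i} - {i} = J - {i} - {Suc i}" by auto
  have J2: "insert (Suc i) (J - {i}) = J - {i}" if "Suc i \<in> J" using that by auto
  have J3: "insert (Suc i) (J - {i}) - {Suc i} = J - {i}" if "Suc i \<notin> J" using that by auto
  have sJ': "s ?J (Suc i) = s J i"
    by (simp add: s_def below_Suc)
  have sumJ: "(\<Sum>j\<in>J. s J j * dcoef q ?\<gamma> j * U (J - {j}))
    = A + (if i \<in> J then s J i * dcoef q \<gamma> i * U (J - {i}) else 0)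
      + (if Suc i \<in> J then s J (Suc i) * (q * (dcoef q \<gamma> i * Q)) * U (J - {Suc i}) else 0)"
    unfolding sum_split2[OF fin, of _ i] A1 by (simp add: c' c'S cS)
  have sumJ': "(\<Sum>j\<in>?J. s ?J j * dcoef q ?\<gamma> j * U (?J - {j}))
    = B + s J i * (q * (dcoef q \<gamma> i * Q)) * U (J - {i})" if "i \<in> J" "Suc i \<notin> J"
  proof -
    have "finite ?J" using fin by simp
    then show ?thesis
      unfolding sum_split2[OF \<open>finite ?J\<close>, of _ i] B1[OF that] using that
      by (simp add: c'S cS sJ' J3 del: insert_Diff_single)
  qed
  have rhs: "gop q n (E i) (dop q n u) (sh J \<gamma>) J
    = q powi (of_bool (i \<in> J) - of_bool (Suc i \<in> J))
      * (qint q (\<gamma> i - of_bool (i \<in> J)) * (\<Sum>j\<in>J. s J j * dcoef q ?\<gamma> j * U (J - {j})))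
    + (if i \<in> J \<and> Suc i \<notin> J then B + s J i * (q * (dcoef q \<gamma> i * Q)) * U (J - {i}) else 0)"
    unfolding gop_E_sh[OF ex] dopJ[symmetric] using dopJ' sumJ' by simp
  show ?thesis
    unfolding lhs rhs sumJ sum_split2[OF fin, of _ i] lhs0
    using q(1) by (cases "i \<in> J"; cases "Suc i \<in> J")
      (simp_all add: sS cS J1 J2 qa power_int_minus field_simps flip: a_def)
qed

text \<open>The mirror image of the argument for e_i. The inverse of K_i in the coproduct
  contributes \<open>Q * P * inverse q\<close>, and if i+1 lies in \<open>J\<close> the recursion
  for [\<gamma>_(i+1)] closes the comparison.\<close>

lemma dop_gop_F:
  assumes q: "q \<noteq> 0" "q - inverse q \<noteq> 0" and i: "i \<in> {1..n-1}"
    and J: "J \<subseteq> {1..n}" and ex: "sh J \<gamma> \<in> exps n"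
  shows "dop q n (gop q n (F i) u) (sh J \<gamma>) J = gop q n (F i) (dop q n u) (sh J \<gamma>) J"
proof -
  let ?\<gamma> = "\<gamma>(i := \<gamma> i + 1, Suc i := \<gamma> (Suc i) - 1)"
  let ?J = "insert i (J - {Suc i})"
  define U where "U I = u (sh I ?\<gamma>) I" for I
  define s where "s I j = (- 1 :: 'a) ^ below j I" for I j
  define Q where "Q = q powi (- \<gamma> i)"
  define P where "P = q powi \<gamma> (Suc i)"
  define a where "a = qint q (\<gamma> (Suc i) - 1)"
  define A where "A = (\<Sum>j\<in>J - {i, Suc i}. s J j * dcoef q \<gamma> j * U (J - {j}))"
  define B where "B = (\<Sum>j\<in>J - {i, Suc i}. s J j * dcoef q \<gamma> j * U (insert i (J - {Suc i}) - {j}))"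
  have i': "i \<ge> 1" "i \<in> {1..n}" "Suc i \<in> {1..n}" using i by auto
  have fin: "finite J" using J finite_subset by blast
  have qa: "qint q (\<gamma> (Suc i)) = inverse q * a + inverse q * P"
    unfolding a_def P_def by (rule qint_rec[OF q])
  have QP: "q powi (- (\<gamma> i - \<gamma> (Suc i) + 1)) = Q * P * inverse q"
  proof -
    have "- (\<gamma> i - \<gamma> (Suc i) + 1) = - \<gamma> i + \<gamma> (Suc i) + (- 1)" by simp
    moreover have "q powi (a + b) = q powi a * q powi b" for a b
      using q(1) by (simp add: power_int_add)
    ultimately show ?thesis unfolding Q_def P_def by (simp only: power_int_minus power_int_1_right)
  qed
  have cS: "dcoef q \<gamma> (Suc i) = dcoef q \<gamma> i * Q"
    unfolding Q_def using q i' by (intro dcoef_Suc) auto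
  have c': "dcoef q ?\<gamma> j = dcoef q \<gamma> j" if "j \<noteq> Suc i" for j
    using dcoef_shift(1)[OF q(1) i'(1) that, of \<gamma> 1] by simp
  have c'S: "dcoef q ?\<gamma> (Suc i) = inverse q * dcoef q \<gamma> (Suc i)"
    using dcoef_shift(2)[OF q(1) i'(1), of \<gamma> 1] by simp
  have sS: "s J (Suc i) = (if i \<in> J then - s J i else s J i)" for J
    by (simp add: s_def below_Suc power_add)
  have dopJ: "qint q (\<gamma> (Suc i) - of_bool (Suc i \<in> J)) * dop q n u (sh J ?\<gamma>) J
    = qint q (\<gamma> (Suc i) - of_bool (Suc i \<in> J)) * (\<Sum>j\<in>J. s J j * dcoef q ?\<gamma> j * U (J - {j}))"
  proof (cases "sh J \<gamma> (Suc i) = 0")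
    case False
    have "\<gamma>(Suc i := \<gamma> (Suc i) - 1, i := \<gamma> i + 1) = ?\<gamma>" by (auto simp: fun_eq_iff)
    then have "sh J ?\<gamma> \<in> exps n" using sh_exps_shift[OF ex i'(3,2) _ False] by simp
    then show ?thesis
      using dop_sh[OF q(1) J, of ?\<gamma> u] by (simp add: U_def s_def)
  qed (simp add: sh_def)
  have dopJ': "dop q n u (sh ?J ?\<gamma>) ?J = (\<Sum>j\<in>?J. s ?J j * dcoef q ?\<gamma> j * U (?J - {j}))"
    if "Suc i \<in> J" "i \<notin> J"
  proof -
    have "sh ?J ?\<gamma> = sh J \<gamma>" using that by (auto simp: sh_def fun_eq_iff)
    then show ?thesis using J i' ex by (subst dop_sh[OF q(1)]) (auto simp: U_def s_def)
  qed
  have lhs: "dop q n (gop q n (F i) u) (sh J \<gamma>) J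
    = (\<Sum>j\<in>J. s J j * dcoef q \<gamma> j * (qint q (\<gamma> (Suc i) - of_bool (Suc i \<in> J - {j})) * U (J - {j})
      + (if Suc i \<in> J - {j} \<and> i \<notin> J - {j}
          then q powi (- (\<gamma> i - \<gamma> (Suc i) + 1)) * U (insert i (J - {j} - {Suc i})) else 0)))"
    using sh_exps_remove[OF ex J] unfolding s_def U_def
    by (subst dop_sh[OF q(1) J ex], intro sum.cong refl) (simp only: gop_F_sh)
  have A1: "(\<Sum>j\<in>J - {i, Suc i}. s J j * dcoef q ?\<gamma> j * U (J - {j})) = A"
    unfolding A_def by (intro sum.cong) (auto simp: c')
  have B1: "(\<Sum>j\<in>?J - {i, Suc i}. s ?J j * dcoef q ?\<gamma> j * U (?J - {j})) = B" if "Suc i \<in> J" "i \<notin> J"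
    unfolding B_def
  proof (rule sum.cong)
    show "?J - {i, Suc i} = J - {i, Suc i}" by auto
    fix j assume "j \<in> J - {i, Suc i}"
    then show "s ?J j * dcoef q ?\<gamma> j * U (?J - {j}) = s J j * dcoef q \<gamma> j * U (?J - {j})"
      using below_swap'[OF that, of j] by (simp add: c' s_def)
  qed
  have lhs0: "(\<Sum>j\<in>J - {i, Suc i}. s J j * dcoef q \<gamma> j * (qint q (\<gamma> (Suc i) - of_bool (Suc i \<in> J - {j})) * U (J - {j})
      + (if Suc i \<in> J - {j} \<and> i \<notin> J - {j}
          then q powi (- (\<gamma> i - \<gamma> (Suc i) + 1)) * U (insert i (J - {j} - {Suc i})) else 0)))
    = qint q (\<gamma> (Suc i) - of_bool (Suc i \<in> J)) * A
      + (if Suc i \<in> J \<and> i \<notin> J then Q * P * inverse q * B else 0)"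
  proof -
    have t: "s J j * dcoef q \<gamma> j * (qint q (\<gamma> (Suc i) - of_bool (Suc i \<in> J - {j})) * U (J - {j})
      + (if Suc i \<in> J - {j} \<and> i \<notin> J - {j}
          then q powi (- (\<gamma> i - \<gamma> (Suc i) + 1)) * U (insert i (J - {j} - {Suc i})) else 0))
      = qint q (\<gamma> (Suc i) - of_bool (Suc i \<in> J))
          * (s J j * dcoef q \<gamma> j * U (J - {j}))
        + (if Suc i \<in> J \<and> i \<notin> J then Q * P * inverse q * (s J j * dcoef q \<gamma> j * U (?J - {j})) else 0)"
      if "j \<in> J - {i, Suc i}" for j
    proof -
      have "insert i (J - {j} - {Suc i}) = ?J - {j}" using that by auto
      then show ?thesis using that unfolding QP by (auto simp: distrib_left mult_ac)
    qed
    show ?thesis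
      by (rule trans, rule sum.cong[OF refl], erule t, cases "Suc i \<in> J \<and> i \<notin> J")
        (simp_all only: if_True if_False sum.distrib sum_distrib_left
        A_def B_def sum.neutral_const add_0_right simp_thms)
  qed
  have J1: "J - {i} - {Suc i} = J - {Suc i} - {i}" by auto
  have J2: "insert i (J - {Suc i}) = J - {Suc i}" if "i \<in> J" using that by auto
  have J3: "insert i (J - {Suc i}) - {i} = J - {Suc i}" if "i \<notin> J" using that by auto
  have sJ': "s ?J i = s J i"
  proof -
    have "below i ?J = below i J" by (rule below_cong) auto
    then show ?thesis by (simp add: s_def)
  qed
  have sumJ: "(\<Sum>j\<in>J. s J j * dcoef q ?\<gamma> j * U (J - {j}))
    = A + (if i \<in> J then s J i * dcoef q \<gamma> i * U (J - {i}) else 0)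
      + (if Suc i \<in> J then s J (Suc i) * (inverse q * (dcoef q \<gamma> i * Q)) * U (J - {Suc i}) else 0)"
    unfolding sum_split2[OF fin, of _ i] A1 by (simp add: c' c'S cS)
  have sumJ': "(\<Sum>j\<in>?J. s ?J j * dcoef q ?\<gamma> j * U (?J - {j}))
    = B + s J i * dcoef q \<gamma> i * U (J - {Suc i})" if "Suc i \<in> J" "i \<notin> J"
  proof -
    have "finite ?J" using fin by simp
    then show ?thesis
      unfolding sum_split2[OF \<open>finite ?J\<close>, of _ i] B1[OF that] using that
      by (simp add: c' sJ' J3 del: insert_Diff_single)
  qed
  have rhs: "gop q n (F i) (dop q n u) (sh J \<gamma>) J
    = (qint q (\<gamma> (Suc i) - of_bool (Suc i \<in> J)) * (\<Sum>j\<in>J. s J j * dcoef q ?\<gamma> j * U (J - {j})))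
    + (if Suc i \<in> J \<and> i \<notin> J then Q * P * inverse q * (B + s J i * dcoef q \<gamma> i * U (J - {Suc i})) else 0)"
    unfolding gop_F_sh[OF ex] dopJ[symmetric] QP using dopJ' sumJ' by simp
  show ?thesis
    unfolding lhs rhs sumJ sum_split2[OF fin, of _ i] lhs0
    unfolding QP
    using q(1) by (cases "i \<in> J"; cases "Suc i \<in> J")
      (simp_all add: sS cS J1 J2 qa power_int_minus field_simps flip: a_def)
qed

lemma supported_eqI:
  assumes "supported n u" "supported n v"
    and "\<And>\<gamma> J. J \<subseteq> {1..n} \<Longrightarrow> sh J \<gamma> \<in> exps n \<Longrightarrow> u (sh J \<gamma>) J = v (sh J \<gamma>) J"
  shows "u = v"
proof (intro ext)
  fix \<beta> J
  obtain \<gamma> where \<gamma>: "\<beta> = sh J \<gamma>" by (rule sh_surj)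
  show "u \<beta> J = v \<beta> J"
  proof (cases "J \<subseteq> {1..n} \<and> \<beta> \<in> exps n")
    case True
    then show ?thesis using assms(3) \<gamma> by simp
  next
    case False
    then show ?thesis using assms(1,2) unfolding supported_def by metis
  qed
qed

lemma supported_zero [simp]: "supported n (\<lambda>\<alpha> J. 0)"
  by (simp add: supported_def)

lemma dop_gop:
  assumes q: "q \<noteq> 0" "q - inverse q \<noteq> 0" and u: "supported n u" and g: "g \<in> uq_gens n"
  shows "dop q n (gop q n g u) = gop q n g (dop q n u)"
proof (rule supported_eqI)
  show "supported n (dop q n (gop q n g u))" "supported n (gop q n g (dop q n u))"
    using u g by (simp_all add: supported_dop supported_gop)
  fix \<gamma> J assume J: "J \<subseteq> {1..n}" "sh J \<gamma> \<in> exps n"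
  show "dop q n (gop q n g u) (sh J \<gamma>) J = gop q n g (dop q n u) (sh J \<gamma>) J"
  proof (cases g)
    case (E i)
    then show ?thesis using dop_gop_E[OF q _ J] g by (auto simp: uq_gens_def)
  next
    case (F i)
    then show ?thesis using dop_gop_F[OF q _ J] g by (auto simp: uq_gens_def)
  next
    case (K i)
    then show ?thesis
      using J by (simp add: gop_K_sh dop_sh q sh_exps_remove sum_distrib_left mult_ac del: gop.simps)
  next
    case (Ki i)
    then show ?thesis
      using J by (simp add: gop_K_sh dop_sh q sh_exps_remove sum_distrib_left mult_ac del: gop.simps)
  qed
qed

text \<open>Whichever of j and k is removed first, exactly one \<open>below\<close> drops by one,
  namely that of the larger index when the smaller one has gone.\<close>

lemma sign_swap:
  assumes "j \<in> J" "k \<in> J" "j \<noteq> k"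
  shows "(- 1 :: 'k::field) ^ below k J * (- 1) ^ below j (J - {k})
    = - ((- 1) ^ below j J * (- 1) ^ below k (J - {j}))"
proof -
  have "below k J = below k (J - {j}) + of_bool (j < k)" "below j J = below j (J - {k}) + of_bool (k < j)"
    using assms below_remove[of k J j] below_remove[of j J k] by auto
  then show ?thesis using assms(3) by (cases "j < k") (auto simp: power_add)
qed

text \<open>The scalars depend only on the weight and hence commute, so the double sum over removed
  pairs is antisymmetric by \<open>sign_swap\<close>. The diagonal of \<open>T\<close> is set to 0
  so that both indices range over all of \<open>J\<close>.\<close>

lemma dop_dop:
  fixes q :: "'k::field_char_0"
  assumes q: "q \<noteq> 0" and u: "supported n u"
  shows "dop q n (dop q n u) = (\<lambda>\<alpha> J. 0)"
proof (rule supported_eqI)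
  show "supported n (dop q n (dop q n u))" using u by (simp add: supported_dop)
  fix \<gamma> J assume J: "J \<subseteq> {1..n}" "sh J \<gamma> \<in> exps n"
  define T where "T j k = (if j = k then 0 else (- 1) ^ below j J * (- 1) ^ below k (J - {j})
    * dcoef q \<gamma> j * dcoef q \<gamma> k * u (sh (J - {j} - {k}) \<gamma>) (J - {j} - {k}))" for j k
  have fin: "finite J" using J finite_subset by blast
  have "dop q n (dop q n u) (sh J \<gamma>) J
      = (\<Sum>j\<in>J. (- 1) ^ below j J * dcoef q \<gamma> j * dop q n u (sh (J - {j}) \<gamma>) (J - {j}))"
    by (rule dop_sh[OF q J])
  also have "\<dots> = (\<Sum>j\<in>J. \<Sum>k\<in>J - {j}. T j k)"
  proof (rule sum.cong[OF refl])
    fix j assume "j \<in> J"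
    have "J - {j} \<subseteq> {1..n}" using J(1) by blast
    note * = dop_sh[OF q this sh_exps_remove[OF J(2,1)], of u]
    show "(- 1) ^ below j J * dcoef q \<gamma> j * dop q n u (sh (J - {j}) \<gamma>) (J - {j})
        = (\<Sum>k\<in>J - {j}. T j k)"
      unfolding * sum_distrib_left by (intro sum.cong) (auto simp: T_def)
  qed
  also have "\<dots> = (\<Sum>j\<in>J. \<Sum>k\<in>J. T j k)"
    using fin by (intro sum.cong refl sum.mono_neutral_left) (auto simp: T_def)
  finally have S: "dop q n (dop q n u) (sh J \<gamma>) J = (\<Sum>j\<in>J. \<Sum>k\<in>J. T j k)" .
  have anti: "T k j = - T j k" if "j \<in> J" "k \<in> J" for j k
  proof (cases "j = k")
    case False
    have K: "J - {k} - {j} = J - {j} - {k}" by blast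
    have "T k j = ((- 1) ^ below k J * (- 1) ^ below j (J - {k})) * dcoef q \<gamma> k * dcoef q \<gamma> j
        * u (sh (J - {j} - {k}) \<gamma>) (J - {j} - {k})"
      using False unfolding T_def K by simp
    then show ?thesis
      unfolding sign_swap[OF that False] using False by (simp add: T_def)
  qed (simp add: T_def)
  have "(\<Sum>j\<in>J. \<Sum>k\<in>J. T j k) = (\<Sum>j\<in>J. \<Sum>k\<in>J. - T k j)"
    by (intro sum.cong refl anti)
  also have "\<dots> = - (\<Sum>j\<in>J. \<Sum>k\<in>J. T j k)"
    by (subst sum.swap) (simp add: sum_negf)
  finally have "(\<Sum>j\<in>J. \<Sum>k\<in>J. T j k) + (\<Sum>j\<in>J. \<Sum>k\<in>J. T j k) = 0"
    by (rule eq_neg_iff_add_eq_0[THEN iffD1])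
  \<comment> \<open>Antisymmetry only gives S = - S; characteristic 0 allows division by 2.\<close>
  then have "2 * (\<Sum>j\<in>J. \<Sum>k\<in>J. T j k) = 0" by (simp only: mult_2)
  then have "(\<Sum>j\<in>J. \<Sum>k\<in>J. T j k) = 0" by simp
  then show "dop q n (dop q n u) (sh J \<gamma>) J = 0"
    unfolding S .
qed simp

section \<open>Cohomology of the truncated complex\<close>

definition tform :: "nat \<Rightarrow> nat \<Rightarrow> nat \<Rightarrow> nat \<Rightarrow> ((nat \<Rightarrow> int) \<Rightarrow> nat set \<Rightarrow> 'k::field) \<Rightarrow> bool" where
  "tform n l m s u \<longleftrightarrow> (\<forall>\<alpha> J. u \<alpha> J \<noteq> 0 \<longrightarrow> \<alpha> \<in> trunc_exps n l m \<and> J \<subseteq> {1..n} \<and> card J = s)"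

lemma tform_supported: "tform n l m s u \<Longrightarrow> supported n u"
  by (auto simp: tform_def supported_def trunc_exps_def)

lemma tform_bound: "tform n l m s u \<Longrightarrow> t \<in> {1..n} \<Longrightarrow> \<alpha> t \<ge> int m * int l \<Longrightarrow> u \<alpha> J = 0"
proof (rule ccontr)
  assume "tform n l m s u" "t \<in> {1..n}" and t: "\<alpha> t \<ge> int m * int l" and "u \<alpha> J \<noteq> 0"
  then have "\<alpha> t \<le> int m * int l - 1" unfolding tform_def trunc_exps_def by blast
  with t show False by simp
qed

lemma tform_dop:
  assumes "tform n l m s u"
  shows "tform n l m (Suc s) (dop q n u)"
  unfolding tform_def
proof (intro allI impI)
  fix \<beta> J assume *: "dop q n u \<beta> J \<noteq> 0"
  with supported_dop[OF tform_supported[OF assms]] have b: "\<beta> \<in> exps n" "J \<subseteq> {1..n}"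
    unfolding supported_def by blast+
  from * obtain j where j: "j \<in> {1..n}" "lmul q j (u (\<beta>(j := \<beta> j + 1))) J \<noteq> 0"
    by (auto simp: dop_def split: if_splits elim!: sum.not_neutral_contains_not_neutral)
  then have j': "j \<in> J" "u (\<beta>(j := \<beta> j + 1)) (J - {j}) \<noteq> 0" by (auto simp: lmul_def split: if_splits)
  with assms have t: "\<beta>(j := \<beta> j + 1) \<in> trunc_exps n l m" "card (J - {j}) = s"
    unfolding tform_def by blast+
  have "\<beta> t \<le> int m * int l - 1" if "t \<in> {1..n}" for t
  proof -
    have "(\<beta>(j := \<beta> j + 1)) t \<le> int m * int l - 1" using t(1) that unfolding trunc_exps_def by blast
    then show ?thesis by (auto split: if_splits)
  qed
  moreover have "finite J" using b finite_subset by blast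
  then have "card J = Suc s" using card.remove[OF _ j'(1)] unfolding t(2) by blast
  ultimately show "\<beta> \<in> trunc_exps n l m \<and> J \<subseteq> {1..n} \<and> card J = Suc s"
    using b by (auto simp: trunc_exps_def)
qed

lemma card_exchange:
  assumes "finite J" "a \<in> J" "b \<notin> J"
  shows "card (insert b (J - {a})) = card J"
proof -
  have "card (insert b (J - {a})) = Suc (card (J - {a}))"
    using assms by (intro card_insert_disjoint) auto
  then show ?thesis using card.remove[OF assms(1,2)] by (simp only:)
qed

text \<open>An exponent can leave the truncated range only by being raised to ml, and there the
  coefficient is [ml] = 0. The exterior part merely exchanges i and i+1 and so keeps the
  degree.\<close>

lemma tform_gop:
  assumes u: "tform n l m s u" and g: "g \<in> uq_gens n" and M: "qint q (int m * int l) = 0"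
  shows "tform n l m s (gop q n g u)"
  unfolding tform_def
proof (intro allI impI)
  fix \<beta> J assume *: "gop q n g u \<beta> J \<noteq> 0"
  with supported_gop[OF tform_supported[OF u] g] have b: "\<beta> \<in> exps n" "J \<subseteq> {1..n}"
    unfolding supported_def by blast+
  have fin: "finite J" using b finite_subset by blast
  have u': "\<alpha> \<in> trunc_exps n l m" "card I = s" if "u \<alpha> I \<noteq> 0" for \<alpha> I
    using u that unfolding tform_def by blast+
  have shift: "\<beta> \<in> trunc_exps n l m \<and> card J = s"
    if ab: "a \<noteq> b" and nz: "u (\<beta>(a := \<beta> a - 1, b := \<beta> b + 1)) J \<noteq> 0" "qint q (\<beta> a) \<noteq> 0" for a b
  proof -
    have t: "(\<beta>(a := \<beta> a - 1, b := \<beta> b + 1)) t \<le> int m * int l - 1" if "t \<in> {1..n}" for t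
      using u'(1)[OF nz(1)] that unfolding trunc_exps_def by blast
    have "\<beta> t \<le> int m * int l - 1" if "t \<in> {1..n}" for t
    proof (cases "t = a")
      case True
      have "\<beta> a \<noteq> int m * int l" using nz(2) M by metis
      then show ?thesis using t[OF that] True ab by auto
    next
      case False
      then show ?thesis using t[OF that] by (auto split: if_splits)
    qed
    then show ?thesis using u'(2)[OF nz(1)] b(1) by (simp add: trunc_exps_def)
  qed
  have "\<beta> \<in> trunc_exps n l m \<and> card J = s"
  proof (cases g)
    case (E i)
    from * consider "qint q (\<beta> i) \<noteq> 0" "u (\<beta>(i := \<beta> i - 1, Suc i := \<beta> (Suc i) + 1)) J \<noteq> 0"
      | "i \<in> J" "Suc i \<notin> J" "u \<beta> (insert (Suc i) (J - {i})) \<noteq> 0"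
      by (cases "u \<beta> (insert (Suc i) (J - {i})) = 0") (auto simp: E split: if_splits)
    then show ?thesis
    proof cases
      case 1
      then show ?thesis using shift[of i "Suc i"] by simp
    next
      case 2
      then show ?thesis using u'[OF 2(3)] card_exchange[OF fin 2(1,2)] by simp
    qed
  next
    case (F i)
    have tw: "\<beta>(Suc i := \<beta> (Suc i) - 1, i := \<beta> i + 1) = \<beta>(i := \<beta> i + 1, Suc i := \<beta> (Suc i) - 1)"
      by (auto simp: fun_eq_iff)
    from * consider "qint q (\<beta> (Suc i)) \<noteq> 0" "u (\<beta>(i := \<beta> i + 1, Suc i := \<beta> (Suc i) - 1)) J \<noteq> 0"
      | "Suc i \<in> J" "i \<notin> J" "u \<beta> (insert i (J - {Suc i})) \<noteq> 0"
      by (cases "u \<beta> (insert i (J - {Suc i})) = 0") (auto simp: F split: if_splits)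
    then show ?thesis
    proof cases
      case 1
      then show ?thesis using shift[of "Suc i" i] unfolding tw by simp
    next
      case 2
      then show ?thesis using u'[OF 2(3)] card_exchange[OF fin 2(1,2)] by simp
    qed
  next
    case (K i)
    with * u' show ?thesis by (auto split: if_splits)
  next
    case (Ki i)
    with * u' show ?thesis by (auto split: if_splits)
  qed
  with b show "\<beta> \<in> trunc_exps n l m \<and> J \<subseteq> {1..n} \<and> card J = s" by simp
qed

text \<open>\<open>topexp M I\<close> is the exponent of the only form \<open>x\<^sup>(\<^sup>\<alpha>\<^sup>) \<otimes> dx\<^sub>J\<close> of weight \<open>topw M I\<close> in the
  truncated complex; it has \<open>J = I\<close>.\<close>

definition topw :: "int \<Rightarrow> nat set \<Rightarrow> nat \<Rightarrow> int" where
  "topw M I = (\<lambda>i. if i \<in> I then M else 0)"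

definition topexp :: "int \<Rightarrow> nat set \<Rightarrow> nat \<Rightarrow> int" where
  "topexp M I = (\<lambda>i. if i \<in> I then M - 1 else 0)"

lemma topexp_sh: "topexp M I = sh I (topw M I)"
  by (auto simp: topexp_def topw_def sh_def)

lemma topexp_exps: "M \<ge> 1 \<Longrightarrow> I \<subseteq> {1..n} \<Longrightarrow> topexp M I \<in> exps n"
  by (auto simp: topexp_def exps_def)

text \<open>A contribution would come from removing some j in \<open>I\<close>, hence from a form
  whose exponent at j is M, beyond the truncation.\<close>

lemma dop_topexp:
  assumes q: "q \<noteq> 0" and u: "tform n l m s u" and M: "M = int m * int l" and I: "I \<subseteq> {1..n}"
  shows "dop q n u (topexp M I) I = 0"
proof (cases "topexp M I \<in> exps n")
  case True
  have "u (sh (I - {j}) (topw M I)) (I - {j}) = 0" if "j \<in> I" for j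
    using u by (rule tform_bound[where t = j]) (use that I M in \<open>auto simp: sh_def topw_def\<close>)
  then show ?thesis
    using True unfolding topexp_sh by (subst dop_sh[OF q I]) auto
qed (simp add: dop_def)

text \<open>If i lies in \<open>I\<close> and i+1 does not, two coordinates of \<open>u\<close> in
  the weight \<open>\<gamma>\<close> enter, at \<open>I\<close> and at \<open>I\<close> with i
  replaced by i+1. The cocycle condition makes the second q q^(-M) times the first, so the sum is (q
  [M-1] + q q^(-M)) = [M] times the first.\<close>

lemma gop_topexp_E:
  assumes q: "q \<noteq> 0" "q - inverse q \<noteq> 0" and u: "tform n l m s u" and M: "M = int m * int l" "M \<ge> 2"
    and qM: "qint q M = 0" and closed: "dop q n u = (\<lambda>\<alpha> J. 0)" and i: "i \<in> {1..n-1}" and I: "I \<subseteq> {1..n}"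
  shows "gop q n (E i) u (topexp M I) I = 0"
proof -
  have ex: "topexp M I \<in> exps n" using M I by (intro topexp_exps) auto
  have i': "i \<in> {1..n}" "Suc i \<in> {1..n}" using i by auto
  consider "i \<notin> I" | "i \<in> I" "Suc i \<in> I" | "i \<in> I" "Suc i \<notin> I" by blast
  then show ?thesis
  proof cases
    case 1
    then show ?thesis using ex by (simp add: topexp_def)
  next
    case 2
    have "u ((topexp M I)(i := topexp M I i - 1, Suc i := topexp M I (Suc i) + 1)) I = 0"
      using u i'(2) by (rule tform_bound) (use M 2 in \<open>simp add: topexp_def\<close>)
    then show ?thesis using ex 2 by simp
  next
    case 3
    define \<gamma> where "\<gamma> = (topw M I)(i := topw M I i - 1, Suc i := topw M I (Suc i) + 1)"
    let ?I = "insert (Suc i) (I - {i})"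
    \<comment> \<open>The cocycle condition is read at this set. Removing an index other than i and
      i+1 leaves exponent M there, so only the two wanted coordinates survive.\<close>
    let ?J = "insert (Suc i) I"
    have J: "?J \<subseteq> {1..n}" "finite ?J" using I i' finite_subset[OF I] by auto
    \<comment> \<open>The exponent at i is M - 2, which is where \<open>M \<ge> 2\<close> enters; at
      i+1 it is 0.\<close>
    have "sh ?J \<gamma> \<in> exps n"
      using 3 M I i' by (auto simp: exps_def sh_def \<gamma>_def topw_def)
    from dop_sh[OF q(1) J(1) this, of u]
    have 0: "(\<Sum>j\<in>?J. (- 1) ^ below j ?J * dcoef q \<gamma> j * u (sh (?J - {j}) \<gamma>) (?J - {j})) = 0"
      by (simp add: closed)
    have z: "u (sh (?J - {j}) \<gamma>) (?J - {j}) = 0" if "j \<in> ?J - {i, Suc i}" for j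
      using u by (rule tform_bound[where t = j])
        (use that I M in \<open>auto simp: sh_def topw_def \<gamma>_def\<close>)
    have "(\<Sum>j\<in>?J - {i, Suc i}. (- 1) ^ below j ?J * dcoef q \<gamma> j * u (sh (?J - {j}) \<gamma>) (?J - {j})) = 0"
      by (intro sum.neutral ballI) (simp only: z mult_zero_right)
    moreover have "?J - {i} = ?I" "?J - {Suc i} = I" using 3 by auto
    ultimately have "(- 1) ^ below i ?J * dcoef q \<gamma> i * u (sh ?I \<gamma>) ?I
      + (- 1) ^ below (Suc i) ?J * dcoef q \<gamma> (Suc i) * u (sh I \<gamma>) I = 0"
      using 0 3 unfolding sum_split2[OF J(2), of _ i] by (simp del: insert_Diff_single Diff_insert0 insert_Diff_if)
    moreover have "below i ?J = below i I" by (rule below_cong) auto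
    moreover have "below (Suc i) ?J = below i I + 1" using 3 by (simp add: below_Suc)
    moreover have "dcoef q \<gamma> (Suc i) = dcoef q \<gamma> i * (q * q powi (- M))"
      using q i' 3 by (subst dcoef_Suc) (simp_all add: \<gamma>_def topw_def power_int_diff power_int_minus divide_inverse)
    ultimately have "(- 1) ^ below i I * dcoef q \<gamma> i * (u (sh ?I \<gamma>) ?I - q * q powi (- M) * u (sh I \<gamma>) I) = 0"
      by (simp add: algebra_simps power_add)
    then have rel: "u (sh ?I \<gamma>) ?I = q * q powi (- M) * u (sh I \<gamma>) I"
      using dcoef_nonzero[OF q(1)] by simp
    have "gop q n (E i) u (topexp M I) I = qint q (M - 1) * q * u (sh I \<gamma>) I + u (sh ?I \<gamma>) ?I"
      using ex 3 unfolding topexp_sh by (subst gop_E_sh) (simp_all add: topw_def[of M I] \<gamma>_def)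
    also have "\<dots> = qint q M * u (sh I \<gamma>) I"
      unfolding rel qint_rec(1)[OF q, of M] by (simp add: algebra_simps)
    finally show ?thesis by (simp add: qM)
  qed
qed

text \<open>The mirror image: the cocycle condition at \<open>insert i I\<close> makes the
  coordinate at \<open>I\<close> equal to q^(-1) times the one at the exchanged set, so the sum is
  (q^(-1) [M-1] + q^(-1) q^M) = [M] times the latter.\<close>

lemma gop_topexp_F:
  assumes q: "q \<noteq> 0" "q - inverse q \<noteq> 0" and u: "tform n l m s u" and M: "M = int m * int l" "M \<ge> 2"
    and qM: "qint q M = 0" and closed: "dop q n u = (\<lambda>\<alpha> J. 0)" and i: "i \<in> {1..n-1}" and I: "I \<subseteq> {1..n}"
  shows "gop q n (F i) u (topexp M I) I = 0"
proof -
  have ex: "topexp M I \<in> exps n" using M I by (intro topexp_exps) auto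
  have i': "i \<in> {1..n}" "Suc i \<in> {1..n}" using i by auto
  consider "Suc i \<notin> I" | "i \<in> I" "Suc i \<in> I" | "Suc i \<in> I" "i \<notin> I" by blast
  then show ?thesis
  proof cases
    case 1
    then show ?thesis using ex by (simp add: topexp_def)
  next
    case 2
    have "u ((topexp M I)(i := topexp M I i + 1, Suc i := topexp M I (Suc i) - 1)) I = 0"
      using u i'(1) by (rule tform_bound) (use M 2 in \<open>simp add: topexp_def\<close>)
    then show ?thesis using ex 2 by simp
  next
    case 3
    define \<gamma> where "\<gamma> = (topw M I)(i := topw M I i + 1, Suc i := topw M I (Suc i) - 1)"
    let ?I = "insert i (I - {Suc i})"
    let ?J = "insert i I"
    have J: "?J \<subseteq> {1..n}" "finite ?J" using I i' finite_subset[OF I] by auto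
    have "sh ?J \<gamma> \<in> exps n"
      using 3 M I i' by (auto simp: exps_def sh_def \<gamma>_def topw_def)
    from dop_sh[OF q(1) J(1) this, of u]
    have 0: "(\<Sum>j\<in>?J. (- 1) ^ below j ?J * dcoef q \<gamma> j * u (sh (?J - {j}) \<gamma>) (?J - {j})) = 0"
      by (simp add: closed)
    have z: "u (sh (?J - {j}) \<gamma>) (?J - {j}) = 0" if "j \<in> ?J - {i, Suc i}" for j
      using u by (rule tform_bound[where t = j])
        (use that I M in \<open>auto simp: sh_def topw_def \<gamma>_def\<close>)
    have "(\<Sum>j\<in>?J - {i, Suc i}. (- 1) ^ below j ?J * dcoef q \<gamma> j * u (sh (?J - {j}) \<gamma>) (?J - {j})) = 0"
      by (intro sum.neutral ballI) (simp only: z mult_zero_right)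
    moreover have "?J - {Suc i} = ?I" "?J - {i} = I" using 3 by auto
    ultimately have "(- 1) ^ below i ?J * dcoef q \<gamma> i * u (sh I \<gamma>) I
      + (- 1) ^ below (Suc i) ?J * dcoef q \<gamma> (Suc i) * u (sh ?I \<gamma>) ?I = 0"
      using 0 3 unfolding sum_split2[OF J(2), of _ i] by (simp del: insert_Diff_single Diff_insert0 insert_Diff_if)
    moreover have "below i ?J = below i I" by (rule below_cong) auto
    moreover have "below (Suc i) ?J = below i I + 1" by (simp add: below_Suc)
    moreover have "dcoef q \<gamma> (Suc i) = dcoef q \<gamma> i * inverse q"
      using q i' 3 by (subst dcoef_Suc) (simp_all add: \<gamma>_def topw_def power_int_minus)
    ultimately have "(- 1) ^ below i I * dcoef q \<gamma> i * (u (sh I \<gamma>) I - inverse q * u (sh ?I \<gamma>) ?I) = 0"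
      by (simp add: algebra_simps power_add)
    then have rel: "u (sh I \<gamma>) I = inverse q * u (sh ?I \<gamma>) ?I"
      using dcoef_nonzero[OF q(1)] by simp
    have "gop q n (F i) u (topexp M I) I
        = qint q (M - 1) * u (sh I \<gamma>) I + inverse q * q powi M * u (sh ?I \<gamma>) ?I"
      using ex 3 q(1) unfolding topexp_sh
      by (subst gop_F_sh) (simp_all add: topw_def[of M I] \<gamma>_def power_int_diff divide_inverse mult_ac)
    also have "\<dots> = qint q M * u (sh ?I \<gamma>) ?I"
      unfolding rel qint_rec(2)[OF q, of M] by (simp add: algebra_simps)
    finally show ?thesis by (simp add: qM)
  qed
qed

lemma gop_topexp_K:
  assumes "q \<noteq> 0" "topexp M I \<in> exps n"
  shows "gop q n (K i) u (topexp M I) I = q powi (topw M I i - topw M I (Suc i)) * u (topexp M I) I"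
    and "gop q n (Ki i) u (topexp M I) I = q powi (- (topw M I i - topw M I (Suc i))) * u (topexp M I) I"
  using gop_K_sh[OF assms(1), of I "topw M I" n] assms(2) by (simp_all add: topexp_sh)

section \<open>The contracting homotopy\<close>

definition has_free :: "nat \<Rightarrow> int \<Rightarrow> (nat \<Rightarrow> int) \<Rightarrow> bool" where
  "has_free n M \<gamma> \<longleftrightarrow> (\<exists>j\<in>{1..n}. 0 < \<gamma> j \<and> \<gamma> j < M)"

text \<open>The choice depends on the weight alone, so all summands of the differential of
  \<open>hop\<close> use the same index.\<close>

definition free_index :: "nat \<Rightarrow> int \<Rightarrow> (nat \<Rightarrow> int) \<Rightarrow> nat" where
  "free_index n M \<gamma> = (SOME j. j \<in> {1..n} \<and> 0 < \<gamma> j \<and> \<gamma> j < M)"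

lemma free_index:
  assumes "has_free n M \<gamma>"
  shows "free_index n M \<gamma> \<in> {1..n}" "0 < \<gamma> (free_index n M \<gamma>)" "\<gamma> (free_index n M \<gamma>) < M"
proof -
  have "\<exists>j. j \<in> {1..n} \<and> 0 < \<gamma> j \<and> \<gamma> j < M" using assms unfolding has_free_def by blast
  from someI_ex[OF this]
  show "free_index n M \<gamma> \<in> {1..n}" "0 < \<gamma> (free_index n M \<gamma>)" "\<gamma> (free_index n M \<gamma>) < M"
    unfolding free_index_def by blast+
qed

text \<open>Contraction with dx_j for the free index j: the set loses j and the exponent at j rises
  by one. The sign and the inverse scalar undo the coefficient with which the differential puts dx_j
  back.\<close>

definition hop :: "'k::field \<Rightarrow> nat \<Rightarrow> int \<Rightarrow> ((nat \<Rightarrow> int) \<Rightarrow> nat set \<Rightarrow> 'k) \<Rightarrow> (nat \<Rightarrow> int) \<Rightarrow> nat set \<Rightarrow> 'k"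
  where "hop q n M u \<alpha> I = (let \<gamma> = \<lambda>i. \<alpha> i + of_bool (i \<in> I); j = free_index n M \<gamma> in
    if has_free n M \<gamma> \<and> j \<notin> I
    then (- 1) ^ below j I * inverse (dcoef q \<gamma> j) * u (sh (insert j I) \<gamma>) (insert j I) else 0)"

lemma hop_sh: "hop q n M u (sh I \<gamma>) I = (if has_free n M \<gamma> \<and> free_index n M \<gamma> \<notin> I
  then (- 1) ^ below (free_index n M \<gamma>) I * inverse (dcoef q \<gamma> (free_index n M \<gamma>))
    * u (sh (insert (free_index n M \<gamma>) I) \<gamma>) (insert (free_index n M \<gamma>) I) else 0)"
proof -
  have "(\<lambda>i. sh I \<gamma> i + of_bool (i \<in> I)) = \<gamma>" by (simp add: sh_def)
  then show ?thesis by (simp add: hop_def Let_def)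
qed

lemma hop_nonzero:
  assumes "hop q n M u \<alpha> I \<noteq> 0"
  obtains j \<gamma> where "\<alpha> = sh I \<gamma>" "j \<in> {1..n}" "j \<notin> I" "0 < \<gamma> j" "\<gamma> j < M"
    "u (sh (insert j I) \<gamma>) (insert j I) \<noteq> 0"
proof -
  obtain \<gamma> where \<gamma>: "\<alpha> = sh I \<gamma>" by (rule sh_surj)
  have *: "has_free n M \<gamma>" "free_index n M \<gamma> \<notin> I"
    "u (sh (insert (free_index n M \<gamma>) I) \<gamma>) (insert (free_index n M \<gamma>) I) \<noteq> 0"
    using assms unfolding \<gamma> hop_sh by (auto split: if_splits)
  show ?thesis
    using free_index[OF *(1)] by (intro that[OF \<gamma> _ *(2) _ _ *(3)])
qed

lemma sh_insert: "j \<notin> I \<Longrightarrow> sh I \<gamma> t = (if t = j then \<gamma> j else sh (insert j I) \<gamma> t)"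
  by (simp add: sh_def)

lemma supported_hop:
  assumes "supported n u"
  shows "supported n (hop q n M u)"
  unfolding supported_def
proof (intro allI impI)
  fix \<alpha> I assume "hop q n M u \<alpha> I \<noteq> 0"
  then obtain j \<gamma> where j: "\<alpha> = sh I \<gamma>" "j \<in> {1..n}" "j \<notin> I" "0 < \<gamma> j"
    "u (sh (insert j I) \<gamma>) (insert j I) \<noteq> 0" by (rule hop_nonzero)
  then have "sh (insert j I) \<gamma> \<in> exps n" "insert j I \<subseteq> {1..n}"
    using assms unfolding supported_def by blast+
  then show "\<alpha> \<in> exps n \<and> I \<subseteq> {1..n}"
    using j(2,4) unfolding j(1) by (auto simp: exps_def sh_insert[OF j(3)])
qed

text \<open>Dropping j from the set raises the exponent at j to \<gamma>_j, which stays within the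
  truncation since \<gamma>_j < M.\<close>

lemma tform_hop:
  assumes "tform n l m (Suc s) u" "M = int m * int l"
  shows "tform n l m s (hop q n M u)"
  unfolding tform_def
proof (intro allI impI)
  fix \<alpha> I assume *: "hop q n M u \<alpha> I \<noteq> 0"
  with supported_hop[OF tform_supported[OF assms(1)]] have ex: "\<alpha> \<in> exps n" "I \<subseteq> {1..n}"
    unfolding supported_def by blast+
  from * obtain j \<gamma> where j: "\<alpha> = sh I \<gamma>" "j \<in> {1..n}" "j \<notin> I" "\<gamma> j < M"
    "u (sh (insert j I) \<gamma>) (insert j I) \<noteq> 0" by (rule hop_nonzero)
  with assms(1) have t: "sh (insert j I) \<gamma> \<in> trunc_exps n l m" "card (insert j I) = Suc s"
    unfolding tform_def by blast+
  have "\<alpha> t \<le> int m * int l - 1" if "t \<in> {1..n}" for t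
    using t(1) that j(4) assms(2) unfolding j(1) by (auto simp: trunc_exps_def sh_insert[OF j(3)])
  moreover have "card I = s" using t(2) j(3) ex(2) finite_subset[OF ex(2)] by simp
  ultimately show "\<alpha> \<in> trunc_exps n l m \<and> I \<subseteq> {1..n} \<and> card I = s"
    using ex by (simp add: trunc_exps_def)
qed

text \<open>The homotopy identity dh + hd = id on a closed \<open>u\<close>. If j lies in
  \<open>J\<close>, only its removal produces a set without j, and one term is left. Otherwise the
  cocycle condition at \<open>insert j J\<close> expresses the coordinate at \<open>J\<close>
  through the others.\<close>

lemma dop_hop:
  assumes q: "q \<noteq> 0" and closed: "dop q n u = (\<lambda>\<alpha> J. 0)"
    and J: "J \<subseteq> {1..n}" and ex: "sh J \<gamma> \<in> exps n" and fr: "has_free n M \<gamma>"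
  shows "dop q n (hop q n M u) (sh J \<gamma>) J = u (sh J \<gamma>) J"
proof -
  define j where "j = free_index n M \<gamma>"
  define U where "U I = u (sh I \<gamma>) I" for I
  define c where "c = dcoef q \<gamma>"
  note j = free_index[OF fr, folded j_def]
  have c0: "c k \<noteq> 0" for k unfolding c_def using q by (rule dcoef_nonzero)
  have fin: "finite J" using J finite_subset by blast
  have lhs: "dop q n (hop q n M u) (sh J \<gamma>) J = (\<Sum>k\<in>J. (- 1) ^ below k J * c k *
      (if j \<notin> J - {k} then (- 1) ^ below j (J - {k}) * inverse (c j) * U (insert j (J - {k})) else 0))"
    using fr by (simp only: dop_sh[OF q J ex] hop_sh c_def U_def j_def simp_thms)
  have cancel: "(- 1) ^ b * c k * ((- 1) ^ b * inverse (c k) * x) = x" for b k x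
    using c0[of k] by (cases "even b") simp_all
  show ?thesis
  proof (cases "j \<in> J")
    case True
    have "dop q n (hop q n M u) (sh J \<gamma>) J = (\<Sum>k\<in>J. if k = j then U J else 0)"
      unfolding lhs using True cancel by (intro sum.cong) (auto simp: insert_absorb)
    then show ?thesis using True fin by (simp add: U_def)
  next
    case False
    let ?K = "insert j J"
    have "sh ?K \<gamma> t = sh J \<gamma> t - of_bool (t = j)" for t using False by (auto simp: sh_def)
    \<comment> \<open>Here 0 < \<gamma>_j is needed: adding dx_j lowers the exponent at j by one,
      and it must stay nonnegative.\<close>
    moreover have "sh J \<gamma> j \<ge> 1" using j(2) False by (simp add: sh_def)
    ultimately have "sh ?K \<gamma> \<in> exps n" using ex j(1) by (auto simp: exps_def)
    from dop_sh[OF q _ this, of u] J j(1)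
    have "(\<Sum>k\<in>?K. (- 1) ^ below k ?K * c k * U (?K - {k})) = 0"
      by (simp add: closed U_def c_def)
    then have 0: "(- 1) ^ below j J * c j * U J + (\<Sum>k\<in>J. (- 1) ^ below k ?K * c k * U (?K - {k})) = 0"
      using False fin by simp
    have "dop q n (hop q n M u) (sh J \<gamma>) J
      = (\<Sum>k\<in>J. - ((- 1) ^ below j J * inverse (c j)) * ((- 1) ^ below k ?K * c k * U (?K - {k})))"
      unfolding lhs
    proof (rule sum.cong)
      fix k assume k: "k \<in> J"
      then have jk: "j \<noteq> k" using False by auto
      have K: "insert j (J - {k}) = ?K - {k}" using jk by auto
      have "below k ?K = below k J + of_bool (j < k)" using below_insert[OF False] .
      moreover have "below j J = below j (J - {k}) + of_bool (k < j)"
        using below_remove[of j J k] k by simp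
      ultimately have s: "(- 1 :: 'a) ^ below k J * (- 1) ^ below j (J - {k})
        = - ((- 1) ^ below j J * (- 1) ^ below k ?K)"
        using jk by (cases "j < k") (auto simp: power_add)
      show "(- 1) ^ below k J * c k * (if j \<notin> J - {k} then (- 1) ^ below j (J - {k}) * inverse (c j)
            * U (insert j (J - {k})) else 0)
        = - ((- 1) ^ below j J * inverse (c j)) * ((- 1) ^ below k ?K * c k * U (?K - {k}))"
      proof -
        have "(- 1) ^ below k J * c k * ((- 1) ^ below j (J - {k}) * inverse (c j) * U (?K - {k}))
          = ((- 1) ^ below k J * (- 1) ^ below j (J - {k})) * (c k * inverse (c j) * U (?K - {k}))"
          by (simp only: mult_ac)
        then show ?thesis using False unfolding s K by simp
      qed
    qed simp
    also have "\<dots> = - ((- 1) ^ below j J * inverse (c j))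
        * (\<Sum>k\<in>J. (- 1) ^ below k ?K * c k * U (?K - {k}))"
      by (simp only: sum_distrib_left)
    also have "\<dots> = ((- 1) ^ below j J * inverse (c j)) * ((- 1) ^ below j J * c j * U J)"
      using 0 by (simp add: eq_neg_iff_add_eq_0[symmetric])
    also have "\<dots> = U J" using cancel[of "below j J" j "U J"] by (simp only: mult_ac)
    finally show ?thesis by (simp add: U_def)
  qed
qed

text \<open>In weights with a free index this is \<open>dop_hop\<close>. In the others
  \<open>hop\<close> is 0, and \<open>u\<close> could be nonzero only at the exponents where it
  vanishes by assumption.\<close>

lemma tform_exact:
  assumes q: "q \<noteq> 0" and closed: "dop q n u = (\<lambda>\<alpha> J. 0)"
    and u: "tform n l m s u" and M: "M = int m * int l"
    and top: "\<And>I. I \<subseteq> {1..n} \<Longrightarrow> card I = s \<Longrightarrow> u (topexp M I) I = 0"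
  shows "dop q n (hop q n M u) = u"
proof (rule supported_eqI)
  show "supported n (dop q n (hop q n M u))" "supported n u"
    using tform_supported[OF u] by (simp_all add: supported_dop supported_hop)
  fix \<gamma> J assume J: "J \<subseteq> {1..n}" and ex: "sh J \<gamma> \<in> exps n"
  show "dop q n (hop q n M u) (sh J \<gamma>) J = u (sh J \<gamma>) J"
  proof (cases "has_free n M \<gamma>")
    case True
    then show ?thesis using dop_hop[OF q closed J ex] by simp
  next
    case False
    have "u (sh J \<gamma>) J = 0"
    proof (rule ccontr)
      assume nz: "u (sh J \<gamma>) J \<noteq> 0"
      with u have t: "sh J \<gamma> \<in> trunc_exps n l m" "card J = s" unfolding tform_def by blast+
      \<comment> \<open>Each \<gamma>_t is \<le> 0 or \<ge> M. The range 0..M-1 of the exponent then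
        forces \<gamma>_t = 0 with t outside \<open>J\<close>, or \<gamma>_t = M with t in
        \<open>J\<close>.\<close>
      have "sh J \<gamma> t = topexp M J t" for t
      proof (cases "t \<in> {1..n}")
        case True
        then have "0 \<le> sh J \<gamma> t" "sh J \<gamma> t \<le> M - 1" "\<not> (0 < \<gamma> t \<and> \<gamma> t < M)"
          using t(1) False unfolding M by (auto simp: trunc_exps_def exps_def has_free_def)
        then show ?thesis by (auto simp: sh_def topexp_def of_bool_def split: if_splits)
      next
        case False
        then show ?thesis using J ex by (auto simp: topexp_def exps_def)
      qed
      then have "sh J \<gamma> = topexp M J" by (rule ext)
      then show False using top[OF J t(2)] nz by simp
    qed
    moreover have "dop q n (hop q n M u) (sh J \<gamma>) J = 0"
      using False by (simp add: dop_sh[OF q J ex] hop_sh)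
    ultimately show ?thesis by simp
  qed
qed

text \<open>Degree 0 has no factor to contract. With \<open>tform_exact\<close> this shows that a
  cocycle of degree 0 with vanishing top coefficients is zero, in accordance with
  \<open>coboundaries\<close> for \<open>s = 0\<close>.\<close>

lemma hop_degree_0:
  assumes "tform n l m 0 u"
  shows "hop q n M u = (\<lambda>\<alpha> I. 0)"
proof (intro ext, rule ccontr)
  fix \<alpha> I assume "hop q n M u \<alpha> I \<noteq> 0"
  then obtain j \<gamma> where "u (sh (insert j I) \<gamma>) (insert j I) \<noteq> 0" by (rule hop_nonzero)
  then have "insert j I \<subseteq> {1..n}" "card (insert j I) = 0" using assms unfolding tform_def by blast+
  then show False using finite_subset[of "insert j I" "{1..n}"] by auto
qed

section \<open>The action on cohomology\<close>

definition char_module :: "('r \<Rightarrow> 'k::field) \<Rightarrow> ('r, 'k) module" where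
  "char_module \<chi> = \<lparr>carrier = UNIV, mult = undefined, one = undefined, zero = 0, add = (+),
     smult = (\<lambda>r v. \<chi> r * v)\<rparr>"

lemma char_module_simps [simp]:
  "carrier (char_module \<chi>) = UNIV" "\<zero>\<^bsub>char_module \<chi>\<^esub> = 0"
  "x \<oplus>\<^bsub>char_module \<chi>\<^esub> y = x + y" "r \<odot>\<^bsub>char_module \<chi>\<^esub> x = \<chi> r * x"
  by (simp_all add: char_module_def)

lemma left_module_char_module:
  assumes "ring R"
    and "\<And>a b. a \<in> carrier R \<Longrightarrow> b \<in> carrier R \<Longrightarrow> \<chi> (a \<oplus>\<^bsub>R\<^esub> b) = \<chi> a + \<chi> b"
    and "\<And>a b. a \<in> carrier R \<Longrightarrow> b \<in> carrier R \<Longrightarrow> \<chi> (a \<otimes>\<^bsub>R\<^esub> b) = \<chi> a * \<chi> b"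
    and "\<chi> \<one>\<^bsub>R\<^esub> = 1"
  shows "left_module R (char_module \<chi>)"
proof (intro left_module.intro left_module_axioms.intro)
  show "abelian_group (char_module \<chi>)"
  proof (rule abelian_groupI)
    fix x assume "x \<in> carrier (char_module \<chi>)"
    show "\<exists>y\<in>carrier (char_module \<chi>). y \<oplus>\<^bsub>char_module \<chi>\<^esub> x = \<zero>\<^bsub>char_module \<chi>\<^esub>"
      by (rule bexI[of _ "- x"]) simp_all
  qed (simp_all add: add_ac)
qed (use assms in \<open>simp_all add: distrib_left distrib_right mult.assoc\<close>)

lemma direct_sum_simps [simp]:
  "carrier (direct_sum N M) = (\<Pi>\<^sub>E j\<in>{..<N}. carrier (M j))"
  "\<zero>\<^bsub>direct_sum N M\<^esub> = (\<lambda>j\<in>{..<N}. \<zero>\<^bsub>M j\<^esub>)"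
  "f \<oplus>\<^bsub>direct_sum N M\<^esub> g = (\<lambda>j\<in>{..<N}. f j \<oplus>\<^bsub>M j\<^esub> g j)"
  "a \<odot>\<^bsub>direct_sum N M\<^esub> f = (\<lambda>j\<in>{..<N}. a \<odot>\<^bsub>M j\<^esub> f j)"
  by (simp_all add: direct_sum_def)

lemma left_module_direct_sum:
  assumes "ring R" and M: "\<And>j. j < N \<Longrightarrow> left_module R (M j)"
  shows "left_module R (direct_sum N M)"
proof (intro left_module.intro left_module_axioms.intro)
  have ag: "abelian_group (M j)" if "j < N" for j
    using M[OF that] by (rule left_module.axioms)
  note am = abelian_group.axioms(1)[OF ag]
  note PiE = PiE_iff extensional_def
  show "abelian_group (direct_sum N M)"
  proof (rule abelian_groupI)
    fix x assume x: "x \<in> carrier (direct_sum N M)"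
    show "\<exists>y\<in>carrier (direct_sum N M). y \<oplus>\<^bsub>direct_sum N M\<^esub> x = \<zero>\<^bsub>direct_sum N M\<^esub>"
      using x by (intro bexI[of _ "\<lambda>j\<in>{..<N}. \<ominus>\<^bsub>M j\<^esub> x j"])
        (auto simp: PiE fun_eq_iff ag abelian_group.l_neg[OF ag] abelian_group.a_inv_closed[OF ag])
  qed (auto simp: PiE fun_eq_iff restrict_def abelian_monoid.a_closed[OF am]
      abelian_monoid.zero_closed[OF am] abelian_monoid.a_assoc[OF am]
      abelian_monoid.a_comm[OF am] abelian_monoid.a_lcomm[OF am]
      abelian_monoid.l_zero[OF am] abelian_monoid.r_zero[OF am])
  show "\<one>\<^bsub>R\<^esub> \<odot>\<^bsub>direct_sum N M\<^esub> x = x" if "x \<in> carrier (direct_sum N M)" for x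
    using that left_module.left_smult_one[OF M] by (auto simp: PiE fun_eq_iff)
  fix a b x y
  assume a: "a \<in> carrier R" and x: "x \<in> carrier (direct_sum N M)"
  then have x': "x j \<in> carrier (M j)" if "j < N" for j using that by (auto simp: PiE)
  show "a \<odot>\<^bsub>direct_sum N M\<^esub> x \<in> carrier (direct_sum N M)"
    using a x' left_module.left_smult_closed[OF M] by auto
  show "(a \<oplus>\<^bsub>R\<^esub> b) \<odot>\<^bsub>direct_sum N M\<^esub> x
      = a \<odot>\<^bsub>direct_sum N M\<^esub> x \<oplus>\<^bsub>direct_sum N M\<^esub> b \<odot>\<^bsub>direct_sum N M\<^esub> x"
    "(a \<otimes>\<^bsub>R\<^esub> b) \<odot>\<^bsub>direct_sum N M\<^esub> x = a \<odot>\<^bsub>direct_sum N M\<^esub> (b \<odot>\<^bsub>direct_sum N M\<^esub> x)"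
    if "b \<in> carrier R"
    using a that x' left_module.left_smult_l_distr[OF M] left_module.left_smult_assoc[OF M]
    by (auto simp: fun_eq_iff)
  show "a \<odot>\<^bsub>direct_sum N M\<^esub> (x \<oplus>\<^bsub>direct_sum N M\<^esub> y)
      = a \<odot>\<^bsub>direct_sum N M\<^esub> x \<oplus>\<^bsub>direct_sum N M\<^esub> a \<odot>\<^bsub>direct_sum N M\<^esub> y"
    if "y \<in> carrier (direct_sum N M)"
    using a that x' left_module.left_smult_r_distr[OF M] by (auto simp: fun_eq_iff PiE)
qed (use assms in auto)

text \<open>The axioms are pulled back along \<open>h\<close>. For \<open>M\<close> only closure and
  compatibility with \<open>h\<close> remain, so no relation has to be verified on forms.\<close>

lemma left_module_transfer:
  assumes N: "left_module R N" and h: "bij_betw h (carrier M) (carrier N)"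
    and add: "\<And>x y. x \<in> carrier M \<Longrightarrow> y \<in> carrier M \<Longrightarrow> x \<oplus>\<^bsub>M\<^esub> y \<in> carrier M"
      "\<And>x y. x \<in> carrier M \<Longrightarrow> y \<in> carrier M \<Longrightarrow> h (x \<oplus>\<^bsub>M\<^esub> y) = h x \<oplus>\<^bsub>N\<^esub> h y"
    and zero: "\<zero>\<^bsub>M\<^esub> \<in> carrier M" "h \<zero>\<^bsub>M\<^esub> = \<zero>\<^bsub>N\<^esub>"
    and smult: "\<And>a x. a \<in> carrier R \<Longrightarrow> x \<in> carrier M \<Longrightarrow> a \<odot>\<^bsub>M\<^esub> x \<in> carrier M"
      "\<And>a x. a \<in> carrier R \<Longrightarrow> x \<in> carrier M \<Longrightarrow> h (a \<odot>\<^bsub>M\<^esub> x) = a \<odot>\<^bsub>N\<^esub> h x"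
  shows "left_module R M"
proof -
  interpret N: left_module R N by (rule N)
  have hc: "h x \<in> carrier N" if "x \<in> carrier M" for x
    using h that by (auto simp: bij_betw_def)
  have eqI: "x = y" if "x \<in> carrier M" "y \<in> carrier M" "h x = h y" for x y
    using h that by (auto simp: bij_betw_def dest: inj_onD)
  show ?thesis
  proof (intro left_module.intro left_module_axioms.intro)
    show "abelian_group M"
    proof (rule abelian_groupI)
      fix x assume x: "x \<in> carrier M"
      have "\<ominus>\<^bsub>N\<^esub> h x \<in> h ` carrier M"
        using hc[OF x] h by (simp add: bij_betw_def)
      then obtain y where y: "y \<in> carrier M" "h y = \<ominus>\<^bsub>N\<^esub> h x" by force
      then have "y \<oplus>\<^bsub>M\<^esub> x = \<zero>\<^bsub>M\<^esub>"
        using x by (intro eqI) (simp_all add: add zero hc N.l_neg)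
      then show "\<exists>y\<in>carrier M. y \<oplus>\<^bsub>M\<^esub> x = \<zero>\<^bsub>M\<^esub>" using y(1) by blast
    qed (auto intro!: eqI simp: add zero hc N.M.a_ac)
    show "ring R" by (rule N.R.ring_axioms)
  qed (auto intro!: eqI simp: add smult hc N.left_smult_l_distr N.left_smult_r_distr
    N.left_smult_assoc N.left_smult_one)
qed

text \<open>How the generators act on the class belonging to \<open>I\<close>, with \<open>e\<close>
  = q^(ml): the top weight is ml on \<open>I\<close> and 0 elsewhere, so K_i acts by a power of
  \<open>e\<close> with exponent [i in I] - [i+1 in I].\<close>

fun chi :: "'k::field \<Rightarrow> nat set \<Rightarrow> ugen \<Rightarrow> 'k" where
  "chi e I (E i) = 0"
| "chi e I (F i) = 0"
| "chi e I (K i) = e powi (of_bool (i \<in> I) - of_bool (Suc i \<in> I))"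
| "chi e I (Ki i) = e powi (- (of_bool (i \<in> I) - of_bool (Suc i \<in> I)))"

definition chiw :: "'k::field \<Rightarrow> nat set \<Rightarrow> ugen list \<Rightarrow> 'k" where
  "chiw e I w = prod_list (map (chi e I) w)"

lemma chiw_simps [simp]:
  "chiw e I [] = 1" "chiw e I (g # w) = chi e I g * chiw e I w" "chiw e I (u @ v) = chiw e I u * chiw e I v"
  by (simp_all add: chiw_def)

lemma chi_K_cases:
  assumes "e * e = (1 :: 'k::field)"
  obtains "chi e I (K i) = 1" "chi e I (Ki i) = 1" | "chi e I (K i) = e" "chi e I (Ki i) = e"
proof -
  have "inverse e = e" using assms by (simp add: inverse_unique)
  then show ?thesis
    using that by (cases "i \<in> I"; cases "Suc i \<in> I") (simp_all add: power_int_minus)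
qed

text \<open>As \<open>E\<close> and \<open>F\<close> go to 0, only relations in the \<open>K\<close>
  alone and the commutator of \<open>E i\<close> and \<open>F i\<close> need attention. The latter
  holds because \<open>K i\<close> and \<open>Ki i\<close> have the same value, of square 1.\<close>

lemma lin_chiw_Uq_rels:
  assumes e: "e * e = (1 :: 'k::field)" and "x \<in> Uq_rels q n"
  shows "lin (chiw e I) x = 0"
proof -
  have *: "chi e I (K i) = chi e I (Ki i)" "chi e I (Ki i) * chi e I (Ki i) = 1" for i
    by (rule chi_K_cases[OF e, of I i]; simp add: e del: chi.simps(3,4))+
  note [simp del] = chi.simps(3,4)
  from assms(2) show ?thesis
    by cases (simp_all add: * mult_single right_diff_distrib zero_list_def)
qed

lemma lin_chiw_small_rels:
  assumes e: "e * e = (1 :: 'k::field)" and "l \<ge> 1" "x \<in> small_rels q n l"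
  shows "lin (chiw e I) x = 0"
proof -
  have "chi e I (K i) * chi e I (K i) = 1" for i
    by (rule chi_K_cases[OF e, of I i]; simp add: e del: chi.simps(3,4))
  then have "chi e I (K i) ^ (2 * l) = 1" for i
    by (simp add: power_mult power2_eq_square del: chi.simps(3,4))
  then show ?thesis
    using assms lin_chiw_Uq_rels[OF e]
    by (auto simp: small_rels_def chiw_def zero_list_def simp del: chi.simps(3,4))
qed

section \<open>Cohomology classes and their top coefficients\<close>

locale de_rham = quantum_exterior q n for q :: "'k::field_char_0" and n +
  fixes l m s :: nat
  assumes q_diff: "q - inverse q \<noteq> 0" and qchar: "has_qchar q l" and l2: "l \<ge> 2" and m1: "m \<ge> 1"
begin

declare Omega_simps [simp del]

definition M :: int where "M = int m * int l"
definition e :: 'k where "e = q powi M"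

lemma M2: "M \<ge> 2"
  using mult_mono[of 1 "int m" 2 "int l"] l2 m1 by (simp add: M_def)

lemma ql_sq: "q ^ l * q ^ l = 1"
proof -
  have "qint q (int l) = 0" using qchar by (simp add: has_qchar_def)
  then have "q ^ l = inverse (q ^ l)" using q_diff by (simp add: qint_def power_int_minus)
  then show ?thesis using q_nonzero by (metis power_not_zero right_inverse)
qed

lemma e_eq: "e = (q ^ l) ^ m"
proof -
  have "int m * int l = int (l * m)" by simp
  then show ?thesis by (simp only: e_def M_def power_int_of_nat power_mult)
qed

lemma e_sq: "e * e = 1"
proof -
  have "e * e = (q ^ l * q ^ l) ^ m" by (simp only: e_eq power_mult_distrib)
  then show ?thesis by (simp only: ql_sq power_one)
qed

lemma qM: "qint q M = 0"
proof -
  have "inverse e = e" using e_sq by (simp add: inverse_unique)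
  then show ?thesis by (simp add: qint_def power_int_minus flip: e_def)
qed

sublocale U: presentation "uq_gens n" "small_rels q n l"
proof
  show "small_rels q n l \<subseteq> carrier (free_algebra (uq_gens n))"
  proof
    fix x :: "ugen list \<Rightarrow>\<^sub>0 'k" assume x: "x \<in> small_rels q n l"
    have U: "x \<in> carrier (free_algebra (uq_gens n))" if "x \<in> Uq_rels q n"
      using that by cases (auto intro!: free_closed simp: uq_gens_def)
    have r: "set (replicate k g) \<subseteq> uq_gens n" if "g \<in> uq_gens n" for k g
      using that by auto
    show "x \<in> carrier (free_algebra (uq_gens n))"
      using x U unfolding small_rels_def
      by (auto intro!: free_closed r simp: uq_gens_def)
  qed
qed

lemma U_eq: "U.Pr = small_uq q n l" "U.cl = uq_class q n l"
  by (simp_all add: small_uq_def uq_class_def fun_eq_iff)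

lemma lin_chiw_Rel: "x \<in> U.Rel \<Longrightarrow> lin (chiw e I) x = 0"
proof (induction x rule: genideal_free_algebra_induct[OF _ U.rels,
      consumes 1, case_names rel zero add uminus mult_left mult_right])
  case (rel x)
  then show ?case using lin_chiw_small_rels[OF e_sq _ rel] l2 by simp
qed (simp_all add: lin_mult_hom)

definition chr :: "nat set \<Rightarrow> (ugen list \<Rightarrow>\<^sub>0 'k) set \<Rightarrow> 'k" where
  "chr I r = lin (chiw e I) (SOME a. a \<in> r)"

lemma chr_cl: "a \<in> carrier U.Fr \<Longrightarrow> chr I (U.cl a) = lin (chiw e I) a"
  using U.cl_some(2)[of a] lin_chiw_Rel[of "(SOME x. x \<in> U.cl a) - a" I] by (simp add: chr_def)

lemma left_module_chr: "left_module (small_uq q n l) (char_module (chr I))"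
proof (rule left_module_char_module)
  show "ring (small_uq q n l)" using U.Pr.ring_axioms by (simp add: U_eq)
  show "chr I \<one>\<^bsub>small_uq q n l\<^esub> = 1"
    by (simp add: U.cl_one chr_cl zero_list_def flip: U_eq)
qed (auto simp: U.carrier_Pr U.cl_add U.cl_mult chr_cl free_add free_mult lin_mult_hom simp flip: U_eq)

lemma finite_trunc_exps: "finite (trunc_exps n l m)"
proof -
  have "finite {f. \<forall>x. (x \<in> {1..n} \<longrightarrow> f x \<in> {0..M - 1}) \<and> (x \<notin> {1..n} \<longrightarrow> f x = 0)}"
    by (rule finite_set_of_finite_funs) auto
  then show ?thesis
    by (rule rev_finite_subset) (auto simp: trunc_exps_def exps_def M_def)
qed

lemma Omega_mod_iff:
  "f \<in> carrier (Omega_mod q n l m k) \<longleftrightarrow> f \<in> carrier (Omega q n) \<and> tform n l m k (co f)"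
proof (cases "f \<in> carrier (Omega q n)")
  case True
  have "supp q n f \<subseteq> trunc_exps n l m \<longleftrightarrow> (\<forall>\<alpha> J. co f \<alpha> J \<noteq> 0 \<longrightarrow> \<alpha> \<in> trunc_exps n l m)"
    unfolding supp_co[OF True] by auto
  moreover have "(\<forall>\<alpha>. f \<alpha> \<in> wedge_deg q n k) \<longleftrightarrow> (\<forall>\<alpha> J. co f \<alpha> J \<noteq> 0 \<longrightarrow> card J = k)"
    using Omega_app[OF True] by (simp add: wedge_deg_iff co_def)
  ultimately show ?thesis
    using True co_supp[OF True] by (auto simp: Omega_mod_def tform_def)
qed (simp add: Omega_mod_def)

lemma tform_surj:
  assumes "tform n l m k u"
  obtains f where "f \<in> carrier (Omega_mod q n l m k)" "co f = u"
proof -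
  have u: "\<alpha> \<in> trunc_exps n l m" "\<alpha> \<in> exps n" "J \<subseteq> {1..n}" if "u \<alpha> J \<noteq> 0" for \<alpha> J
    using assms that unfolding tform_def trunc_exps_def by blast+
  have "finite {\<alpha>. \<exists>J. u \<alpha> J \<noteq> 0}"
    using finite_trunc_exps by (rule rev_finite_subset) (use u in blast)
  then obtain f where "f \<in> carrier (Omega q n)" "co f = u"
    using co_surj[of u] u by blast
  then show thesis using assms that by (simp add: Omega_mod_iff)
qed

lemma co_eq_zero_iff:
  assumes "f \<in> carrier (Omega q n)"
  shows "f = \<zero>\<^bsub>Omega q n\<^esub> \<longleftrightarrow> co f = (\<lambda>\<alpha> J. 0)"
proof -
  have "co \<zero>\<^bsub>Omega q n\<^esub> = (\<lambda>\<alpha> J. 0)" by (intro ext co_zero)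
  then show ?thesis using co_inj[OF assms Omega_zero_closed] by metis
qed

abbreviation "Z \<equiv> cocycles q n l m s"
abbreviation "B \<equiv> coboundaries q n l m s"

lemma cocycle_iff: "f \<in> Z \<longleftrightarrow>
    f \<in> carrier (Omega q n) \<and> tform n l m s (co f) \<and> dop q n (co f) = (\<lambda>\<alpha> J. 0)"
proof (cases "f \<in> carrier (Omega q n)")
  case True
  have "co (dOmega q n f) = dop q n (co f)" by (intro ext co_dOmega True)
  then show ?thesis
    using co_eq_zero_iff[OF dOmega_closed[OF True]] by (simp add: cocycles_def Omega_mod_iff)
qed (simp add: cocycles_def Omega_mod_iff)

definition tp :: "'k form \<Rightarrow> nat set \<Rightarrow> 'k" where
  "tp f I = co f (topexp M I) I"

definition idx :: "nat set set" where
  "idx = {I. I \<subseteq> {1..n} \<and> card I = s}"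

lemma idxD: "I \<in> idx \<Longrightarrow> I \<subseteq> {1..n}"
  by (simp add: idx_def)

lemma dop_zero: "dop q n (\<lambda>\<alpha> J. 0) = (\<lambda>\<alpha> J. 0)"
  by (intro ext) (auto simp: dop_def lmul_def intro!: sum.neutral)

lemma dop_add: "dop q n (\<lambda>\<alpha> J. u \<alpha> J + v \<alpha> J) = (\<lambda>\<alpha> J. dop q n u \<alpha> J + dop q n v \<alpha> J)"
  by (intro ext) (auto simp: dop_def lmul_def distrib_left simp flip: sum.distrib intro!: sum.cong)

lemma dop_scale: "dop q n (\<lambda>\<alpha> J. c * u \<alpha> J) = (\<lambda>\<alpha> J. c * dop q n u \<alpha> J)"
  by (intro ext) (auto simp: dop_def lmul_def sum_distrib_left mult_ac intro!: sum.cong)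

lemma Z_carrier: "f \<in> Z \<Longrightarrow> f \<in> carrier (Omega q n)"
  by (simp add: cocycle_iff)

lemma Z_zero: "\<zero>\<^bsub>Omega q n\<^esub> \<in> Z"
proof -
  have "co \<zero>\<^bsub>Omega q n\<^esub> = (\<lambda>\<alpha> J. 0)" by (intro ext co_zero)
  then show ?thesis using Omega_zero_closed by (simp add: cocycle_iff dop_zero tform_def)
qed

lemma Z_add:
  assumes "f \<in> Z" "g \<in> Z"
  shows "f \<oplus>\<^bsub>Omega q n\<^esub> g \<in> Z"
proof -
  have "co (f \<oplus>\<^bsub>Omega q n\<^esub> g) = (\<lambda>\<alpha> J. co f \<alpha> J + co g \<alpha> J)"
    using assms by (intro ext co_add Z_carrier)
  moreover have "tform n l m s (\<lambda>\<alpha> J. co f \<alpha> J + co g \<alpha> J)"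
    unfolding tform_def
  proof (intro allI impI)
    fix \<alpha> J assume "co f \<alpha> J + co g \<alpha> J \<noteq> 0"
    then have "co f \<alpha> J \<noteq> 0 \<or> co g \<alpha> J \<noteq> 0" by auto
    then show "\<alpha> \<in> trunc_exps n l m \<and> J \<subseteq> {1..n} \<and> card J = s"
      using assms unfolding cocycle_iff tform_def by blast
  qed
  ultimately show ?thesis
    using assms by (simp add: cocycle_iff Omega_add_closed dop_add)
qed

lemma Z_smult:
  assumes "f \<in> Z"
  shows "c \<odot>\<^bsub>Omega q n\<^esub> f \<in> Z"
proof -
  have "co (c \<odot>\<^bsub>Omega q n\<^esub> f) = (\<lambda>\<alpha> J. c * co f \<alpha> J)"
    using assms by (intro ext co_smult Z_carrier)
  moreover have "tform n l m s (\<lambda>\<alpha> J. c * co f \<alpha> J)"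
    unfolding tform_def
  proof (intro allI impI)
    fix \<alpha> J assume "c * co f \<alpha> J \<noteq> 0"
    then have "co f \<alpha> J \<noteq> 0" by simp
    then show "\<alpha> \<in> trunc_exps n l m \<and> J \<subseteq> {1..n} \<and> card J = s"
      using assms unfolding cocycle_iff tform_def by blast
  qed
  ultimately show ?thesis
    using assms by (simp add: cocycle_iff Omega_smult_closed dop_scale)
qed

lemma Z_finsum:
  assumes "\<And>x. x \<in> A \<Longrightarrow> h x \<in> Z"
  shows "(\<Oplus>\<^bsub>Omega q n\<^esub>x\<in>A. h x) \<in> Z"
  using assms
proof (induction A rule: infinite_finite_induct)
  case (insert x A)
  then have "(\<Oplus>\<^bsub>Omega q n\<^esub>x\<in>insert x A. h x) = h x \<oplus>\<^bsub>Omega q n\<^esub> (\<Oplus>\<^bsub>Omega q n\<^esub>x\<in>A. h x)"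
    by (intro Om.finsum_insert) (auto intro: Z_carrier)
  then show ?case using insert by (simp add: Z_add)
qed (simp_all add: Z_zero Om.finsum_infinite)

text \<open>Coboundaries have no top coefficients by \<open>dop_topexp\<close>; conversely,
  \<open>hop\<close> supplies a primitive inside the truncated complex by
  \<open>tform_exact\<close>. So cohomology is the space of top coefficient vectors.\<close>

lemma coboundary_iff: "f \<in> B \<longleftrightarrow> f \<in> Z \<and> (\<forall>I\<in>idx. tp f I = 0)"
proof
  assume f: "f \<in> B"
  show "f \<in> Z \<and> (\<forall>I\<in>idx. tp f I = 0)"
  proof (cases "s = 0")
    case True
    then show ?thesis using f Z_zero by (simp add: coboundaries_def tp_def co_zero)
  next
    case False
    then obtain g where g: "g \<in> carrier (Omega_mod q n l m (s - 1))" "f = dOmega q n g"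
      using f by (auto simp: coboundaries_def)
    then have g': "g \<in> carrier (Omega q n)" "tform n l m (s - 1) (co g)"
      by (simp_all add: Omega_mod_iff)
    have co: "co f = dop q n (co g)" unfolding g(2) by (intro ext co_dOmega g')
    have "tform n l m s (co f)"
      using tform_dop[OF g'(2), of q] False unfolding co by simp
    moreover have "f \<in> carrier (Omega q n)" unfolding g(2) by (rule dOmega_closed[OF g'(1)])
    moreover have "dop q n (co f) = (\<lambda>\<alpha> J. 0)"
      unfolding co by (rule dop_dop[OF q_nonzero tform_supported[OF g'(2)]])
    ultimately have "f \<in> Z" unfolding cocycle_iff by blast
    moreover have "tp f I = 0" if "I \<in> idx" for I
      unfolding tp_def co using q_nonzero g'(2) M_def idxD[OF that] by (rule dop_topexp)
    ultimately show ?thesis by simp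
  qed
next
  assume "f \<in> Z \<and> (\<forall>I\<in>idx. tp f I = 0)"
  then have f: "f \<in> carrier (Omega q n)" "tform n l m s (co f)" "dop q n (co f) = (\<lambda>\<alpha> J. 0)"
    and tp: "\<And>I. I \<subseteq> {1..n} \<Longrightarrow> card I = s \<Longrightarrow> co f (topexp M I) I = 0"
    by (auto simp: cocycle_iff tp_def idx_def)
  have ex: "dop q n (hop q n M (co f)) = co f"
    by (rule tform_exact[OF q_nonzero f(3,2) M_def tp])
  show "f \<in> B"
  proof (cases s)
    case 0
    have "tform n l m 0 (co f)" using f(2) 0 by simp
    then have "hop q n M (co f) = (\<lambda>\<alpha> I. 0)" by (rule hop_degree_0)
    then have "co f = (\<lambda>\<alpha> J. 0)" using ex dop_zero by simp
    then have "f = \<zero>\<^bsub>Omega q n\<^esub>" unfolding co_eq_zero_iff[OF f(1)] .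
    then show ?thesis using 0 unfolding coboundaries_def by simp
  next
    case (Suc k)
    then have "tform n l m k (hop q n M (co f))"
      using f(2) by (intro tform_hop[OF _ M_def]) simp
    then obtain g where g: "g \<in> carrier (Omega_mod q n l m k)" "co g = hop q n M (co f)"
      by (rule tform_surj)
    then have g': "g \<in> carrier (Omega q n)" by (simp add: Omega_mod_iff)
    have "co (dOmega q n g) = dop q n (co g)" by (intro ext co_dOmega g')
    then have "co (dOmega q n g) = co f" by (simp only: g(2) ex)
    then have "dOmega q n g = f" using g' f(1) by (intro co_inj dOmega_closed)
    then show ?thesis using g(1) Suc by (auto simp: coboundaries_def)
  qed
qed

lemma gen_Z:
  assumes g: "g \<in> uq_gens n" and f: "f \<in> Z"
  shows "Omega_gen q n g f \<in> Z"
proof -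
  have fc: "f \<in> carrier (Omega q n)" "tform n l m s (co f)" "dop q n (co f) = (\<lambda>\<alpha> J. 0)"
    using f by (simp_all add: cocycle_iff)
  have co: "co (Omega_gen q n g f) = gop q n g (co f)" by (intro ext co_Omega_gen g fc)
  have "gop q n g (\<lambda>\<alpha> J. 0) = (\<lambda>\<alpha> J. 0)" by (cases g) (auto simp: fun_eq_iff)
  then have "dop q n (gop q n g (co f)) = (\<lambda>\<alpha> J. 0)"
    using dop_gop[OF q_nonzero q_diff tform_supported[OF fc(2)] g] fc(3) by simp
  moreover have "tform n l m s (gop q n g (co f))"
    using fc(2) g qM unfolding M_def by (rule tform_gop)
  ultimately show ?thesis using Omega_gen_closed[OF g fc(1)] by (simp add: cocycle_iff co)
qed

text \<open>Closedness of \<open>f\<close> is essential for \<open>E\<close> and \<open>F\<close>,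
  whose action on top coefficients vanishes only modulo the cocycle condition.\<close>

lemma gen_tp:
  assumes g: "g \<in> uq_gens n" and f: "f \<in> Z" and I: "I \<subseteq> {1..n}"
  shows "tp (Omega_gen q n g f) I = chi e I g * tp f I"
proof -
  have fc: "f \<in> carrier (Omega q n)" "tform n l m s (co f)" "dop q n (co f) = (\<lambda>\<alpha> J. 0)"
    using f by (simp_all add: cocycle_iff)
  have ex: "topexp M I \<in> exps n" using M2 I by (intro topexp_exps) auto
  have tw: "topw M I i - topw M I (Suc i) = M * (of_bool (i \<in> I) - of_bool (Suc i \<in> I))" for i
    by (simp add: topw_def)
  have "gop q n g (co f) (topexp M I) I = chi e I g * co f (topexp M I) I"
  proof (cases g)
    case (E i)
    then show ?thesis
      using gop_topexp_E[OF q_nonzero q_diff fc(2) M_def M2 qM fc(3) _ I] g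
      by (auto simp: uq_gens_def simp del: gop.simps)
  next
    case (F i)
    then show ?thesis
      using gop_topexp_F[OF q_nonzero q_diff fc(2) M_def M2 qM fc(3) _ I] g
      by (auto simp: uq_gens_def simp del: gop.simps)
  next
    case (K i)
    show ?thesis
      unfolding K gop_topexp_K[OF q_nonzero ex] tw chi.simps by (simp only: power_int_mult e_def)
  next
    case (Ki i)
    show ?thesis
      unfolding Ki gop_topexp_K[OF q_nonzero ex] tw chi.simps
      by (simp only: power_int_mult e_def flip: mult_minus_right)
  qed
  then show ?thesis by (simp add: tp_def co_Omega_gen[OF g fc(1)])
qed

lemma word_Z:
  assumes "f \<in> Z" "set w \<subseteq> uq_gens n"
  shows "foldr (Omega_gen q n) w f \<in> Z"
  using assms(2) by (induction w) (simp_all add: assms(1) gen_Z)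

lemma word_tp:
  assumes "f \<in> Z" "set w \<subseteq> uq_gens n" "I \<subseteq> {1..n}"
  shows "tp (foldr (Omega_gen q n) w f) I = chiw e I w * tp f I"
  using assms(2) by (induction w) (simp_all add: gen_tp word_Z assms(1,3))

lemma act_Z:
  assumes "f \<in> Z" "a \<in> carrier U.Fr"
  shows "Omega_act q n a f \<in> Z"
  unfolding Omega_act_def
  using assms by (intro Z_finsum Z_smult word_Z) (auto simp: carrier_free_algebra)

lemma act_tp:
  assumes f: "f \<in> Z" and a: "a \<in> carrier U.Fr" and I: "I \<subseteq> {1..n}"
  shows "tp (Omega_act q n a f) I = lin (chiw e I) a * tp f I"
proof -
  have w: "set w \<subseteq> uq_gens n" if "w \<in> Poly_Mapping.keys a" for w
    using a that by (auto simp: carrier_free_algebra)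
  have "tp (Omega_act q n a f) I = (\<Sum>w\<in>Poly_Mapping.keys a.
      tp (Poly_Mapping.lookup a w \<odot>\<^bsub>Omega q n\<^esub> foldr (Omega_gen q n) w f) I)"
    unfolding Omega_act_def tp_def
    by (intro co_finsum Omega_smult_closed Z_carrier word_Z f w)
  also have "\<dots> = (\<Sum>w\<in>Poly_Mapping.keys a. Poly_Mapping.lookup a w * (chiw e I w * tp f I))"
    using word_tp[OF f w I] Z_carrier[OF word_Z[OF f w]]
    by (intro sum.cong refl) (simp add: tp_def co_smult)
  also have "\<dots> = lin (chiw e I) a * tp f I"
    by (simp add: lin_def sum_distrib_right mult.assoc)
  finally show ?thesis .
qed

text \<open>The cohomology class of \<open>f\<close>, described as a fibre of the top coefficients;
  \<open>coset_eq\<close> identifies it with the coset.\<close>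

definition hcl :: "'k form \<Rightarrow> 'k form set" where
  "hcl f = {g \<in> Z. \<forall>I\<in>idx. tp g I = tp f I}"

lemma hcl_self: "f \<in> Z \<Longrightarrow> f \<in> hcl f"
  by (simp add: hcl_def)

lemma hcl_eqI: "(\<And>I. I \<in> idx \<Longrightarrow> tp f I = tp g I) \<Longrightarrow> hcl f = hcl g"
  by (auto simp: hcl_def)

lemma hcl_some:
  assumes "f \<in> Z"
  shows "(SOME x. x \<in> hcl f) \<in> Z" "I \<in> idx \<Longrightarrow> tp (SOME x. x \<in> hcl f) I = tp f I"
  using someI[of "\<lambda>x. x \<in> hcl f", OF hcl_self[OF assms]] by (auto simp: hcl_def)

lemma tp_add: "f \<in> Z \<Longrightarrow> g \<in> Z \<Longrightarrow> tp (f \<oplus>\<^bsub>Omega q n\<^esub> g) I = tp f I + tp g I"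
  by (simp add: tp_def co_add Z_carrier)

lemma Z_subtract:
  assumes "g \<in> Z" "f \<in> Z"
  obtains b where "b \<in> Z" "g = b \<oplus>\<^bsub>Omega q n\<^esub> f" "\<forall>I. tp b I = tp g I - tp f I"
proof -
  let ?f = "(- 1) \<odot>\<^bsub>Omega q n\<^esub> f"
  let ?b = "g \<oplus>\<^bsub>Omega q n\<^esub> ?f"
  have f: "?f \<in> Z" using assms(2) by (rule Z_smult)
  have b: "?b \<in> Z" using assms(1) f by (rule Z_add)
  have "g = ?b \<oplus>\<^bsub>Omega q n\<^esub> f"
    using assms f b by (intro co_inj ext)
      (simp_all add: Z_carrier Z_add co_add co_smult)
  moreover have "tp ?b I = tp g I - tp f I" for I
    using assms f by (simp add: tp_add) (simp add: tp_def co_smult Z_carrier)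
  ultimately show thesis using b that by blast
qed

abbreviation "Zm \<equiv> (Omega_mod q n l m s)\<lparr>carrier := Z\<rparr>"

lemma coset_eq:
  assumes f: "f \<in> Z"
  shows "B +>\<^bsub>Zm\<^esub> f = hcl f"
proof -
  have *: "B +>\<^bsub>Zm\<^esub> f = {b \<oplus>\<^bsub>Omega q n\<^esub> f | b. b \<in> B}"
    by (auto simp: a_r_coset_def' Omega_mod_def)
  show ?thesis
  proof
    show "B +>\<^bsub>Zm\<^esub> f \<subseteq> hcl f"
      using f unfolding * by (auto simp: hcl_def coboundary_iff tp_add Z_add)
    show "hcl f \<subseteq> B +>\<^bsub>Zm\<^esub> f"
    proof
      fix g assume g: "g \<in> hcl f"
      then have "g \<in> Z" by (simp add: hcl_def)
      then obtain b where b: "b \<in> Z" "g = b \<oplus>\<^bsub>Omega q n\<^esub> f" "\<forall>I. tp b I = tp g I - tp f I"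
        using f by (rule Z_subtract)
      then have "b \<in> B" using g by (simp add: coboundary_iff hcl_def)
      then show "g \<in> B +>\<^bsub>Zm\<^esub> f" using b(2) unfolding * by blast
    qed
  qed
qed

abbreviation "H \<equiv> cohomology q n l m s"

lemma carrier_H: "carrier H = hcl ` Z"
  using coset_eq by (auto simp: cohomology_def quotient_module_def A_RCOSETS_def')

lemma carrier_H_cases:
  assumes "C \<in> carrier H"
  obtains f where "f \<in> Z" "C = hcl f"
  using assms unfolding carrier_H by blast

lemma zero_H: "\<zero>\<^bsub>H\<^esub> = hcl \<zero>\<^bsub>Omega q n\<^esub>"
  by (auto simp: cohomology_def quotient_module_def hcl_def coboundary_iff tp_def co_zero)

lemma add_H:
  assumes "f \<in> Z" "g \<in> Z"
  shows "hcl f \<oplus>\<^bsub>H\<^esub> hcl g = hcl (f \<oplus>\<^bsub>Omega q n\<^esub> g)"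
proof -
  have *: "hcl f \<oplus>\<^bsub>H\<^esub> hcl g = {x \<oplus>\<^bsub>Omega q n\<^esub> y | x y. x \<in> hcl f \<and> y \<in> hcl g}"
    by (auto simp: cohomology_def quotient_module_def set_add_def' Omega_mod_def)
  show ?thesis
  proof
    show "hcl f \<oplus>\<^bsub>H\<^esub> hcl g \<subseteq> hcl (f \<oplus>\<^bsub>Omega q n\<^esub> g)"
      using assms unfolding * by (auto simp: hcl_def tp_add Z_add)
    show "hcl (f \<oplus>\<^bsub>Omega q n\<^esub> g) \<subseteq> hcl f \<oplus>\<^bsub>H\<^esub> hcl g"
    proof
      fix h assume h: "h \<in> hcl (f \<oplus>\<^bsub>Omega q n\<^esub> g)"
      then have "h \<in> Z" by (simp add: hcl_def)
      then obtain b where b: "b \<in> Z" "h = b \<oplus>\<^bsub>Omega q n\<^esub> g" "\<forall>I. tp b I = tp h I - tp g I"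
        using assms(2) by (rule Z_subtract)
      then have "b \<in> hcl f" using h assms by (simp add: hcl_def tp_add)
      then show "h \<in> hcl f \<oplus>\<^bsub>H\<^esub> hcl g" using b(2) hcl_self[OF assms(2)] unfolding * by blast
    qed
  qed
qed

text \<open>The action chooses a representative both of the scalar and of the class. Neither choice
  affects the top coefficients, which determine the resulting class.\<close>

lemma smult_H:
  assumes r: "r \<in> carrier (small_uq q n l)" and f: "f \<in> Z"
  obtains g where "g \<in> Z" "r \<odot>\<^bsub>H\<^esub> hcl f = hcl g" "\<forall>I\<in>idx. tp g I = chr I r * tp f I"
proof -
  obtain a where a: "a \<in> carrier U.Fr" "r = U.cl a"
    using r U.carrier_Pr by (auto simp: U_eq)
  let ?a = "SOME a. a \<in> r" and ?f = "SOME x. x \<in> hcl f"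
  have a': "?a \<in> carrier U.Fr" using U.cl_some(1)[OF a(1)] by (simp add: a(2))
  let ?g = "Omega_act q n ?a ?f"
  have g: "?g \<in> Z" using hcl_some(1)[OF f] a' by (rule act_Z)
  have "r \<odot>\<^bsub>H\<^esub> hcl f = B +>\<^bsub>Zm\<^esub> ?g"
    by (simp add: cohomology_def quotient_module_def Omega_mod_def)
  then have "r \<odot>\<^bsub>H\<^esub> hcl f = hcl ?g" by (simp only: coset_eq[OF g])
  moreover have "tp ?g I = chr I r * tp f I" if "I \<in> idx" for I
    using act_tp[OF hcl_some(1)[OF f] a' idxD[OF that]] hcl_some(2)[OF f that] by (simp add: chr_def)
  ultimately show thesis using g that by blast
qed

text \<open>The prescribed values are placed at the top exponents. The result is closed: removing j
  from a set leaves top exponent 0 at j, so a term of the differential would need exponent -1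
  there.\<close>

lemma tp_surj:
  obtains f where "f \<in> Z" "\<forall>I\<in>idx. tp f I = v I"
proof -
  define u where "u \<alpha> J = (if J \<in> idx \<and> \<alpha> = topexp M J then v J else 0)" for \<alpha> J
  have "topexp M J \<in> trunc_exps n l m" if "J \<subseteq> {1..n}" for J
    using topexp_exps[of M J n] that M2 by (auto simp: trunc_exps_def topexp_def M_def)
  then have u: "tform n l m s u" by (auto simp: tform_def u_def idx_def split: if_splits)
  have "dop q n u \<beta> J = 0" for \<beta> J
  proof (cases "\<beta> \<in> exps n")
    case True
    have "lmul q j (u (\<beta>(j := \<beta> j + 1))) J = 0" if "j \<in> {1..n}" for j
    proof (rule ccontr)
      assume "lmul q j (u (\<beta>(j := \<beta> j + 1))) J \<noteq> 0"
      then have "\<beta>(j := \<beta> j + 1) = topexp M (J - {j})"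
        by (auto simp: lmul_def u_def split: if_splits)
      from fun_cong[OF this, of j] have "\<beta> j = - 1" by (simp add: topexp_def)
      moreover have "\<beta> j \<ge> 0" using True that by (simp add: exps_def)
      ultimately show False by simp
    qed
    then show ?thesis by (simp add: dop_def)
  qed (simp add: dop_def)
  then have d: "dop q n u = (\<lambda>\<alpha> J. 0)" by (intro ext)
  from u obtain f where f: "f \<in> carrier (Omega_mod q n l m s)" "co f = u" by (rule tform_surj)
  then have "f \<in> Z" using u d by (simp add: cocycle_iff Omega_mod_iff)
  moreover have "\<forall>I\<in>idx. tp f I = v I"
    by (simp add: tp_def f(2) u_def)
  ultimately show thesis by (rule that)
qed

text \<open>The s-element subsets are enumerated, and a class goes to the list of its top
  coefficients. Each coefficient transforms by its own character; the module axioms for the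
  cohomology come from the direct sum by \<open>left_module_transfer\<close>.\<close>

lemma cohomology_iso:
  obtains J where "\<And>j. j < n choose s \<Longrightarrow> J j \<in> idx"
    "module_isomorphic (small_uq q n l) H (direct_sum (n choose s) (\<lambda>j. char_module (chr (J j))))"
proof -
  let ?N = "n choose s"
  have "card idx = ?N" unfolding idx_def using n_subsets[of "{1..n}" s] by simp
  moreover have "finite idx" unfolding idx_def by simp
  ultimately obtain J where J: "bij_betw J {..<?N} idx"
    using ex_bij_betw_nat_finite[of idx] by (auto simp: atLeast0LessThan)
  have Ji: "J j \<in> idx" if "j < ?N" for j using J that by (auto simp: bij_betw_def)
  let ?D = "direct_sum ?N (\<lambda>j. char_module (chr (J j)))"
  define h where "h C = (\<lambda>j\<in>{..<?N}. tp (SOME x. x \<in> C) (J j))" for C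
  have h: "h (hcl f) = (\<lambda>j\<in>{..<?N}. tp f (J j))" if "f \<in> Z" for f
    unfolding h_def using hcl_some(2)[OF that] Ji by (auto simp: fun_eq_iff)
  have D: "left_module (small_uq q n l) ?D"
    using U.Pr.ring_axioms left_module_chr by (intro left_module_direct_sum) (simp_all add: U_eq)
  have bij: "bij_betw h (carrier H) (carrier ?D)"
  proof (rule bij_betwI')
    fix C C' assume "C \<in> carrier H" "C' \<in> carrier H"
    then obtain f g where fg: "f \<in> Z" "C = hcl f" "g \<in> Z" "C' = hcl g"
      by (elim carrier_H_cases)
    show "h C = h C' \<longleftrightarrow> C = C'"
    proof
      assume "h C = h C'"
      then have eq: "(\<lambda>j\<in>{..<?N}. tp f (J j)) = (\<lambda>j\<in>{..<?N}. tp g (J j))"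
        unfolding fg h[OF fg(1)] h[OF fg(3)] .
      have "tp f I = tp g I" if "I \<in> idx" for I
      proof -
        have "I \<in> J ` {..<?N}" using J that by (simp add: bij_betw_def)
        then obtain j where "j < ?N" "I = J j" by auto
        then show ?thesis using fun_cong[OF eq, of j] by simp
      qed
      then show "C = C'" unfolding fg by (rule hcl_eqI)
    qed simp
  next
    fix C assume "C \<in> carrier H"
    then show "h C \<in> carrier ?D" by (simp add: h_def)
  next
    fix y assume y: "y \<in> carrier ?D"
    obtain f where f: "f \<in> Z" "\<forall>I\<in>idx. tp f I = y (the_inv_into {..<?N} J I)"
      by (rule tp_surj[of "\<lambda>I. y (the_inv_into {..<?N} J I)"])
    have "tp f (J j) = y j" if "j < ?N" for j
      using bspec[OF f(2) Ji[OF that]] the_inv_into_f_f[OF bij_betw_imp_inj_on[OF J], of j] that by simp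
    then have "h (hcl f) = y"
      unfolding h[OF f(1)] using y by (intro ext) (simp add: PiE_iff extensional_def)
    then show "\<exists>x\<in>carrier H. y = h x" using f(1) unfolding carrier_H by blast
  qed
  have add: "C \<oplus>\<^bsub>H\<^esub> C' \<in> carrier H \<and> h (C \<oplus>\<^bsub>H\<^esub> C') = h C \<oplus>\<^bsub>?D\<^esub> h C'"
    if "C \<in> carrier H" "C' \<in> carrier H" for C C'
  proof -
    obtain f g where fg: "f \<in> Z" "C = hcl f" "g \<in> Z" "C' = hcl g"
      using \<open>C \<in> carrier H\<close> \<open>C' \<in> carrier H\<close> by (elim carrier_H_cases)
    have "h (hcl (f \<oplus>\<^bsub>Omega q n\<^esub> g)) = h C \<oplus>\<^bsub>?D\<^esub> h C'"
      unfolding fg h[OF fg(1)] h[OF fg(3)] h[OF Z_add[OF fg(1,3)]] using fg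
      by (intro ext) (simp add: tp_add)
    then show ?thesis
      using Z_add[OF fg(1,3)] unfolding fg add_H[OF fg(1,3)] carrier_H by blast
  qed
  have smult: "a \<odot>\<^bsub>H\<^esub> C \<in> carrier H \<and> h (a \<odot>\<^bsub>H\<^esub> C) = a \<odot>\<^bsub>?D\<^esub> h C"
    if a: "a \<in> carrier (small_uq q n l)" and "C \<in> carrier H" for a C
  proof -
    obtain f where f: "f \<in> Z" "C = hcl f"
      using \<open>C \<in> carrier H\<close> by (rule carrier_H_cases)
    from a f(1) obtain g where g: "g \<in> Z" "a \<odot>\<^bsub>H\<^esub> hcl f = hcl g"
      "\<forall>I\<in>idx. tp g I = chr I a * tp f I" by (rule smult_H)
    have "h (hcl g) = a \<odot>\<^bsub>?D\<^esub> h C"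
      unfolding f h[OF f(1)] h[OF g(1)] by (intro ext) (simp add: g(3) Ji)
    then show ?thesis
      using g(1) unfolding f g(2) carrier_H by blast
  qed
  have zero: "\<zero>\<^bsub>H\<^esub> \<in> carrier H" "h \<zero>\<^bsub>H\<^esub> = \<zero>\<^bsub>?D\<^esub>"
    using Z_zero unfolding zero_H carrier_H h[OF Z_zero] by (simp_all add: tp_def co_zero)
  have "left_module (small_uq q n l) H"
    by (rule left_module_transfer[OF D bij]) (use add smult zero in blast)+
  then have "module_isomorphic (small_uq q n l) H ?D"
    unfolding module_isomorphic_def using D bij add smult by blast
  then show thesis using Ji that by blast
qed

lemma uq_gens_mem: "i \<in> {1..n-1} \<Longrightarrow> {E i, F i, K i, Ki i} \<subseteq> uq_gens n"
  by (auto simp: uq_gens_def)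

lemma chr_uq_class:
  "chr I (uq_class q n l (cst c)) = c"
  "i \<in> {1..n-1} \<Longrightarrow> chr I (uq_class q n l (mon [E i])) = 0"
  "i \<in> {1..n-1} \<Longrightarrow> chr I (uq_class q n l (mon [F i])) = 0"
  "i \<in> {1..n-1} \<Longrightarrow> chr I (uq_class q n l (mon [K i])) = chi e I (K i)"
  using uq_gens_mem[of i] by (simp_all add: chr_cl free_single flip: U_eq del: chi.simps(3,4))

lemma trivial_char_module:
  assumes "e = 1"
  shows "trivial_module q n l (char_module (chr I))"
  unfolding trivial_module_def
proof (intro conjI left_module_chr bexI[of _ 1] ballI)
  show "carrier (char_module (chr I))
      = (\<lambda>c. uq_class q n l (cst c) \<odot>\<^bsub>char_module (chr I)\<^esub> 1) ` UNIV"
    by (simp add: chr_uq_class)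
qed (simp_all add: chr_uq_class assms)

text \<open>Each K_i acts by 1 or by \<open>e\<close>, and \<open>e * e = 1\<close> leaves only 1
  and -1.\<close>

lemma sign_trivial_char_module: "sign_trivial_module q n l (char_module (chr I))"
proof -
  have "e \<in> {1, - 1}" using e_sq by (simp add: square_eq_1_iff)
  moreover have "chi e I (K i) = 1 \<or> chi e I (K i) = e" for i
    using chi_K_cases[OF e_sq, of I i] by blast
  ultimately have "chi e I (K i) \<in> {1, - 1}" for i by auto
  then have "\<exists>\<epsilon>\<in>{1, - 1}. uq_class q n l (mon [K i]) \<odot>\<^bsub>char_module (chr I)\<^esub> 1
      = uq_class q n l (cst \<epsilon>) \<odot>\<^bsub>char_module (chr I)\<^esub> 1" if "i \<in> {1..n-1}" for i
    using that by (simp add: chr_uq_class del: chi.simps(3,4))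
  moreover have "carrier (char_module (chr I))
      = (\<lambda>c. uq_class q n l (cst c) \<odot>\<^bsub>char_module (chr I)\<^esub> 1) ` UNIV"
    by (simp add: chr_uq_class)
  ultimately show ?thesis
    unfolding sign_trivial_module_def using left_module_chr[of I]
    by (intro conjI left_module_chr, rule_tac x = 1 in bexI, intro conjI ballI)
      (simp_all add: chr_uq_class del: chi.simps(3,4))
qed

end

theorem theorem4p8:
  fixes q :: "'k::{alg_closed_field, field_char_0}" and n l m s :: nat
  assumes "q \<noteq> 0" and "q \<noteq> 1" and "q \<noteq> - 1"
    and "n \<ge> 3" and "has_qchar q l" and "l \<ge> 3" and "m \<ge> 1" and "s \<le> n"
  shows "(primitive_root_of_unity q l \<or> even m \<longrightarrow>
      (\<exists>M :: nat \<Rightarrow> ((ugen list \<Rightarrow>\<^sub>0 'k) set, 'k) module.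
         (\<forall>j < n choose s. trivial_module q n l (M j)) \<and>
         module_isomorphic (small_uq q n l) (cohomology q n l m s) (direct_sum (n choose s) M)))
    \<and> (primitive_root_of_unity q (2 * l) \<and> odd m \<longrightarrow>
      (\<exists>M :: nat \<Rightarrow> ((ugen list \<Rightarrow>\<^sub>0 'k) set, 'k) module.
         (\<forall>j < n choose s. sign_trivial_module q n l (M j)) \<and>
         module_isomorphic (small_uq q n l) (cohomology q n l m s) (direct_sum (n choose s) M)))"
proof -
  have "q - inverse q \<noteq> 0"
  proof
    assume "q - inverse q = 0"
    then have "q * q = 1" using assms(1) by (simp add: field_simps)
    then show False using assms(2,3) by (simp add: square_eq_1_iff)
  qed
  then interpret de_rham q n l m s
    using assms by unfold_locales auto
  \<comment> \<open>Here \<open>e\<close> = (q^l)^m, where q^l is 1 in the first case and has square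
    1 in the second.\<close>
  have e: "e = 1" if "primitive_root_of_unity q l \<or> even m"
    using that
  proof
    assume "primitive_root_of_unity q l"
    then show ?thesis by (simp add: e_eq primitive_root_of_unity_def)
  next
    assume "even m"
    then obtain k where "m = 2 * k" by (rule evenE)
    then have "e = (q ^ l * q ^ l) ^ k"
      unfolding e_eq by (simp only: power_mult power2_eq_square)
    then show ?thesis by (simp only: ql_sq power_one)
  qed
  obtain J where J: "module_isomorphic (small_uq q n l) (cohomology q n l m s)
      (direct_sum (n choose s) (\<lambda>j. char_module (chr (J j))))"
    by (rule cohomology_iso)
  show ?thesis
  proof (intro conjI impI)
    assume "primitive_root_of_unity q l \<or> even m"
    with J show "\<exists>M :: nat \<Rightarrow> ((ugen list \<Rightarrow>\<^sub>0 'k) set, 'k) module. (\<forall>j < n choose s. trivial_module q n l (M j)) \<and>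
        module_isomorphic (small_uq q n l) (cohomology q n l m s) (direct_sum (n choose s) M)"
      by (intro exI[of _ "\<lambda>j. char_module (chr (J j))"]) (simp add: trivial_char_module e)
  next
    from J show "\<exists>M :: nat \<Rightarrow> ((ugen list \<Rightarrow>\<^sub>0 'k) set, 'k) module. (\<forall>j < n choose s. sign_trivial_module q n l (M j)) \<and>
        module_isomorphic (small_uq q n l) (cohomology q n l m s) (direct_sum (n choose s) M)"
      by (intro exI[of _ "\<lambda>j. char_module (chr (J j))"]) (simp add: sign_trivial_char_module)
  qed
qed

end
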